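(* Let $$\tilde L_\hbar=\sum_{l=0}^{m_{\tilde L}}(-\hbar)^l\partial^l\,\tilde b_{l,\hbar}(\sqrt{\hbar}\,x)\,\partial^l\quad\text{and}\quad L_\hbar=\sum_{l=0}^{m_L}(-\hbar)^l\partial^l\, b_{l,\hbar}(\sqrt{\hbar}\,x)\,\partial^l$$ be linear differential operators on $\mathcal{S}$ whose polynomial coefficients $\{\tilde b_{l,\hbar}\}_{l=0}^{m_{\tilde L}}$ and $\{b_{l,\hbar}\}_{l=0}^{m_L}$ satisfy Assumption 1 (stated in the context) with constants $\eta_{\tilde L}>0$ and $\eta_L>0$ respectively. Let $\eta=\min\{\eta_{\tilde L},\eta_L\}$. Assume further that $m_{\tilde L}\le m_L$ and that there exist constants $c_1,c_2$ such that $$|\tilde b_{l,\hbar}(x)|\le c_1\,(b_{l,\hbar}(x)+c_2)\qquad\text{for all }x\in\mathbb{R},\ 0\le l\le m_{\tilde L}\text{ and }0<\hbar<\eta.$$ Then for every $n\in\mathbb{N}$ there exist constants $C_1$ and $C_2$ such that $$\tilde L_\hbar^n\preceq_{\mathcal{S}}C_1\,(L_\hbar^n+C_2)\qquad\text{for all }0<\hbar<\eta.$$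
   Context: $\mathcal{S}=\mathcal{S}(\mathbb{R})$ is the complex Schwartz space, a dense subspace of $L^2(\mathbb{R},dx)$ with inner product $\langle u,v\rangle=\int u\bar v\,dx$; $\partial=d/dx$; $\partial^l b\,\partial^l$ means $f\mapsto\partial^l(b\cdot\partial^lf)$. Order: an operator $A$ is symmetric on $\mathcal{S}$ if $\mathcal{S}\subseteq\mathcal{D}(A)$ and $\langle A\psi,\psi\rangle=\langle\psi,A\psi\rangle$ for all $\psi\in\mathcal{S}$. $A\preceq_{\mathcal{S}}B$ means that $A$ and $B$ are both symmetric on $\mathcal{S}$ and $\langle A\psi,\psi\rangle\le\langle B\psi,\psi\rangle$ for all $\psi\in\mathcal{S}$. Assumption 1 (for a family of real polynomials $\{b_{l,\hbar}\}_{l=0}^m$, $\hbar>0$, with $m\in\mathbb{N}_0$, and a number $\eta>0$): (1) for $0\le l\le m$, $b_{l,\hbar}(x)=\sum_{j=0}^{2m_l}\alpha_{l,j}(\hbar)x^j$ where $m_l\in\mathbb{N}_0$ and each $\alpha_{l,j}$ is a real continuous function on $[0,\eta]$; (2) for all $0<\hbar<\eta$, $2m_l=\deg(b_{l,\hbar})\le\deg(b_{l-1,\hbar})=2m_{l-1}$ for $1\le l\le m$; (3) $\inf_{x\in\mathbb{R},\,0<\hbar<\eta}b_{m,\hbar}(x)>0$ and $\min_{0\le l\le m}\inf_{0<\hbar<\eta}\alpha_{l,2m_l}(\hbar)>0$. *)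

theory Defs
  imports "HOL-Analysis.Analysis" "HOL-Computational_Algebra.Polynomial"
begin

definition ddx :: "(real \<Rightarrow> complex) \<Rightarrow> (real \<Rightarrow> complex)" where
  "ddx f = (\<lambda>x. vector_derivative f (at x))"

definition schwartz :: "(real \<Rightarrow> complex) set" where
  "schwartz = {f. \<forall>k. (ddx ^^ k) f differentiable_on UNIV \<and>
     (\<forall>j. bounded (range (\<lambda>x. x ^ j *\<^sub>R (ddx ^^ k) f x)))}"

(* Elements of L^2(R,dx) are represented by square-integrable Borel functions;
   every class has such a representative. *)
definition L2 :: "(real \<Rightarrow> complex) set" where
  "L2 = {f. f \<in> borel_measurable lborel \<and> integrable lborel (\<lambda>x. (norm (f x))\<^sup>2)}"

definition L2_inner :: "(real \<Rightarrow> complex) \<Rightarrow> (real \<Rightarrow> complex) \<Rightarrow> complex" where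
  "L2_inner u v = (LINT x|lborel. u x * cnj (v x))"

(* A possibly unbounded operator is a map together with its domain; the values of
   the map outside the domain are irrelevant. *)
record l2_op =
  op_dom :: "(real \<Rightarrow> complex) set"
  op_app :: "(real \<Rightarrow> complex) \<Rightarrow> (real \<Rightarrow> complex)"

(* The record really describes a linear operator in L^2: the domain is a linear
   subspace of L^2, the values are in L^2, and the map is linear and well defined
   on classes modulo null sets. *)
definition linear_l2_op :: "l2_op \<Rightarrow> bool" where
  "linear_l2_op A \<longleftrightarrow>
     op_dom A \<subseteq> L2 \<and> op_app A ` op_dom A \<subseteq> L2 \<and> (\<lambda>x. 0) \<in> op_dom A \<and>
     (\<forall>u \<in> op_dom A. \<forall>v \<in> op_dom A. \<forall>a b.
        (\<lambda>x. a * u x + b * v x) \<in> op_dom A \<and>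
        (AE x in lborel. op_app A (\<lambda>x. a * u x + b * v x) x
                           = a * op_app A u x + b * op_app A v x)) \<and>
     (\<forall>u \<in> op_dom A. \<forall>v \<in> op_dom A. (AE x in lborel. u x = v x) \<longrightarrow>
        (AE x in lborel. op_app A u x = op_app A v x))"

definition op_id :: l2_op where
  "op_id = \<lparr>op_dom = L2, op_app = (\<lambda>u. u)\<rparr>"

definition op_comp :: "l2_op \<Rightarrow> l2_op \<Rightarrow> l2_op" where
  "op_comp A B = \<lparr>op_dom = {u \<in> op_dom B. op_app B u \<in> op_dom A},
                  op_app = (\<lambda>u. op_app A (op_app B u))\<rparr>"

primrec op_pow :: "l2_op \<Rightarrow> nat \<Rightarrow> l2_op" where
  "op_pow A 0 = op_id"
| "op_pow A (Suc n) = op_comp A (op_pow A n)"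

definition op_add :: "l2_op \<Rightarrow> l2_op \<Rightarrow> l2_op" where
  "op_add A B = \<lparr>op_dom = op_dom A \<inter> op_dom B,
                 op_app = (\<lambda>u x. op_app A u x + op_app B u x)\<rparr>"

definition op_scale :: "real \<Rightarrow> l2_op \<Rightarrow> l2_op" where
  "op_scale c A = \<lparr>op_dom = op_dom A, op_app = (\<lambda>u x. complex_of_real c * op_app A u x)\<rparr>"

definition symmetric_on_schwartz :: "l2_op \<Rightarrow> bool" where
  "symmetric_on_schwartz A \<longleftrightarrow>
     linear_l2_op A \<and> schwartz \<subseteq> op_dom A \<and>
     (\<forall>\<psi> \<in> schwartz. L2_inner (op_app A \<psi>) \<psi> = L2_inner \<psi> (op_app A \<psi>))"

(* By symmetry both inner products are real, so comparing real parts is comparing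
   the numbers themselves. *)
definition op_le_schwartz :: "l2_op \<Rightarrow> l2_op \<Rightarrow> bool"  (infix "\<preceq>\<^sub>S" 50) where
  "A \<preceq>\<^sub>S B \<longleftrightarrow>
     symmetric_on_schwartz A \<and> symmetric_on_schwartz B \<and>
     (\<forall>\<psi> \<in> schwartz. Re (L2_inner (op_app A \<psi>) \<psi>) \<le> Re (L2_inner (op_app B \<psi>) \<psi>))"

(* b l h is the polynomial with index l at parameter value h. The conditions only
   concern 0 < h < eta; the infima are taken in the extended reals, so that an
   infimum of an unbounded set has its usual value. *)
definition assumption1 :: "nat \<Rightarrow> (nat \<Rightarrow> real \<Rightarrow> real poly) \<Rightarrow> real \<Rightarrow> bool" where
  "assumption1 m b \<eta> \<longleftrightarrow> \<eta> > 0 \<and>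
     (\<exists>(M :: nat \<Rightarrow> nat) (\<alpha> :: nat \<Rightarrow> nat \<Rightarrow> real \<Rightarrow> real).
        (\<forall>l\<le>m. \<forall>j\<le>2 * M l. continuous_on {0..\<eta>} (\<alpha> l j)) \<and>
        (\<forall>l\<le>m. \<forall>h\<in>{0<..<\<eta>}. b l h = (\<Sum>j\<le>2 * M l. monom (\<alpha> l j h) j)) \<and>
        (\<forall>h\<in>{0<..<\<eta>}. \<forall>l\<in>{1..m}.
           degree (b l h) = 2 * M l \<and> degree (b (l - 1) h) = 2 * M (l - 1) \<and>
           degree (b l h) \<le> degree (b (l - 1) h)) \<and>
        (INF (x, h) \<in> UNIV \<times> {0<..<\<eta>}. ereal (poly (b m h) x)) > 0 \<and>
        Min ((\<lambda>l. INF h\<in>{0<..<\<eta>}. ereal (\<alpha> l (2 * M l) h)) ` {..m}) > 0)"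

definition diff_op :: "nat \<Rightarrow> (nat \<Rightarrow> real \<Rightarrow> real poly) \<Rightarrow> real \<Rightarrow> l2_op" where
  "diff_op m b h = \<lparr>op_dom = schwartz,
     op_app = (\<lambda>f x. \<Sum>l\<le>m. complex_of_real ((- h) ^ l) *
       (ddx ^^ l) (\<lambda>y. complex_of_real (poly (b l h) (sqrt h * y)) * (ddx ^^ l) f y) x)\<rparr>"

end

theory Submission
  imports Defs "HOL-Probability.Sinc_Integral"
begin

text \<open>
  Put \<open>X = sqrt h * x\<close> and \<open>D = - \<i> * sqrt h * d/dx\<close>, so that \<open>[X, D] = \<i> * h\<close> and
  \<open>L\<^sub>h = (\<Sum>l. D\<^sup>l b\<^sub>l(X) D\<^sup>l)\<close>. All constants below are uniform in \<open>h\<close>, because \<open>h\<close> enters only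
  through the bounded coefficients of the polynomials and through the commutator.

  The \<open>n\<close>-th power is a linear combination of words in \<open>X\<close> and \<open>D\<close>. Both powers are compared with
  one quadratic form, the energy \<open>\<Sum>l\<le>n*m. \<parallel>(1 + X\<^sup>2)^(w l / 2) D\<^sup>l \<psi>\<parallel>\<^sup>2\<close>, where \<open>2 * w l\<close> is the largest
  degree in \<open>x\<close> with which \<open>D\<close>-order \<open>2 * l\<close> occurs in the power of the symbol
  \<open>\<Sum>l. b\<^sub>l(x) * \<xi>^(2*l)\<close>. Since the degrees of the \<open>b\<^sub>l\<close> decrease in \<open>l\<close>, so does \<open>w\<close>.

  Moving letters past each other changes a word only by words with one \<open>X\<close> and one \<open>D\<close> fewer. Such
  a word lies strictly inside the staircase of exponents \<open>(2 * w l, 2 * l)\<close>, and there the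
  Cauchy-Schwarz inequality, lowering of the weight and interpolation between powers of \<open>D\<close> bound
  its form by \<open>\<epsilon> * energy + C * \<parallel>\<psi>\<parallel>\<^sup>2\<close> (\<open>word_form_interior\<close>). So every word may be replaced
  by its symmetric ordering \<open>D\<^sup>l X\<^sup>J D\<^sup>l\<close> at this cost (\<open>word_form_boundary\<close>).

  For the smaller operator this bounds its form by a multiple of the energy (\<open>energy_upper\<close>): the
  comparison of the coefficients forces their degrees to be at most those of the \<open>b\<^sub>l\<close>. For the larger
  operator the symmetrically ordered terms integrate the symbol of the power, evaluated at \<open>X\<close>, with
  \<open>\<bar>D\<^sup>l \<psi>\<bar>\<^sup>2\<close> in place of \<open>\<xi>^(2*l)\<close>. For large \<open>X\<close> every \<open>b\<^sub>l\<close> is elliptic; for bounded \<open>X\<close> only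
  the positivity of \<open>b\<^sub>m\<close> is available, and the lower orders of \<open>D\<close> are again absorbed by interpolation
  (\<open>symbol_power_lower\<close>, \<open>energy_lower\<close>). Hence \<open>energy \<le> C * (L\<^sub>h\<^sup>n + C')\<close> as forms.
\<close>

section \<open>Schwartz functions\<close>

text \<open>The Schwartz space is the largest class of rapidly bounded differentiable functions that is
  closed under differentiation. Closure properties follow by exhibiting a class of this kind.\<close>
lemma schwartz_coinduct:
  assumes "f \<in> T"
    and T: "\<And>g. g \<in> T \<Longrightarrow> ddx g \<in> T \<and> g differentiable_on UNIV \<and>
               (\<forall>j. bounded (range (\<lambda>x. x ^ j *\<^sub>R g x)))"
  shows "f \<in> schwartz"
proof -
  have "(ddx ^^ k) f \<in> T" for k
    by (induction k) (use assms in auto)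
  then show ?thesis
    using T unfolding schwartz_def by blast
qed

lemma schwartz_ddx: "f \<in> schwartz \<Longrightarrow> ddx f \<in> schwartz"
proof -
  assume f: "f \<in> schwartz"
  have "(ddx ^^ k) (ddx f) = (ddx ^^ Suc k) f" for k
    by (simp add: funpow_swap1)
  then show ?thesis
    using f unfolding schwartz_def mem_Collect_eq by (metis (no_types))
qed

lemma schwartz_differentiable: "f \<in> schwartz \<Longrightarrow> f differentiable_on UNIV"
  unfolding schwartz_def mem_Collect_eq by (drule spec[of _ 0]) simp

lemma schwartz_bounded: "f \<in> schwartz \<Longrightarrow> bounded (range (\<lambda>x. x ^ j *\<^sub>R f x))"
  unfolding schwartz_def mem_Collect_eq by (drule spec[of _ 0]) simp

lemma schwartz_has_derivative:
  "f \<in> schwartz \<Longrightarrow> (f has_vector_derivative ddx f x) (at x)"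
  using schwartz_differentiable[of f]
  by (auto simp: ddx_def differentiable_on_def vector_derivative_works[symmetric])

lemma ddx_eqI: "(\<And>x. (f has_vector_derivative f' x) (at x)) \<Longrightarrow> ddx f = f'"
  by (auto simp: ddx_def vector_derivative_at)

lemma schwartz_continuous: "f \<in> schwartz \<Longrightarrow> continuous_on UNIV f"
  by (simp add: differentiable_imp_continuous_on schwartz_differentiable)

lemma schwartz_borel: "f \<in> schwartz \<Longrightarrow> f \<in> borel_measurable lborel"
  using borel_measurable_continuous_onI schwartz_continuous by auto

lemma ddx_lincomb:
  assumes "u \<in> schwartz" "v \<in> schwartz"
  shows "ddx (\<lambda>x. a * u x + b * v x) = (\<lambda>x. a * ddx u x + b * ddx v x)"
  by (rule ddx_eqI, intro has_vector_derivative_add has_vector_derivative_mult_right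
      schwartz_has_derivative assms)

lemma schwartz_lincomb:
  assumes "u \<in> schwartz" "v \<in> schwartz"
  shows "(\<lambda>x. a * u x + b * v x) \<in> schwartz"
proof (rule schwartz_coinduct)
  let ?T = "{\<lambda>x. a * u x + b * v x | u v. u \<in> schwartz \<and> v \<in> schwartz}"
  show "(\<lambda>x. a * u x + b * v x) \<in> ?T" using assms by blast
  fix g assume "g \<in> ?T"
  then obtain u v where uv: "u \<in> schwartz" "v \<in> schwartz" and g: "g = (\<lambda>x. a * u x + b * v x)"
    by blast
  have "ddx g \<in> ?T"
    unfolding g ddx_lincomb[OF uv] using uv schwartz_ddx by blast
  moreover have "g differentiable_on UNIV"
    unfolding g using uv by (intro derivative_intros schwartz_differentiable)
  moreover have "bounded (range (\<lambda>x. x ^ j *\<^sub>R g x))" for j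
  proof -
    obtain B where B: "\<And>x. norm (x ^ j *\<^sub>R u x) \<le> B"
      using schwartz_bounded[OF uv(1), of j] by (auto simp: bounded_iff)
    obtain B' where B': "\<And>x. norm (x ^ j *\<^sub>R v x) \<le> B'"
      using schwartz_bounded[OF uv(2), of j] by (auto simp: bounded_iff)
    have "norm (x ^ j *\<^sub>R g x) \<le> norm a * B + norm b * B'" for x
    proof -
      have "x ^ j *\<^sub>R g x = a * (x ^ j *\<^sub>R u x) + b * (x ^ j *\<^sub>R v x)"
        by (simp add: g algebra_simps)
      also have "norm \<dots> \<le> norm a * norm (x ^ j *\<^sub>R u x) + norm b * norm (x ^ j *\<^sub>R v x)"
        by (metis norm_mult norm_triangle_ineq)
      also have "\<dots> \<le> norm a * B + norm b * B'"
        by (intro add_mono mult_left_mono B B') auto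
      finally show ?thesis .
    qed
    then show ?thesis by (auto simp: bounded_iff)
  qed
  ultimately show "ddx g \<in> ?T \<and> g differentiable_on UNIV \<and>
      (\<forall>j. bounded (range (\<lambda>x. x ^ j *\<^sub>R g x)))" by (intro conjI allI)
qed

lemma schwartz_zero: "(\<lambda>x. 0) \<in> schwartz"
proof (rule schwartz_coinduct)
  show "(\<lambda>x. 0) \<in> {\<lambda>x::real. 0::complex}" by simp
qed (auto simp: ddx_def)

lemma schwartz_scale: "u \<in> schwartz \<Longrightarrow> (\<lambda>x. a * u x) \<in> schwartz"
  using schwartz_lincomb[of u u a 0] by simp

lemma schwartz_add: "u \<in> schwartz \<Longrightarrow> v \<in> schwartz \<Longrightarrow> (\<lambda>x. u x + v x) \<in> schwartz"
  using schwartz_lincomb[of u v 1 1] by simp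

lemma ddx_scale: "u \<in> schwartz \<Longrightarrow> ddx (\<lambda>x. a * u x) = (\<lambda>x. a * ddx u x)"
  using ddx_lincomb[of u u a 0] by simp

lemma schwartz_sum:
  assumes "\<And>i. i \<in> I \<Longrightarrow> f i \<in> schwartz"
  shows "(\<lambda>x. \<Sum>i\<in>I. c i * f i x) \<in> schwartz"
proof (cases "finite I")
  case True
  then show ?thesis using assms
  proof (induction I)
    case (insert i I)
    have "(\<lambda>x. c i * f i x + (\<Sum>i\<in>I. c i * f i x)) \<in> schwartz"
      by (intro schwartz_add schwartz_scale insert) (use insert in auto)
    then show ?case using insert by simp
  qed (simp add: schwartz_zero)
qed (simp add: schwartz_zero)

lemma ddx_sum:
  assumes "\<And>i. i \<in> I \<Longrightarrow> f i \<in> schwartz"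
  shows "ddx (\<lambda>x. \<Sum>i\<in>I. c i * f i x) = (\<lambda>x. \<Sum>i\<in>I. c i * ddx (f i) x)"
  by (rule ddx_eqI, intro has_vector_derivative_sum has_vector_derivative_mult_right
      schwartz_has_derivative assms)

lemma ddx_times_x:
  assumes "f \<in> schwartz"
  shows "ddx (\<lambda>x. complex_of_real x * f x) = (\<lambda>x. complex_of_real x * ddx f x + f x)"
proof (rule ddx_eqI)
  fix x :: real
  have "((\<lambda>x. complex_of_real x * f x) has_vector_derivative
     complex_of_real x * ddx f x + complex_of_real 1 * f x) (at x)"
    by (intro has_vector_derivative_mult has_vector_derivative_of_real
        schwartz_has_derivative assms) (auto intro: derivative_eq_intros)
  then show "((\<lambda>x. complex_of_real x * f x) has_vector_derivative
     complex_of_real x * ddx f x + f x) (at x)" by simp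
qed

text \<open>The derivative of \<open>x f + g\<close> is \<open>x f' + (f + g')\<close>, of the same shape, so the functions of
  this shape form a class to which the coinduction principle applies.\<close>
lemma schwartz_times_x:
  assumes "f \<in> schwartz"
  shows "(\<lambda>x. complex_of_real x * f x) \<in> schwartz"
proof (rule schwartz_coinduct)
  let ?T = "{\<lambda>x. complex_of_real x * u x + v x | u v. u \<in> schwartz \<and> v \<in> schwartz}"
  show "(\<lambda>x. complex_of_real x * f x) \<in> ?T" using assms schwartz_zero by force
  fix g assume "g \<in> ?T"
  then obtain u v where uv: "u \<in> schwartz" "v \<in> schwartz"
    and g: "g = (\<lambda>x. complex_of_real x * u x + v x)"
    by blast
  have xu: "((\<lambda>x. complex_of_real x * u x) has_vector_derivative
      complex_of_real x * ddx u x + u x) (at x)" for x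
  proof -
    have "((\<lambda>x. complex_of_real x * u x) has_vector_derivative
        complex_of_real x * ddx u x + complex_of_real 1 * u x) (at x)"
      by (intro has_vector_derivative_mult has_vector_derivative_of_real
          schwartz_has_derivative uv) (auto intro: derivative_eq_intros)
    then show ?thesis by simp
  qed
  have g': "(g has_vector_derivative complex_of_real x * ddx u x + (u x + ddx v x)) (at x)" for x
    unfolding g using has_vector_derivative_add[OF xu schwartz_has_derivative[OF uv(2)]]
    by (simp add: add.assoc)
  have "ddx g = (\<lambda>x. complex_of_real x * ddx u x + (u x + ddx v x))"
    by (rule ddx_eqI) (rule g')
  then have "ddx g \<in> ?T"
    using uv schwartz_ddx schwartz_add by force
  moreover have "g differentiable_on UNIV"
    using g' unfolding differentiable_on_def has_vector_derivative_def differentiable_def by blast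
  moreover have "bounded (range (\<lambda>x. x ^ j *\<^sub>R g x))" for j
  proof -
    obtain B where B: "\<And>x. norm (x ^ Suc j *\<^sub>R u x) \<le> B"
      using schwartz_bounded[OF uv(1), of "Suc j"] unfolding bounded_iff by blast
    obtain B' where B': "\<And>x. norm (x ^ j *\<^sub>R v x) \<le> B'"
      using schwartz_bounded[OF uv(2), of j] unfolding bounded_iff by blast
    have "norm (x ^ j *\<^sub>R g x) \<le> B + B'" for x
    proof -
      have "x ^ j *\<^sub>R g x = x ^ Suc j *\<^sub>R u x + x ^ j *\<^sub>R v x"
        by (simp add: g scaleR_conv_of_real algebra_simps)
      then show ?thesis
        using norm_triangle_mono[OF B B'] by metis
    qed
    then show ?thesis by (auto simp: bounded_iff)
  qed
  ultimately show "ddx g \<in> ?T \<and> g differentiable_on UNIV \<and>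
      (\<forall>j. bounded (range (\<lambda>x. x ^ j *\<^sub>R g x)))" by (intro conjI allI)
qed

lemma schwartz_times_poly:
  assumes "f \<in> schwartz"
  shows "(\<lambda>x. complex_of_real (poly p x) * f x) \<in> schwartz"
proof (induction p)
  case 0
  then show ?case by (simp add: schwartz_zero)
next
  case (pCons a p)
  have "(\<lambda>x. complex_of_real a * f x + complex_of_real x * (complex_of_real (poly p x) * f x))
      \<in> schwartz"
    by (intro schwartz_add schwartz_scale assms schwartz_times_x pCons.IH)
  then show ?case by (simp add: algebra_simps)
qed


section \<open>Integration of Schwartz functions\<close>

lemma integrable_schwartz_mult:
  assumes "f \<in> schwartz" "g \<in> schwartz"
  shows "integrable lborel (\<lambda>x. f x * cnj (g x))"
proof -
  obtain B where B: "\<And>x. norm (f x) \<le> B"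
    using schwartz_bounded[OF assms(1), of 0] by (auto simp: bounded_iff)
  obtain B' where B': "\<And>x. norm (x ^ 2 *\<^sub>R f x) \<le> B'"
    using schwartz_bounded[OF assms(1), of 2] unfolding bounded_iff by blast
  obtain A where A: "\<And>x. norm (g x) \<le> A"
    using schwartz_bounded[OF assms(2), of 0] by (auto simp: bounded_iff)
  have int: "integrable lborel (\<lambda>x::real. (B + B') * A * inverse (1 + x^2))"
    using integrable_inverse_1_plus_square
    by (simp add: set_integrable_def einterval_def)
  show ?thesis
  proof (rule Bochner_Integration.integrable_bound[OF int])
    have "continuous_on UNIV (\<lambda>x. f x * cnj (g x))"
      by (intro continuous_intros schwartz_continuous assms)
    then show "(\<lambda>x. f x * cnj (g x)) \<in> borel_measurable lborel"
      using borel_measurable_continuous_onI by simp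
    show "AE x in lborel. norm (f x * cnj (g x)) \<le> norm ((B + B') * A * inverse (1 + x\<^sup>2))"
    proof (rule AE_I2)
      fix x :: real
      have pos: "1 + x\<^sup>2 > 0" by (smt (verit) zero_le_power2)
      have "norm (f x) * (1 + x\<^sup>2) \<le> B + B'"
        using B[of x] B'[of x] by (simp add: algebra_simps)
      then have "norm (f x) \<le> (B + B') * inverse (1 + x\<^sup>2)"
        using pos by (simp add: field_simps)
      then have "norm (f x) * norm (g x) \<le> (B + B') * inverse (1 + x\<^sup>2) * A"
        using A[of x] by (meson mult_mono norm_ge_zero order_trans)
      also have "\<dots> \<le> norm ((B + B') * A * inverse (1 + x\<^sup>2))"
        by (simp add: mult_ac)
      finally show "norm (f x * cnj (g x)) \<le> norm ((B + B') * A * inverse (1 + x\<^sup>2))"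
        by (simp add: norm_mult)
    qed
  qed
qed

lemma integrable_schwartz_norm_mult:
  assumes "f \<in> schwartz" "g \<in> schwartz"
  shows "integrable lborel (\<lambda>x. poly p x * (norm (f x) * norm (g x)))"
proof -
  have "integrable lborel (\<lambda>x. norm (complex_of_real (poly p x) * f x * cnj (g x)))"
    by (intro integrable_norm integrable_schwartz_mult schwartz_times_poly assms)
  then show ?thesis
  proof (rule Bochner_Integration.integrable_bound)
    have [measurable]: "poly p \<in> borel_measurable borel"
      by (intro borel_measurable_continuous_onI continuous_intros)
    show "(\<lambda>x. poly p x * (norm (f x) * norm (g x))) \<in> borel_measurable lborel"
      using schwartz_borel[OF assms(1)] schwartz_borel[OF assms(2)] by measurable
  qed (simp add: norm_mult abs_mult mult.assoc)
qed

lemma schwartz_subset_L2: "schwartz \<subseteq> L2"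
  using integrable_schwartz_norm_mult[where p = 1] schwartz_borel
  by (auto simp: L2_def power2_eq_square)

lemma schwartz_AE_eq:
  assumes "u \<in> schwartz" "v \<in> schwartz" "AE x in lborel. u x = v x"
  shows "u = v"
proof (rule ccontr)
  assume "u \<noteq> v"
  then obtain y where "u y \<noteq> v y" by blast
  then have ne: "y \<in> {x. u x \<noteq> v x}" by simp
  have op: "open {x. u x \<noteq> v x}"
    by (intro open_Collect_neq schwartz_continuous assms)
  have "{x. u x \<noteq> v x} \<in> null_sets lborel"
    using assms(3) op by (subst AE_iff_null_sets) auto
  then have "negligible {x. u x \<noteq> v x}"
    by (metis negligible_iff_null_sets null_sets_completionI)
  then show False
    using ne op open_not_negligible by blast
qed

lemma schwartz_tendsto_0:
  assumes "f \<in> schwartz"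
  shows "(f \<longlongrightarrow> 0) at_infinity"
proof -
  obtain B where B: "\<And>x. norm (x ^ 1 *\<^sub>R f x) \<le> B"
    using schwartz_bounded[OF assms, of 1] unfolding bounded_iff by blast
  have "((\<lambda>x::real. B * inverse (norm x)) \<longlongrightarrow> B * 0) at_infinity"
    by (intro tendsto_mult tendsto_const tendsto_compose_filtermap
        filterlim_compose[OF tendsto_inverse_0] filterlim_norm_at_top
        filterlim_at_top_imp_at_infinity)
  then have lim: "((\<lambda>x::real. B * inverse (norm x)) \<longlongrightarrow> 0) at_infinity" by simp
  have ev: "eventually (\<lambda>x::real. x \<noteq> 0) at_infinity"
    unfolding eventually_at_infinity by (intro exI[of _ 1]) auto
  show ?thesis
  proof (rule Lim_null_comparison[OF _ lim])
    show "\<forall>\<^sub>F x in at_infinity. norm (f x) \<le> B * inverse (norm x)"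
      using ev by eventually_elim (use B in \<open>simp add: field_simps\<close>)
  qed
qed

text \<open>Integration by parts: the product \<open>f * cnj g\<close> vanishes at both infinities, so its derivative
  integrates to zero.\<close>
lemma L2_inner_ddx:
  assumes f: "f \<in> schwartz" and g: "g \<in> schwartz"
  shows "L2_inner (ddx f) g = - L2_inner f (ddx g)"
proof -
  let ?F = "\<lambda>x. f x * cnj (g x)"
  let ?F' = "\<lambda>x. f x * cnj (ddx g x) + ddx f x * cnj (g x)"
  have int1: "integrable lborel (\<lambda>x. f x * cnj (ddx g x))"
    and int2: "integrable lborel (\<lambda>x. ddx f x * cnj (g x))"
    by (intro integrable_schwartz_mult f g schwartz_ddx)+
  have cont: "continuous_on UNIV ?F'"
    by (intro continuous_intros schwartz_continuous f g schwartz_ddx)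
  have lim: "(?F \<longlongrightarrow> 0) at_infinity"
    using tendsto_mult[OF schwartz_tendsto_0[OF f] tendsto_cnj[OF schwartz_tendsto_0[OF g]]] by simp
  have "(LBINT x=-\<infinity>..\<infinity>. ?F' x) = 0 - 0"
  proof (rule interval_integral_FTC_integrable)
    show "(?F has_vector_derivative ?F' x) (at x)" for x
      by (intro has_vector_derivative_mult has_vector_derivative_cnj
          schwartz_has_derivative f g)
    show "isCont ?F' x" for x
      using cont by (simp add: continuous_on_eq_continuous_at)
    show "set_integrable lborel (einterval (-\<infinity>) \<infinity>) ?F'"
      using int1 int2 by (simp add: set_integrable_def einterval_def)
    show "((?F \<circ> real_of_ereal) \<longlongrightarrow> 0) (at_right (-\<infinity>))"
      by (simp add: ereal_tendsto_simps)
        (rule tendsto_mono[OF _ lim], simp add: at_infinity_eq_at_top_bot)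
    show "((?F \<circ> real_of_ereal) \<longlongrightarrow> 0) (at_left \<infinity>)"
      by (simp add: ereal_tendsto_simps)
        (rule tendsto_mono[OF _ lim], simp add: at_infinity_eq_at_top_bot)
  qed simp
  then have "(LINT x|lborel. ?F' x) = 0"
    by (simp add: interval_lebesgue_integral_def einterval_def set_lebesgue_integral_def)
  then show ?thesis
    using int1 int2 by (simp add: L2_inner_def add_eq_0_iff)
qed


section \<open>Position, momentum, and words in them\<close>

text \<open>The scaling by \<open>sqrt h\<close> makes the commutator of the two operators \<open>\<i> * h\<close>, and the factor
  \<open>- \<i>\<close> makes the momentum symmetric, which removes the signs \<open>(- 1) ^ l\<close> from the differential
  operators.\<close>
definition position :: "real \<Rightarrow> (real \<Rightarrow> complex) \<Rightarrow> (real \<Rightarrow> complex)" where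
  "position h f = (\<lambda>x. complex_of_real (sqrt h * x) * f x)"

definition momentum :: "real \<Rightarrow> (real \<Rightarrow> complex) \<Rightarrow> (real \<Rightarrow> complex)" where
  "momentum h f = (\<lambda>x. - \<i> * complex_of_real (sqrt h) * ddx f x)"

lemma position_schwartz: "f \<in> schwartz \<Longrightarrow> position h f \<in> schwartz"
  using schwartz_times_poly[of f "[:0, sqrt h:]"] by (simp add: position_def mult.commute)

lemma momentum_schwartz: "f \<in> schwartz \<Longrightarrow> momentum h f \<in> schwartz"
  unfolding momentum_def by (intro schwartz_scale schwartz_ddx)

lemma momentum_funpow_schwartz: "f \<in> schwartz \<Longrightarrow> (momentum h ^^ k) f \<in> schwartz"
  by (induction k) (auto simp: momentum_schwartz)

lemma position_funpow:
  "(position h ^^ j) f = (\<lambda>x. complex_of_real ((sqrt h * x) ^ j) * f x)"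
  by (induction j) (auto simp: position_def)

lemma momentum_funpow:
  assumes "f \<in> schwartz"
  shows "(momentum h ^^ k) f = (\<lambda>x. (- \<i> * complex_of_real (sqrt h)) ^ k * (ddx ^^ k) f x)"
proof (induction k)
  case (Suc k)
  have "(ddx ^^ k) f \<in> schwartz"
    using assms by (induction k) (auto simp: schwartz_ddx)
  then have "ddx (\<lambda>x. (- \<i> * complex_of_real (sqrt h)) ^ k * (ddx ^^ k) f x)
      = (\<lambda>x. (- \<i> * complex_of_real (sqrt h)) ^ k * (ddx ^^ Suc k) f x)"
    by (simp add: ddx_scale)
  then show ?case
    by (simp add: Suc, simp add: momentum_def mult_ac)
qed simp

lemma momentum_position_commute:
  assumes "f \<in> schwartz" "h \<ge> 0"
  shows "momentum h (position h f) =
           (\<lambda>x. position h (momentum h f) x + (- \<i> * complex_of_real h) * f x)"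
proof -
  have "ddx (position h f) = (\<lambda>x. complex_of_real (sqrt h) * (complex_of_real x * ddx f x + f x))"
    using ddx_scale[OF schwartz_times_x[OF assms(1)], of "complex_of_real (sqrt h)"]
    by (simp add: position_def ddx_times_x[OF assms(1)] mult.assoc)
  moreover have "complex_of_real h = complex_of_real (sqrt h) * complex_of_real (sqrt h)"
    using assms(2) by (metis of_real_mult real_sqrt_mult_self abs_of_nonneg)
  ultimately show ?thesis
    by (auto simp: momentum_def position_def algebra_simps)
qed

lemma position_sum:
  "position h (\<lambda>x. \<Sum>i\<in>I. c i * f i x) = (\<lambda>x. \<Sum>i\<in>I. c i * position h (f i) x)"
  by (simp add: position_def sum_distrib_left algebra_simps)

lemma momentum_sum:
  assumes "\<And>i. i \<in> I \<Longrightarrow> f i \<in> schwartz"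
  shows "momentum h (\<lambda>x. \<Sum>i\<in>I. c i * f i x) = (\<lambda>x. \<Sum>i\<in>I. c i * momentum h (f i) x)"
proof -
  have "ddx (\<lambda>x. \<Sum>i\<in>I. c i * f i x) = (\<lambda>x. \<Sum>i\<in>I. c i * ddx (f i) x)"
    by (rule ddx_sum) (rule assms)
  then show ?thesis by (simp add: momentum_def sum_distrib_left mult_ac)
qed

datatype letter = Pos | Mom

primrec letter_op :: "real \<Rightarrow> letter \<Rightarrow> (real \<Rightarrow> complex) \<Rightarrow> (real \<Rightarrow> complex)" where
  "letter_op h Pos = position h"
| "letter_op h Mom = momentum h"

primrec act :: "real \<Rightarrow> letter list \<Rightarrow> (real \<Rightarrow> complex) \<Rightarrow> (real \<Rightarrow> complex)" where
  "act h [] f = f"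
| "act h (c # w) f = letter_op h c (act h w f)"

lemma act_append: "act h (u @ v) f = act h u (act h v f)"
  by (induction u) auto

lemma act_replicate: "act h (replicate k c) f = (letter_op h c ^^ k) f"
  by (induction k) auto

lemma act_schwartz: "f \<in> schwartz \<Longrightarrow> act h w f \<in> schwartz"
proof (induction w)
  case (Cons c w)
  then show ?case by (cases c) (auto simp: position_schwartz momentum_schwartz)
qed auto

lemma act_sum:
  assumes "\<And>i. i \<in> I \<Longrightarrow> f i \<in> schwartz"
  shows "act h w (\<lambda>x. \<Sum>i\<in>I. c i * f i x) = (\<lambda>x. \<Sum>i\<in>I. c i * act h w (f i) x)"
proof (induction w)
  case (Cons a w)
  then show ?case
    by (cases a) (auto simp: position_sum momentum_sum act_schwartz assms)
qed auto

lemma act_add_scale: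
  assumes "f \<in> schwartz" "g \<in> schwartz"
  shows "act h w (\<lambda>x. f x + c * g x) = (\<lambda>x. act h w f x + c * act h w g x)"
proof -
  have "act h w (\<lambda>x. \<Sum>i\<in>UNIV. (if i then 1 else c) * (if i then f else g) x)
      = (\<lambda>x. \<Sum>i\<in>UNIV. (if i then 1 else c) * act h w (if i then f else g) x)"
    by (rule act_sum) (use assms in auto)
  then show ?thesis by (simp add: UNIV_bool add.commute)
qed


section \<open>The inner product on Schwartz functions\<close>

lemma L2_inner_sum_left:
  assumes "\<And>i. i \<in> I \<Longrightarrow> f i \<in> schwartz" "g \<in> schwartz"
  shows "L2_inner (\<lambda>x. \<Sum>i\<in>I. c i * f i x) g = (\<Sum>i\<in>I. c i * L2_inner (f i) g)"
proof -
  have "L2_inner (\<lambda>x. \<Sum>i\<in>I. c i * f i x) g = (LINT x|lborel. (\<Sum>i\<in>I. c i * (f i x * cnj (g x))))"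
    by (simp add: L2_inner_def sum_distrib_right mult.assoc)
  also have "\<dots> = (\<Sum>i\<in>I. LINT x|lborel. c i * (f i x * cnj (g x)))"
    by (rule Bochner_Integration.integral_sum)
      (use assms integrable_schwartz_mult in auto)
  finally show ?thesis by (simp add: L2_inner_def)
qed

lemma L2_inner_add_scale:
  assumes "f \<in> schwartz" "g \<in> schwartz" "k \<in> schwartz"
  shows "L2_inner (\<lambda>x. f x + c * g x) k = L2_inner f k + c * L2_inner g k"
  using assms by (simp add: L2_inner_def distrib_right mult.assoc integrable_schwartz_mult)

lemma L2_inner_commute: "L2_inner g f = cnj (L2_inner f g)"
proof -
  have "cnj (L2_inner f g) = (LINT x|lborel. cnj (f x * cnj (g x)))"
    unfolding L2_inner_def by (rule Bochner_Integration.integral_cnj[symmetric])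
  then show ?thesis by (simp add: L2_inner_def mult.commute)
qed

lemma L2_inner_momentum:
  assumes "f \<in> schwartz" "g \<in> schwartz"
  shows "L2_inner (momentum h f) g = L2_inner f (momentum h g)"
proof -
  have "L2_inner (momentum h f) g = - \<i> * complex_of_real (sqrt h) * L2_inner (ddx f) g"
    by (simp add: L2_inner_def momentum_def mult.assoc)
  also have "\<dots> = \<i> * complex_of_real (sqrt h) * L2_inner f (ddx g)"
    by (simp add: L2_inner_ddx assms)
  also have "\<dots> = (LINT x|lborel. \<i> * complex_of_real (sqrt h) * (f x * cnj (ddx g x)))"
    by (simp add: L2_inner_def)
  also have "\<dots> = L2_inner f (momentum h g)"
    by (simp add: L2_inner_def momentum_def mult_ac)
  finally show ?thesis .
qed

lemma L2_inner_momentum_funpow: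
  assumes "f \<in> schwartz" "g \<in> schwartz"
  shows "L2_inner ((momentum h ^^ k) f) g = L2_inner f ((momentum h ^^ k) g)"
  using assms
proof (induction k arbitrary: g)
  case (Suc k)
  have "L2_inner ((momentum h ^^ Suc k) f) g = L2_inner ((momentum h ^^ k) f) (momentum h g)"
    using Suc.prems by (simp add: L2_inner_momentum momentum_funpow_schwartz)
  also have "\<dots> = L2_inner f ((momentum h ^^ k) (momentum h g))"
    using Suc by (simp add: momentum_schwartz)
  finally show ?case by (simp add: funpow_swap1)
qed simp


section \<open>Reordering the letters of a word\<close>

definition word_form :: "real \<Rightarrow> letter list \<Rightarrow> (real \<Rightarrow> complex) \<Rightarrow> complex" where
  "word_form h w \<psi> = L2_inner (act h w \<psi>) \<psi>"

lemma word_form_swap: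
  assumes "\<psi> \<in> schwartz" "h \<ge> 0"
  shows "word_form h (u @ Mom # Pos # v) \<psi> =
           word_form h (u @ Pos # Mom # v) \<psi> + (- \<i> * complex_of_real h) * word_form h (u @ v) \<psi>"
proof -
  have v: "act h v \<psi> \<in> schwartz" using assms act_schwartz by blast
  have "act h (u @ Mom # Pos # v) \<psi> =
      (\<lambda>x. act h (u @ Pos # Mom # v) \<psi> x + (- \<i> * complex_of_real h) * act h (u @ v) \<psi> x)"
    unfolding act_append act.simps letter_op.simps momentum_position_commute[OF v assms(2)]
    by (rule act_add_scale) (intro v position_schwartz momentum_schwartz)+
  then show ?thesis
    unfolding word_form_def
    by (simp only: L2_inner_add_scale act_schwartz assms)
qed

text \<open>In the next two lemmas \<open>u\<close> is the part of the word that has already been sorted past; each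
  swap costs \<open>h * g\<close>, where \<open>g\<close> bounds all words with one letter of each kind fewer.\<close>
lemma word_form_move_mom:
  assumes "\<psi> \<in> schwartz" "h \<ge> 0"
    and bound: "\<And>w. count_list w Pos = J \<Longrightarrow> count_list w Mom = N \<Longrightarrow> norm (word_form h w \<psi>) \<le> g"
  shows "count_list (u @ v) Pos + k = Suc J \<Longrightarrow> count_list (u @ v) Mom = N \<Longrightarrow>
     norm (word_form h (u @ Mom # replicate k Pos @ v) \<psi> - word_form h (u @ replicate k Pos @ Mom # v) \<psi>)
       \<le> real k * (h * g)"
proof (induction k arbitrary: u)
  case (Suc k)
  have c: "count_list (replicate k Pos) Pos = k" "count_list (replicate k Pos) Mom = 0"
    by (induction k) auto
  let ?w = "replicate k Pos @ v"
  have "norm (word_form h ((u @ [Pos]) @ Mom # ?w) \<psi>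
          - word_form h ((u @ [Pos]) @ replicate k Pos @ Mom # v) \<psi>) \<le> real k * (h * g)"
    by (rule Suc.IH) (use Suc.prems in auto)
  then have 1: "norm (word_form h (u @ Pos # Mom # ?w) \<psi>
          - word_form h (u @ replicate (Suc k) Pos @ Mom # v) \<psi>) \<le> real k * (h * g)"
    by simp
  have "norm (word_form h (u @ ?w) \<psi>) \<le> g"
    by (rule bound) (use Suc.prems c in auto)
  then have "norm ((- \<i> * complex_of_real h) * word_form h (u @ ?w) \<psi>) \<le> h * g"
    using assms(2) by (simp add: norm_mult mult_left_mono)
  then have 2: "norm (word_form h (u @ Mom # Pos # ?w) \<psi> - word_form h (u @ Pos # Mom # ?w) \<psi>) \<le> h * g"
    unfolding word_form_swap[OF assms(1,2)] by simp
  show ?case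
    using norm_triangle_mono[OF 1 2] by (simp add: algebra_simps)
qed simp

lemma word_form_sort:
  assumes "\<psi> \<in> schwartz" "h \<ge> 0" "g \<ge> 0"
    and bound: "\<And>w. count_list w Pos = J \<Longrightarrow> count_list w Mom = N \<Longrightarrow> norm (word_form h w \<psi>) \<le> g"
  shows "count_list (u @ w) Pos = Suc J \<Longrightarrow> count_list (u @ w) Mom = Suc N \<Longrightarrow>
     norm (word_form h (u @ w) \<psi>
        - word_form h (u @ replicate (count_list w Pos) Pos @ replicate (count_list w Mom) Mom) \<psi>)
       \<le> real (count_list w Mom) * (real (Suc J) * (h * g))"
proof (induction w arbitrary: u)
  case (Cons c w)
  have crep: "count_list (replicate k a) b = (if a = b then k else 0)" for k and a b :: letter
    by (induction k) auto
  let ?p = "replicate (count_list w Pos) Pos" and ?m = "replicate (count_list w Mom) Mom"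
  show ?case
  proof (cases c)
    case Pos
    then show ?thesis
      using Cons.IH[of "u @ [Pos]"] Cons.prems by simp
  next
    case Mom
    have 1: "norm (word_form h (u @ Mom # w) \<psi> - word_form h (u @ Mom # ?p @ ?m) \<psi>)
        \<le> real (count_list w Mom) * (real (Suc J) * (h * g))"
      using Cons.IH[of "u @ [Mom]"] Cons.prems Mom by simp
    have "norm (word_form h (u @ Mom # ?p @ ?m) \<psi> - word_form h (u @ ?p @ Mom # ?m) \<psi>)
        \<le> real (count_list w Pos) * (h * g)"
      by (rule word_form_move_mom[OF assms(1,2) bound]) (use Cons.prems Mom in \<open>auto simp: crep\<close>)
    also have "\<dots> \<le> real (Suc J) * (h * g)"
      by (intro mult_right_mono) (use Cons.prems Mom assms in auto)
    finally show ?thesis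
      using norm_triangle_mono[OF 1] Mom by (fastforce simp: algebra_simps)
  qed
qed simp

lemma word_without_letter:
  "count_list w Pos = 0 \<Longrightarrow> w = replicate (count_list w Mom) Mom"
  "count_list w Mom = 0 \<Longrightarrow> w = replicate (count_list w Pos) Pos"
proof -
  show "count_list w Pos = 0 \<Longrightarrow> w = replicate (count_list w Mom) Mom"
  proof (induction w)
    case (Cons c w) then show ?case by (cases c) auto
  qed simp
  show "count_list w Mom = 0 \<Longrightarrow> w = replicate (count_list w Pos) Pos"
  proof (induction w)
    case (Cons c w) then show ?case by (cases c) auto
  qed simp
qed

text \<open>Swapping two adjacent letters costs a word with one \<open>Pos\<close> and one \<open>Mom\<close> fewer, times \<open>h\<close>,
  and sorting a word takes at most \<open>J * N\<close> swaps.\<close>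
lemma word_form_reorder:
  assumes "\<psi> \<in> schwartz" "h \<ge> 0" "g \<ge> 0"
    and w: "count_list w Pos = J" "count_list w Mom = N"
    and w': "count_list w' Pos = J" "count_list w' Mom = N"
    and bound: "\<And>v. Suc (count_list v Pos) = J \<Longrightarrow> Suc (count_list v Mom) = N \<Longrightarrow>
                  norm (word_form h v \<psi>) \<le> g"
  shows "norm (word_form h w \<psi> - word_form h w' \<psi>) \<le> 2 * real N * real J * h * g"
proof (cases "J = 0 \<or> N = 0")
  case True
  then have "w = w'"
    using word_without_letter w w' by metis
  then show ?thesis using assms by simp
next
  case False
  then obtain J' N' where JN: "J = Suc J'" "N = Suc N'"
    using not0_implies_Suc by blast
  let ?s = "replicate J Pos @ replicate N Mom"
  have b: "\<And>v. count_list v Pos = J' \<Longrightarrow> count_list v Mom = N' \<Longrightarrow> norm (word_form h v \<psi>) \<le> g"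
    using bound JN by simp
  have 1: "norm (word_form h w \<psi> - word_form h ?s \<psi>) \<le> real N * (real J * (h * g))"
    using word_form_sort[OF assms(1-3) b, where u = "[]" and w = w] w JN by simp
  have 2: "norm (word_form h w' \<psi> - word_form h ?s \<psi>) \<le> real N * (real J * (h * g))"
    using word_form_sort[OF assms(1-3) b, where u = "[]" and w = w'] w' JN by simp
  have "norm (word_form h w \<psi> - word_form h w' \<psi>)
      = norm ((word_form h w \<psi> - word_form h ?s \<psi>) - (word_form h w' \<psi> - word_form h ?s \<psi>))"
    by simp
  also have "\<dots> \<le> real N * (real J * (h * g)) + real N * (real J * (h * g))"
    using norm_triangle_ineq4 1 2 by (meson add_mono order_trans)
  finally show ?thesis by (simp add: algebra_simps)
qed


section \<open>Weighted norms and interpolation\<close>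

definition wnorm :: "real \<Rightarrow> nat \<Rightarrow> (real \<Rightarrow> complex) \<Rightarrow> real" where
  "wnorm h M f = (LINT x|lborel. (1 + h * x\<^sup>2) ^ M * (norm (f x))\<^sup>2)"

lemma integrable_wnorm:
  assumes "f \<in> schwartz"
  shows "integrable lborel (\<lambda>x. (1 + h * x\<^sup>2) ^ M * (norm (f x))\<^sup>2)"
  using integrable_schwartz_norm_mult[OF assms assms, of "[:1, 0, h:] ^ M"]
  by (simp add: power2_eq_square mult_ac)

lemma wnorm_nonneg: "h \<ge> 0 \<Longrightarrow> wnorm h M f \<ge> 0"
  unfolding wnorm_def by (intro Bochner_Integration.integral_nonneg) auto

lemma wnorm_mono:
  assumes "f \<in> schwartz" "h \<ge> 0" "M \<le> M'"
  shows "wnorm h M f \<le> wnorm h M' f"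
  unfolding wnorm_def
  by (intro integral_mono integrable_wnorm assms mult_right_mono power_increasing) (use assms in auto)

lemma power_le_power_Suc_plus:
  fixes t \<epsilon> :: real
  assumes "t \<ge> 1" "\<epsilon> > 0"
  shows "t ^ M \<le> \<epsilon> * t ^ Suc M + (1 / \<epsilon>) ^ M"
proof (cases "\<epsilon> * t \<ge> 1")
  case True
  then have "1 * t ^ M \<le> (\<epsilon> * t) * t ^ M"
    using assms by (intro mult_right_mono) auto
  then show ?thesis using assms by (simp add: mult.assoc add_increasing2)
next
  case False
  then have "t \<le> 1 / \<epsilon>" using assms by (simp add: field_simps)
  then have "t ^ M \<le> (1 / \<epsilon>) ^ M" using assms by (intro power_mono) auto
  moreover have "0 \<le> \<epsilon> * t ^ Suc M" using assms by simp
  ultimately show ?thesis by linarith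
qed

text \<open>A lower weight is negligible against a higher one up to the unweighted norm: this is what
  makes terms of lower degree in \<open>x\<close> harmless.\<close>
lemma wnorm_weight_interpolation:
  assumes "f \<in> schwartz" "h \<ge> 0" "\<epsilon> > 0"
  shows "wnorm h M f \<le> \<epsilon> * wnorm h (Suc M) f + (1 / \<epsilon>) ^ M * wnorm h 0 f"
proof -
  have "wnorm h M f \<le> (LINT x|lborel. \<epsilon> * ((1 + h * x\<^sup>2) ^ Suc M * (norm (f x))\<^sup>2)
      + (1 / \<epsilon>) ^ M * ((1 + h * x\<^sup>2) ^ 0 * (norm (f x))\<^sup>2))"
    unfolding wnorm_def
  proof (rule integral_mono)
    fix x :: real
    have "(1 + h * x\<^sup>2) ^ M * (norm (f x))\<^sup>2
        \<le> (\<epsilon> * (1 + h * x\<^sup>2) ^ Suc M + (1 / \<epsilon>) ^ M) * (norm (f x))\<^sup>2"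
      by (intro mult_right_mono power_le_power_Suc_plus) (use assms in auto)
    then show "(1 + h * x\<^sup>2) ^ M * (norm (f x))\<^sup>2 \<le> \<epsilon> * ((1 + h * x\<^sup>2) ^ Suc M * (norm (f x))\<^sup>2)
      + (1 / \<epsilon>) ^ M * ((1 + h * x\<^sup>2) ^ 0 * (norm (f x))\<^sup>2)"
      by (simp add: distrib_right mult.assoc)
  qed (intro integrable_wnorm Bochner_Integration.integrable_add integrable_mult_right assms)+
  also have "\<dots> = \<epsilon> * wnorm h (Suc M) f + (1 / \<epsilon>) ^ M * wnorm h 0 f"
    unfolding wnorm_def
    by (subst Bochner_Integration.integral_add)
      (auto intro!: integrable_wnorm integrable_mult_right assms simp del: power_Suc power_0)
  finally show ?thesis .
qed

lemma L2_inner_position_funpow_bound: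
  assumes f: "f \<in> schwartz" and g: "g \<in> schwartz"
    and le: "\<And>x. \<bar>sqrt h * x\<bar> ^ J * (norm (f x) * norm (g x)) \<le>
      a * ((1 + h * x\<^sup>2) ^ M * (norm (f x))\<^sup>2) + b * ((1 + h * x\<^sup>2) ^ N * (norm (g x))\<^sup>2)"
  shows "norm (L2_inner ((position h ^^ J) f) g) \<le> a * wnorm h M f + b * wnorm h N g"
proof -
  have S: "(position h ^^ J) f \<in> schwartz"
    using f by (induction J) (auto simp: position_schwartz)
  have "norm (L2_inner ((position h ^^ J) f) g)
      \<le> (LINT x|lborel. norm ((position h ^^ J) f x * cnj (g x)))"
    unfolding L2_inner_def by (rule integral_norm_bound)
  also have "\<dots> \<le> (LINT x|lborel. a * ((1 + h * x\<^sup>2) ^ M * (norm (f x))\<^sup>2)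
      + b * ((1 + h * x\<^sup>2) ^ N * (norm (g x))\<^sup>2))"
  proof (rule integral_mono)
    show "integrable lborel (\<lambda>x. norm ((position h ^^ J) f x * cnj (g x)))"
      by (intro integrable_norm integrable_schwartz_mult S g)
    show "integrable lborel (\<lambda>x. a * ((1 + h * x\<^sup>2) ^ M * (norm (f x))\<^sup>2)
      + b * ((1 + h * x\<^sup>2) ^ N * (norm (g x))\<^sup>2))"
      by (intro integrable_wnorm Bochner_Integration.integrable_add integrable_mult_right f g)
    show "norm ((position h ^^ J) f x * cnj (g x)) \<le> a * ((1 + h * x\<^sup>2) ^ M * (norm (f x))\<^sup>2)
      + b * ((1 + h * x\<^sup>2) ^ N * (norm (g x))\<^sup>2)" for x
      using le[of x] by (simp add: position_funpow norm_mult norm_power power_abs abs_mult mult.assoc)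
  qed
  also have "\<dots> = a * wnorm h M f + b * wnorm h N g"
    unfolding wnorm_def
    by (subst Bochner_Integration.integral_add)
      (auto intro!: integrable_wnorm integrable_mult_right f g)
  finally show ?thesis .
qed

lemma mult_le_weighted_squares:
  fixes p q t :: real
  assumes "t > 0"
  shows "p * q \<le> t * p\<^sup>2 + 1 / (4 * t) * q\<^sup>2"
proof -
  have "0 \<le> (2 * t * p - q)\<^sup>2 / (4 * t)" using assms by simp
  also have "\<dots> = t * p\<^sup>2 + 1 / (4 * t) * q\<^sup>2 - p * q"
    using assms by (simp add: power2_eq_square field_simps)
  finally show ?thesis by simp
qed

lemma abs_le_sqrt_weight: "h \<ge> 0 \<Longrightarrow> \<bar>sqrt h * x\<bar> \<le> sqrt (1 + h * x\<^sup>2)"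
  by (rule real_le_rsqrt) (simp add: power_mult_distrib)

text \<open>An odd power is the case that matters: \<open>\<bar>x\<bar> ^ (2 * M - 1)\<close> is split into the weights of
  order \<open>M\<close> and \<open>M - 1\<close>.\<close>
lemma L2_inner_position_offdiagonal:
  assumes "f \<in> schwartz" "g \<in> schwartz" "h \<ge> 0" "t > 0" "J < 2 * M"
  shows "norm (L2_inner ((position h ^^ J) f) g) \<le> t * wnorm h M f + 1 / (4 * t) * wnorm h (M - 1) g"
proof (rule L2_inner_position_funpow_bound[OF assms(1,2)])
  fix x :: real
  let ?w = "sqrt (1 + h * x\<^sup>2)"
  have w1: "?w \<ge> 1" using assms(3) by simp
  have w2: "(?w ^ k)\<^sup>2 = (1 + h * x\<^sup>2) ^ k" for k
    using assms(3) by (simp add: power_mult[symmetric] mult.commute[of k] power_mult)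
  have "\<bar>sqrt h * x\<bar> ^ J \<le> ?w ^ J"
    by (intro power_mono abs_le_sqrt_weight assms) auto
  also have "\<dots> \<le> ?w ^ (M + (M - 1))"
    using assms(5) w1 by (intro power_increasing) auto
  finally have "\<bar>sqrt h * x\<bar> ^ J * (norm (f x) * norm (g x))
      \<le> ?w ^ (M + (M - 1)) * (norm (f x) * norm (g x))"
    by (intro mult_right_mono) auto
  also have "\<dots> = (?w ^ M * norm (f x)) * (?w ^ (M - 1) * norm (g x))"
    by (simp add: power_add)
  also have "\<dots> \<le> t * (?w ^ M * norm (f x))\<^sup>2 + 1 / (4 * t) * (?w ^ (M - 1) * norm (g x))\<^sup>2"
    by (rule mult_le_weighted_squares) (rule assms)
  finally show "\<bar>sqrt h * x\<bar> ^ J * (norm (f x) * norm (g x)) \<le>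
      t * ((1 + h * x\<^sup>2) ^ M * (norm (f x))\<^sup>2)
      + 1 / (4 * t) * ((1 + h * x\<^sup>2) ^ (M - 1) * (norm (g x))\<^sup>2)"
    by (simp only: power_mult_distrib w2)
qed

lemma L2_inner_position_diagonal:
  assumes "f \<in> schwartz" "h \<ge> 0" "J \<le> 2 * M"
  shows "norm (L2_inner ((position h ^^ J) f) f) \<le> wnorm h M f"
proof -
  have "norm (L2_inner ((position h ^^ J) f) f) \<le> 1 * wnorm h M f + 0 * wnorm h M f"
  proof (rule L2_inner_position_funpow_bound[OF assms(1,1)])
    fix x :: real
    let ?w = "sqrt (1 + h * x\<^sup>2)"
    have "\<bar>sqrt h * x\<bar> ^ J \<le> ?w ^ J"
      by (intro power_mono abs_le_sqrt_weight assms) auto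
    also have "\<dots> \<le> ?w ^ (2 * M)"
      using assms by (intro power_increasing) auto
    also have "\<dots> = (1 + h * x\<^sup>2) ^ M"
      using assms by (simp add: power_mult)
    finally show "\<bar>sqrt h * x\<bar> ^ J * (norm (f x) * norm (f x)) \<le>
      1 * ((1 + h * x\<^sup>2) ^ M * (norm (f x))\<^sup>2) + 0 * ((1 + h * x\<^sup>2) ^ M * (norm (f x))\<^sup>2)"
      by (simp add: mult_right_mono power2_eq_square)
  qed
  then show ?thesis by simp
qed

lemma wnorm_0_eq: "wnorm h 0 f = Re (L2_inner f f)"
proof -
  have "L2_inner f f = (LINT x|lborel. complex_of_real ((norm (f x))\<^sup>2))"
    by (simp only: L2_inner_def complex_norm_square)
  also have "\<dots> = complex_of_real (LINT x|lborel. (norm (f x))\<^sup>2)"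
    by (rule integral_complex_of_real)
  finally show ?thesis by (simp add: wnorm_def)
qed

text \<open>Symmetry of the momentum gives \<open>\<parallel>D\<^sup>k\<^sup>+\<^sup>1 \<psi>\<parallel>\<^sup>2 = \<langle>D\<^sup>k\<^sup>+\<^sup>2 \<psi>, D\<^sup>k \<psi>\<rangle>\<close>, to which the Cauchy-Schwarz
  inequality applies.\<close>
lemma momentum_interpolation_step:
  assumes "\<psi> \<in> schwartz" "h \<ge> 0" "t > 0"
  shows "wnorm h 0 ((momentum h ^^ Suc k) \<psi>)
      \<le> t * wnorm h 0 ((momentum h ^^ Suc (Suc k)) \<psi>) + wnorm h 0 ((momentum h ^^ k) \<psi>) / (4 * t)"
proof -
  let ?f = "(momentum h ^^ Suc (Suc k)) \<psi>" and ?g = "(momentum h ^^ k) \<psi>"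
  have "wnorm h 0 ((momentum h ^^ Suc k) \<psi>) = Re (L2_inner ?f ?g)"
    unfolding wnorm_0_eq using assms
    by (simp add: L2_inner_momentum momentum_funpow_schwartz momentum_schwartz)
  also have "\<dots> \<le> norm (L2_inner ((position h ^^ 0) ?f) ?g)"
    by (simp add: complex_Re_le_cmod)
  also have "\<dots> \<le> t * wnorm h 0 ?f + 1 / (4 * t) * wnorm h 0 ?g"
    by (rule L2_inner_position_funpow_bound)
      (use assms mult_le_weighted_squares in \<open>auto simp: momentum_funpow_schwartz momentum_schwartz\<close>)
  finally show ?thesis by simp
qed

text \<open>Log-convexity \<open>s (Suc k)\<^sup>2 \<le> s k * s (Suc (Suc k))\<close>, linearised by a free parameter \<open>t\<close>.\<close>
definition interpolating :: "(nat \<Rightarrow> real) \<Rightarrow> bool" where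
  "interpolating s \<longleftrightarrow> (\<forall>k. s k \<ge> 0) \<and>
     (\<forall>k t. t > 0 \<longrightarrow> s (Suc k) \<le> t * s (Suc (Suc k)) + s k / (4 * t))"

lemma interpolating_step:
  assumes "\<epsilon> > 0"
  shows "\<exists>C\<ge>0. \<forall>s. interpolating s \<longrightarrow> s K \<le> \<epsilon> * s (Suc K) + C * s 0"
  using assms
proof (induction K arbitrary: \<epsilon>)
  case 0
  then show ?case
    by (intro exI[of _ 1]) (auto simp: interpolating_def)
next
  case (Suc K)
  \<comment> \<open>The constants are such that \<open>s (Suc K)\<close> reappears on the right with the factor 1/2.\<close>
  obtain C where C: "C \<ge> 0" "\<And>s. interpolating s \<Longrightarrow> s K \<le> \<epsilon> * s (Suc K) + C * s 0"
    using Suc.IH[OF Suc.prems] by blast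
  show ?case
  proof (intro exI[of _ "C / \<epsilon>"] conjI allI impI)
    show "0 \<le> C / \<epsilon>" using C Suc.prems by simp
    fix s assume s: "interpolating s"
    have "s (Suc K) \<le> \<epsilon> / 2 * s (Suc (Suc K)) + s K / (4 * (\<epsilon> / 2))"
      using s Suc.prems unfolding interpolating_def by (meson half_gt_zero)
    also have "s K / (4 * (\<epsilon> / 2)) \<le> (\<epsilon> * s (Suc K) + C * s 0) / (4 * (\<epsilon> / 2))"
      using C(2)[OF s] Suc.prems by (intro divide_right_mono) auto
    also have "\<dots> = s (Suc K) / 2 + C * s 0 / (2 * \<epsilon>)"
      using Suc.prems by (simp add: field_simps)
    finally show "s (Suc K) \<le> \<epsilon> * s (Suc (Suc K)) + C / \<epsilon> * s 0"
      by (simp add: field_simps)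
  qed
qed

lemma interpolating_bound:
  assumes "a < K" "\<epsilon> > 0"
  shows "\<exists>C\<ge>0. \<forall>s. interpolating s \<longrightarrow> s a \<le> \<epsilon> * s K + C * s 0"
  using assms
proof (induction K arbitrary: \<epsilon>)
  case (Suc K)
  show ?case
  proof (cases "a = K")
    case True
    then show ?thesis using interpolating_step Suc.prems by blast
  next
    case False
    then obtain C where C: "C \<ge> 0" "\<And>s. interpolating s \<Longrightarrow> s a \<le> 1 * s K + C * s 0"
      using Suc.IH[of 1] Suc.prems by (metis less_SucE zero_less_one)
    obtain D where D: "D \<ge> 0" "\<And>s. interpolating s \<Longrightarrow> s K \<le> \<epsilon> * s (Suc K) + D * s 0"
      using interpolating_step Suc.prems by blast
    show ?thesis
      using C D by (intro exI[of _ "C + D"]) (fastforce simp: algebra_simps)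
  qed
qed simp

lemma momentum_interpolation:
  assumes "a < K" "\<epsilon> > 0"
  shows "\<exists>C\<ge>0. \<forall>h \<psi>. 0 \<le> h \<longrightarrow> \<psi> \<in> schwartz \<longrightarrow>
     wnorm h 0 ((momentum h ^^ a) \<psi>) \<le> \<epsilon> * wnorm h 0 ((momentum h ^^ K) \<psi>) + C * wnorm h 0 \<psi>"
proof -
  obtain C where C: "C \<ge> 0" "\<And>s. interpolating s \<Longrightarrow> s a \<le> \<epsilon> * s K + C * s 0"
    using interpolating_bound[OF assms] by blast
  show ?thesis
  proof (intro exI[of _ C] conjI allI impI C)
    fix h \<psi> assume "0 \<le> (h::real)" "\<psi> \<in> schwartz"
    then have "interpolating (\<lambda>k. wnorm h 0 ((momentum h ^^ k) \<psi>))"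
      unfolding interpolating_def using wnorm_nonneg momentum_interpolation_step by blast
    from C(2)[OF this] show "wnorm h 0 ((momentum h ^^ a) \<psi>)
        \<le> \<epsilon> * wnorm h 0 ((momentum h ^^ K) \<psi>) + C * wnorm h 0 \<psi>" by simp
  qed
qed


section \<open>Bounds for words by the energy\<close>

definition energy :: "real \<Rightarrow> (nat \<Rightarrow> nat) \<Rightarrow> nat \<Rightarrow> (real \<Rightarrow> complex) \<Rightarrow> real" where
  "energy h M K \<psi> = (\<Sum>l\<le>K. wnorm h (M l) ((momentum h ^^ l) \<psi>))"

lemma wnorm_le_energy:
  assumes "h \<ge> 0" "l \<le> K"
  shows "wnorm h (M l) ((momentum h ^^ l) \<psi>) \<le> energy h M K \<psi>"
  unfolding energy_def using assms by (intro member_le_sum) (auto simp: wnorm_nonneg)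

lemma wnorm_le_energy':
  assumes "h \<ge> 0" "l \<le> K" "N \<le> M l" "\<psi> \<in> schwartz"
  shows "wnorm h N ((momentum h ^^ l) \<psi>) \<le> energy h M K \<psi>"
  using wnorm_mono[OF momentum_funpow_schwartz] wnorm_le_energy assms order_trans by blast

lemma energy_nonneg: "h \<ge> 0 \<Longrightarrow> energy h M K \<psi> \<ge> 0"
  unfolding energy_def by (intro sum_nonneg wnorm_nonneg)

lemma wnorm_0_le_energy: "h \<ge> 0 \<Longrightarrow> \<psi> \<in> schwartz \<Longrightarrow> wnorm h 0 \<psi> \<le> energy h M K \<psi>"
  using wnorm_le_energy'[of h 0 K 0 M \<psi>] by simp

text \<open>The commutator terms carry a factor of size at most \<open>2 * N * J * \<eta>\<close>, so they are absorbed by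
  taking \<open>\<delta>\<close> small in the hypothesis on the shorter words.\<close>
lemma word_form_reorder_uniform:
  assumes "\<eta> \<ge> 0" "\<epsilon> > 0"
    and low: "\<And>\<delta>. \<delta> > 0 \<Longrightarrow> \<exists>C\<ge>0. \<forall>h \<psi> v. 0 < h \<longrightarrow> h < \<eta> \<longrightarrow> \<psi> \<in> schwartz \<longrightarrow>
        Suc (count_list v Pos) = J \<longrightarrow> Suc (count_list v Mom) = N \<longrightarrow>
        norm (word_form h v \<psi>) \<le> \<delta> * energy h M K \<psi> + C * wnorm h 0 \<psi>"
  shows "\<exists>C\<ge>0. \<forall>h \<psi> w w'. 0 < h \<longrightarrow> h < \<eta> \<longrightarrow> \<psi> \<in> schwartz \<longrightarrow>
        count_list w Pos = J \<longrightarrow> count_list w Mom = N \<longrightarrow>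
        count_list w' Pos = J \<longrightarrow> count_list w' Mom = N \<longrightarrow>
        norm (word_form h w \<psi> - word_form h w' \<psi>) \<le> \<epsilon> * energy h M K \<psi> + C * wnorm h 0 \<psi>"
proof -
  define A where "A = 2 * real N * real J * \<eta>"
  have A: "A \<ge> 0" using assms(1) by (simp add: A_def)
  define \<delta> where "\<delta> = \<epsilon> / (A + 1)"
  have \<delta>: "\<delta> > 0" "A * \<delta> \<le> \<epsilon>"
    using A assms(2) by (auto simp: \<delta>_def field_simps)
  obtain C where C: "C \<ge> 0" "\<And>h \<psi> v. 0 < h \<Longrightarrow> h < \<eta> \<Longrightarrow> \<psi> \<in> schwartz \<Longrightarrow>
        Suc (count_list v Pos) = J \<Longrightarrow> Suc (count_list v Mom) = N \<Longrightarrow>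
        norm (word_form h v \<psi>) \<le> \<delta> * energy h M K \<psi> + C * wnorm h 0 \<psi>"
    using low[OF \<delta>(1)] by metis
  show ?thesis
  proof (intro exI[of _ "A * C"] conjI allI impI)
    show "0 \<le> A * C" using A C by simp
    fix h \<psi> w w' assume h: "0 < (h::real)" "h < \<eta>" and \<psi>: "\<psi> \<in> schwartz"
      and w: "count_list w Pos = J" "count_list w Mom = N"
        "count_list w' Pos = J" "count_list w' Mom = N"
    let ?E = "energy h M K \<psi>" and ?n = "wnorm h 0 \<psi>"
    have nn: "?E \<ge> 0" "?n \<ge> 0" using h by (auto simp: energy_nonneg wnorm_nonneg)
    have "norm (word_form h w \<psi> - word_form h w' \<psi>)
        \<le> 2 * real N * real J * h * (\<delta> * ?E + C * ?n)"
      by (rule word_form_reorder) (use h \<psi> w C nn \<delta> in auto)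
    also have "\<dots> \<le> A * (\<delta> * ?E + C * ?n)"
      unfolding A_def using h nn C \<delta> by (intro mult_right_mono mult_left_mono) auto
    also have "\<dots> = (A * \<delta>) * ?E + A * C * ?n" by (simp add: algebra_simps)
    also have "\<dots> \<le> \<epsilon> * ?E + A * C * ?n"
      using \<delta> nn by (intro add_right_mono mult_right_mono)
    finally show "norm (word_form h w \<psi> - word_form h w' \<psi>) \<le> \<epsilon> * ?E + A * C * ?n" .
  qed
qed

lemma word_form_canonical:
  assumes "\<psi> \<in> schwartz"
  shows "word_form h (replicate a Mom @ replicate J Pos @ replicate c Mom) \<psi> =
    L2_inner ((position h ^^ J) ((momentum h ^^ c) \<psi>)) ((momentum h ^^ a) \<psi>)"
proof -
  have S: "(position h ^^ J) ((momentum h ^^ c) \<psi>) \<in> schwartz"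
    using act_schwartz[OF assms, of h "replicate J Pos @ replicate c Mom"]
    by (simp add: act_append act_replicate)
  show ?thesis
    by (simp add: word_form_def act_append act_replicate L2_inner_momentum_funpow[OF S assms])
qed

lemma count_list_replicate_letter:
  "count_list (replicate k a) b = (if a = b then k else 0)"
  by (induction k) auto

text \<open>The word is the pairing of \<open>X\<^sup>J D\<^sup>c \<psi>\<close> with \<open>D\<^sup>a \<psi>\<close>. As \<open>J \<le> 2 * M l - 1\<close>, the first factor can take
  the weight \<open>M l\<close>, admissible because \<open>c \<le> l\<close> and \<open>M\<close> is decreasing; the second factor then needs only
  the weight \<open>M l - 1\<close> and has order \<open>a < l\<close>, which leaves room for both interpolations.\<close>
lemma word_form_canonical_interior:
  assumes anti: "\<And>k l. k \<le> l \<Longrightarrow> l \<le> K \<Longrightarrow> M l \<le> M k"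
    and "l \<le> K" "J < 2 * M l" "a < l" "c \<le> l" "\<epsilon> > 0"
  shows "\<exists>C\<ge>0. \<forall>h \<psi>. 0 < h \<longrightarrow> \<psi> \<in> schwartz \<longrightarrow>
    norm (word_form h (replicate a Mom @ replicate J Pos @ replicate c Mom) \<psi>)
      \<le> \<epsilon> * energy h M K \<psi> + C * wnorm h 0 \<psi>"
proof -
  \<comment> \<open>Each of the three losses (the weight \<open>M l\<close>, the lowered weight, the lowered momentum)
     is kept below \<open>\<epsilon> / 4\<close>.\<close>
  define t where "t = \<epsilon> / 4"
  define \<epsilon>1 where "\<epsilon>1 = t * \<epsilon>"
  define D1 where "D1 = (1 / \<epsilon>1) ^ (M l - 1)"
  define \<epsilon>2 where "\<epsilon>2 = t * \<epsilon> / (D1 + 1)"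
  have pos: "t > 0" "\<epsilon>1 > 0" "D1 \<ge> 0" "\<epsilon>2 > 0"
    using assms by (auto simp: t_def \<epsilon>1_def D1_def \<epsilon>2_def intro!: divide_pos_pos add_nonneg_pos)
  have small1: "1 / (4 * t) * \<epsilon>1 = \<epsilon> / 4"
    using pos by (simp add: \<epsilon>1_def)
  have "D1 * \<epsilon>2 \<le> t * \<epsilon>"
    using pos assms by (simp add: \<epsilon>2_def field_simps)
  then have "1 / (4 * t) * (D1 * \<epsilon>2) \<le> 1 / (4 * t) * (t * \<epsilon>)"
    using pos by (intro mult_left_mono) auto
  then have small2: "1 / (4 * t) * (D1 * \<epsilon>2) \<le> \<epsilon> / 4"
    using pos by simp
  obtain D2 where D2: "D2 \<ge> 0" "\<And>h \<psi>. 0 \<le> h \<Longrightarrow> \<psi> \<in> schwartz \<Longrightarrow>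
     wnorm h 0 ((momentum h ^^ a) \<psi>) \<le> \<epsilon>2 * wnorm h 0 ((momentum h ^^ K) \<psi>) + D2 * wnorm h 0 \<psi>"
    using momentum_interpolation[of a K \<epsilon>2] pos assms by (meson order_less_le_trans)
  define C where "C = 1 / (4 * t) * (D1 * D2)"
  show ?thesis
  proof (intro exI[of _ C] conjI allI impI)
    show "0 \<le> C" using pos D2 by (simp add: C_def)
    fix h \<psi> assume h: "0 < (h::real)" and \<psi>: "\<psi> \<in> schwartz"
    let ?E = "energy h M K \<psi>" and ?n = "wnorm h 0 \<psi>"
    let ?f = "(momentum h ^^ c) \<psi>" and ?g = "(momentum h ^^ a) \<psi>"
    have E: "?E \<ge> 0" "?n \<ge> 0" using h by (auto simp: energy_nonneg wnorm_nonneg)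
    have S: "?f \<in> schwartz" "?g \<in> schwartz" using \<psi> momentum_funpow_schwartz by auto
    have M: "Suc (M l - 1) = M l" using assms by simp
    have f: "wnorm h (M l) ?f \<le> ?E"
      using assms h \<psi> by (intro wnorm_le_energy') auto
    have "wnorm h (M l - 1) ?g \<le> \<epsilon>1 * wnorm h (M l) ?g + D1 * wnorm h 0 ?g"
      using wnorm_weight_interpolation[OF S(2), of h \<epsilon>1 "M l - 1"] h pos M by (simp add: D1_def)
    also have "\<dots> \<le> \<epsilon>1 * ?E + D1 * (\<epsilon>2 * ?E + D2 * ?n)"
    proof (intro add_mono mult_left_mono)
      show "wnorm h (M l) ?g \<le> ?E"
        using assms h \<psi> by (intro wnorm_le_energy') auto
      have "wnorm h 0 ((momentum h ^^ K) \<psi>) \<le> ?E"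
        using h \<psi> by (intro wnorm_le_energy') auto
      then show "wnorm h 0 ?g \<le> \<epsilon>2 * ?E + D2 * ?n"
        using D2(2)[of h \<psi>] h \<psi> pos
        by (smt (verit) mult_left_mono)
    qed (use pos in auto)
    finally have g: "wnorm h (M l - 1) ?g \<le> \<epsilon>1 * ?E + D1 * (\<epsilon>2 * ?E + D2 * ?n)" .
    have "norm (L2_inner ((position h ^^ J) ?f) ?g)
        \<le> t * wnorm h (M l) ?f + 1 / (4 * t) * wnorm h (M l - 1) ?g"
      by (rule L2_inner_position_offdiagonal) (use S h pos assms in auto)
    also have "\<dots> \<le> t * ?E + 1 / (4 * t) * (\<epsilon>1 * ?E + D1 * (\<epsilon>2 * ?E + D2 * ?n))"
      using f g pos by (intro add_mono mult_left_mono) auto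
    also have "\<dots> = t * ?E + (1 / (4 * t) * \<epsilon>1) * ?E + (1 / (4 * t) * (D1 * \<epsilon>2)) * ?E + C * ?n"
      by (simp add: C_def distrib_left mult.assoc)
    also have "\<dots> \<le> \<epsilon> / 4 * ?E + \<epsilon> / 4 * ?E + \<epsilon> / 4 * ?E + C * ?n"
      unfolding small1 using small2 E by (intro add_mono mult_right_mono) (auto simp: t_def)
    also have "\<dots> \<le> \<epsilon> * ?E + C * ?n"
      using E assms by (simp add: field_simps)
    finally show "norm (word_form h (replicate a Mom @ replicate J Pos @ replicate c Mom) \<psi>)
        \<le> \<epsilon> * ?E + C * ?n"
      using word_form_canonical[OF \<psi>] by simp
  qed
qed

text \<open>Distributing the momenta evenly, \<open>N div 2\<close> of them to the left, reduces the claim to the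
  preceding lemma. The commutators are strictly interior for the same \<open>l\<close>, so the induction on the number
  of position letters covers them.\<close>
lemma word_form_interior:
  assumes anti: "\<And>k l. k \<le> l \<Longrightarrow> l \<le> K \<Longrightarrow> M l \<le> M k"
    and "\<eta> \<ge> 0" "l \<le> K"
  shows "J < 2 * M l \<Longrightarrow> N < 2 * l \<Longrightarrow> \<epsilon> > 0 \<Longrightarrow>
    \<exists>C\<ge>0. \<forall>h \<psi> w. 0 < h \<longrightarrow> h < \<eta> \<longrightarrow> \<psi> \<in> schwartz \<longrightarrow>
      count_list w Pos = J \<longrightarrow> count_list w Mom = N \<longrightarrow>
      norm (word_form h w \<psi>) \<le> \<epsilon> * energy h M K \<psi> + C * wnorm h 0 \<psi>"
proof (induction J arbitrary: N \<epsilon> rule: less_induct)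
  case (less J N \<epsilon>)
  define a where "a = N div 2"
  define c where "c = N - a"
  have ac: "a < l" "c \<le> l" "a + c = N" using less.prems by (auto simp: a_def c_def)
  let ?w = "replicate a Mom @ replicate J Pos @ replicate c Mom"
  have half: "\<epsilon> / 2 > 0" using less.prems by simp
  have "\<exists>C\<ge>0. \<forall>h \<psi>. 0 < h \<longrightarrow> \<psi> \<in> schwartz \<longrightarrow>
      norm (word_form h ?w \<psi>) \<le> \<epsilon> / 2 * energy h M K \<psi> + C * wnorm h 0 \<psi>"
    by (rule word_form_canonical_interior[where l = l]) (use anti assms(3) less.prems(1) ac half in auto)
  then obtain C1 where C1: "C1 \<ge> 0" "\<And>h \<psi>. 0 < h \<Longrightarrow> \<psi> \<in> schwartz \<Longrightarrow>
      norm (word_form h ?w \<psi>) \<le> \<epsilon> / 2 * energy h M K \<psi> + C1 * wnorm h 0 \<psi>"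
    by metis
  have "\<exists>C\<ge>0. \<forall>h \<psi> w w'. 0 < h \<longrightarrow> h < \<eta> \<longrightarrow> \<psi> \<in> schwartz \<longrightarrow>
        count_list w Pos = J \<longrightarrow> count_list w Mom = N \<longrightarrow>
        count_list w' Pos = J \<longrightarrow> count_list w' Mom = N \<longrightarrow>
        norm (word_form h w \<psi> - word_form h w' \<psi>) \<le> \<epsilon> / 2 * energy h M K \<psi> + C * wnorm h 0 \<psi>"
  proof (rule word_form_reorder_uniform[OF assms(2) half])
    fix \<delta> :: real assume \<delta>: "\<delta> > 0"
    show "\<exists>C\<ge>0. \<forall>h \<psi> v. 0 < h \<longrightarrow> h < \<eta> \<longrightarrow> \<psi> \<in> schwartz \<longrightarrow>
        Suc (count_list v Pos) = J \<longrightarrow> Suc (count_list v Mom) = N \<longrightarrow>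
        norm (word_form h v \<psi>) \<le> \<delta> * energy h M K \<psi> + C * wnorm h 0 \<psi>"
    proof (cases "J = 0 \<or> N = 0")
      case True
      then show ?thesis by auto
    next
      case False
      then obtain J' N' where JN: "J = Suc J'" "N = Suc N'"
        using not0_implies_Suc by blast
      show ?thesis
        using less.IH[of J' N' \<delta>] less.prems \<delta> JN by simp
    qed
  qed
  then obtain C2 where C2: "C2 \<ge> 0" "\<And>h \<psi> w w'. 0 < h \<Longrightarrow> h < \<eta> \<Longrightarrow> \<psi> \<in> schwartz \<Longrightarrow>
        count_list w Pos = J \<Longrightarrow> count_list w Mom = N \<Longrightarrow>
        count_list w' Pos = J \<Longrightarrow> count_list w' Mom = N \<Longrightarrow>
        norm (word_form h w \<psi> - word_form h w' \<psi>) \<le> \<epsilon> / 2 * energy h M K \<psi> + C2 * wnorm h 0 \<psi>"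
    by metis
  show ?case
  proof (intro exI[of _ "C1 + C2"] conjI allI impI)
    show "0 \<le> C1 + C2" using C1 C2 by simp
    fix h \<psi> w assume h: "0 < (h::real)" "h < \<eta>" and \<psi>: "\<psi> \<in> schwartz"
      and w: "count_list w Pos = J" "count_list w Mom = N"
    have "norm (word_form h w \<psi> - word_form h ?w \<psi>) \<le> \<epsilon> / 2 * energy h M K \<psi> + C2 * wnorm h 0 \<psi>"
      by (rule C2(2)) (use h \<psi> w ac in \<open>auto simp: count_list_replicate_letter\<close>)
    from norm_triangle_mono[OF this C1(2)[OF h(1) \<psi>]]
    show "norm (word_form h w \<psi>) \<le> \<epsilon> * energy h M K \<psi> + (C1 + C2) * wnorm h 0 \<psi>"
      by (simp add: algebra_simps)
  qed
qed

text \<open>The word itself has the full exponents \<open>(J, 2 * l)\<close>, but its commutators have exponents strictly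
  below those and are interior.\<close>
lemma word_form_boundary:
  assumes anti: "\<And>k l. k \<le> l \<Longrightarrow> l \<le> K \<Longrightarrow> M l \<le> M k"
    and "\<eta> \<ge> 0" "l \<le> K" "J \<le> 2 * M l" "\<epsilon> > 0"
  shows "\<exists>C\<ge>0. \<forall>h \<psi> w. 0 < h \<longrightarrow> h < \<eta> \<longrightarrow> \<psi> \<in> schwartz \<longrightarrow>
      count_list w Pos = J \<longrightarrow> count_list w Mom = 2 * l \<longrightarrow>
      norm (word_form h w \<psi> - L2_inner ((position h ^^ J) ((momentum h ^^ l) \<psi>)) ((momentum h ^^ l) \<psi>))
        \<le> \<epsilon> * energy h M K \<psi> + C * wnorm h 0 \<psi>"
proof -
  let ?w = "replicate l Mom @ replicate J Pos @ replicate l Mom"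
  have "\<exists>C\<ge>0. \<forall>h \<psi> w w'. 0 < h \<longrightarrow> h < \<eta> \<longrightarrow> \<psi> \<in> schwartz \<longrightarrow>
        count_list w Pos = J \<longrightarrow> count_list w Mom = 2 * l \<longrightarrow>
        count_list w' Pos = J \<longrightarrow> count_list w' Mom = 2 * l \<longrightarrow>
        norm (word_form h w \<psi> - word_form h w' \<psi>) \<le> \<epsilon> * energy h M K \<psi> + C * wnorm h 0 \<psi>"
  proof (rule word_form_reorder_uniform)
    fix \<delta> :: real assume \<delta>: "\<delta> > 0"
    show "\<exists>C\<ge>0. \<forall>h \<psi> v. 0 < h \<longrightarrow> h < \<eta> \<longrightarrow> \<psi> \<in> schwartz \<longrightarrow>
        Suc (count_list v Pos) = J \<longrightarrow> Suc (count_list v Mom) = 2 * l \<longrightarrow>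
        norm (word_form h v \<psi>) \<le> \<delta> * energy h M K \<psi> + C * wnorm h 0 \<psi>"
    proof (cases "J = 0 \<or> l = 0")
      case True
      then show ?thesis by auto
    next
      case False
      have "\<exists>C\<ge>0. \<forall>h \<psi> w. 0 < h \<longrightarrow> h < \<eta> \<longrightarrow> \<psi> \<in> schwartz \<longrightarrow>
        count_list w Pos = J - 1 \<longrightarrow> count_list w Mom = 2 * l - 1 \<longrightarrow>
        norm (word_form h w \<psi>) \<le> \<delta> * energy h M K \<psi> + C * wnorm h 0 \<psi>"
        by (rule word_form_interior[of K M \<eta> l]) (use assms False \<delta> in auto)
      then obtain C where C: "C \<ge> 0" "\<And>h \<psi> w. 0 < h \<Longrightarrow> h < \<eta> \<Longrightarrow> \<psi> \<in> schwartz \<Longrightarrow>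
        count_list w Pos = J - 1 \<Longrightarrow> count_list w Mom = 2 * l - 1 \<Longrightarrow>
        norm (word_form h w \<psi>) \<le> \<delta> * energy h M K \<psi> + C * wnorm h 0 \<psi>"
        by metis
      show ?thesis
        by (intro exI[of _ C] conjI allI impI C) auto
    qed
  qed (use assms in auto)
  then obtain C where C: "C \<ge> 0" "\<And>h \<psi> w w'. 0 < h \<Longrightarrow> h < \<eta> \<Longrightarrow> \<psi> \<in> schwartz \<Longrightarrow>
        count_list w Pos = J \<Longrightarrow> count_list w Mom = 2 * l \<Longrightarrow>
        count_list w' Pos = J \<Longrightarrow> count_list w' Mom = 2 * l \<Longrightarrow>
        norm (word_form h w \<psi> - word_form h w' \<psi>) \<le> \<epsilon> * energy h M K \<psi> + C * wnorm h 0 \<psi>"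
    by metis
  show ?thesis
  proof (intro exI[of _ C] conjI allI impI C(1))
    fix h \<psi> w assume "0 < (h::real)" "h < \<eta>" and \<psi>: "\<psi> \<in> schwartz"
      and "count_list w Pos = J" "count_list w Mom = 2 * l"
    then show "norm (word_form h w \<psi> - L2_inner ((position h ^^ J) ((momentum h ^^ l) \<psi>)) ((momentum h ^^ l) \<psi>))
        \<le> \<epsilon> * energy h M K \<psi> + C * wnorm h 0 \<psi>"
      using C(2)[of h \<psi> w ?w] word_form_canonical[OF \<psi>, of h l J l]
      by (simp add: count_list_replicate_letter)
  qed
qed


section \<open>Powers of the symbol\<close>

text \<open>Half the largest degree in \<open>x\<close> among the products \<open>b k1 * ... * b kn\<close> with
  \<open>k1 + ... + kn = l\<close>, when \<open>b k\<close> has degree \<open>2 * M k\<close>.\<close>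
primrec top_weight :: "nat \<Rightarrow> (nat \<Rightarrow> nat) \<Rightarrow> nat \<Rightarrow> nat \<Rightarrow> nat" where
  "top_weight m M 0 l = 0"
| "top_weight m M (Suc n) l =
     Max ((\<lambda>k. M k + top_weight m M n (l - k)) ` {k. k \<le> m \<and> k \<le> l \<and> l - k \<le> n * m})"

lemma top_weight_add_le:
  assumes "k \<le> m" "l \<le> n * m"
  shows "M k + top_weight m M n l \<le> top_weight m M (Suc n) (k + l)"
proof -
  let ?f = "\<lambda>k'. M k' + top_weight m M n (k + l - k')"
  let ?A = "{k'. k' \<le> m \<and> k' \<le> k + l \<and> k + l - k' \<le> n * m}"
  have "finite ?A" by (rule finite_subset[of _ "{..m}"]) auto
  moreover have "k \<in> ?A" using assms by simp
  ultimately have "?f k \<le> Max (?f ` ?A)"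
    by (intro Max_ge finite_imageI imageI)
  then show ?thesis by simp
qed

lemma top_weight_attained:
  assumes "l \<le> Suc n * m"
  shows "\<exists>k. k \<le> m \<and> k \<le> l \<and> l - k \<le> n * m \<and>
    top_weight m M (Suc n) l = M k + top_weight m M n (l - k)"
proof -
  let ?f = "\<lambda>k. M k + top_weight m M n (l - k)"
  let ?A = "{k. k \<le> m \<and> k \<le> l \<and> l - k \<le> n * m}"
  have "finite ?A" by (rule finite_subset[of _ "{..m}"]) auto
  then have fin: "finite (?f ` ?A)" by (rule finite_imageI)
  have "min l m \<in> ?A" using assms by auto
  then have "?f (min l m) \<in> ?f ` ?A" by (rule imageI)
  then have "?f ` ?A \<noteq> {}" by (metis empty_iff)
  with fin have "Max (?f ` ?A) \<in> ?f ` ?A" by (rule Max_in)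
  then obtain k where k: "k \<in> ?A" "Max (?f ` ?A) = ?f k" by (rule imageE)
  from k(2) have "top_weight m M (Suc n) l = ?f k" unfolding top_weight.simps .
  with k(1) show ?thesis by (intro exI[of _ k]) simp
qed

declare top_weight.simps(2) [simp del]

text \<open>In a splitting of \<open>Suc l\<close> of maximal weight some index is positive; lowering it by one
  splits \<open>l\<close>, and the weight does not drop because \<open>M\<close> is decreasing.\<close>
lemma top_weight_Suc_le:
  assumes "\<And>k l. k \<le> l \<Longrightarrow> l \<le> m \<Longrightarrow> M l \<le> M k"
  shows "Suc l \<le> n * m \<Longrightarrow> top_weight m M n (Suc l) \<le> top_weight m M n l"
proof (induction n arbitrary: l)
  case (Suc n)
  obtain k where k: "k \<le> m" "k \<le> Suc l" "Suc l - k \<le> n * m"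
    "top_weight m M (Suc n) (Suc l) = M k + top_weight m M n (Suc l - k)"
    using top_weight_attained[OF Suc.prems] by blast
  show ?case
  proof (cases k)
    case 0
    then have "M k + top_weight m M n (Suc l - k) \<le> M 0 + top_weight m M n l"
      using Suc.IH[of l] k by simp
    also have "\<dots> \<le> top_weight m M (Suc n) (0 + l)"
      using k 0 by (intro top_weight_add_le) auto
    finally show ?thesis using k by simp
  next
    case (Suc k')
    then have "M k + top_weight m M n (Suc l - k) \<le> M k' + top_weight m M n (l - k')"
      using assms[of k' k] k by simp
    also have "\<dots> \<le> top_weight m M (Suc n) (k' + (l - k'))"
      using k Suc by (intro top_weight_add_le) auto
    also have "k' + (l - k') = l" using k Suc by simp
    finally show ?thesis using k by simp
  qed
qed simp

lemma top_weight_antimono: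
  assumes "\<And>k l. k \<le> l \<Longrightarrow> l \<le> m \<Longrightarrow> M l \<le> M k" "k \<le> l" "l \<le> n * m"
  shows "top_weight m M n l \<le> top_weight m M n k"
  using assms(2,3)
proof (induction l rule: dec_induct)
  case (step l)
  have "top_weight m M n (Suc l) \<le> top_weight m M n l"
    by (rule top_weight_Suc_le) (use assms(1) step in auto)
  then show ?case using step by simp
qed simp

text \<open>The polynomial \<open>(\<Sum>k\<le>m. \<beta> k * \<xi> ^ k) ^ n\<close> in \<open>\<xi>\<close> with each power \<open>\<xi> ^ i\<close> replaced by \<open>y i\<close>. Later
  \<open>\<beta> k\<close> is a coefficient polynomial at a point and \<open>y i\<close> is \<open>\<bar>D\<^sup>i \<psi>\<bar>\<^sup>2\<close> there.\<close>
primrec symbol_power :: "(nat \<Rightarrow> real) \<Rightarrow> nat \<Rightarrow> nat \<Rightarrow> (nat \<Rightarrow> real) \<Rightarrow> real" where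
  "symbol_power \<beta> m 0 y = y 0"
| "symbol_power \<beta> m (Suc n) y = (\<Sum>k\<le>m. \<beta> k * symbol_power \<beta> m n (\<lambda>i. y (k + i)))"

lemma symbol_power_lower_elliptic:
  assumes "\<And>k. k \<le> m \<Longrightarrow> c * T ^ M k \<le> \<beta> k" "c \<ge> 0" "T \<ge> 0"
  shows "(\<And>i. y i \<ge> 0) \<Longrightarrow>
    c ^ n * (\<Sum>l\<le>n * m. T ^ top_weight m M n l * y l) \<le> symbol_power \<beta> m n y"
proof (induction n arbitrary: y)
  case (Suc n)
  define F where "F = (\<lambda>(k, l). T ^ (M k + top_weight m M n l) * y (k + l))"
  have F0: "F p \<ge> 0" for p using assms Suc.prems by (auto simp: F_def split: prod.splits)
  \<comment> \<open>Every \<open>l\<close> has a splitting \<open>k + (l - k)\<close> of maximal weight, and distinct \<open>l\<close>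
     have distinct splittings.\<close>
  obtain \<kappa> where \<kappa>: "\<And>l. l \<le> Suc n * m \<Longrightarrow> \<kappa> l \<le> m \<and> \<kappa> l \<le> l \<and> l - \<kappa> l \<le> n * m \<and>
      top_weight m M (Suc n) l = M (\<kappa> l) + top_weight m M n (l - \<kappa> l)"
    using that[of "\<lambda>l. SOME k. k \<le> m \<and> k \<le> l \<and> l - k \<le> n * m \<and>
      top_weight m M (Suc n) l = M k + top_weight m M n (l - k)"]
      someI_ex[OF top_weight_attained[where M = M]] by blast
  have "(\<Sum>l\<le>Suc n * m. T ^ top_weight m M (Suc n) l * y l)
      = (\<Sum>l\<le>Suc n * m. F (\<kappa> l, l - \<kappa> l))"
    by (rule sum.cong) (use \<kappa> in \<open>auto simp: F_def\<close>)
  also have "\<dots> = sum F ((\<lambda>l. (\<kappa> l, l - \<kappa> l)) ` {..Suc n * m})"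
  proof (rule sum.reindex[unfolded comp_def, symmetric])
    show "inj_on (\<lambda>l. (\<kappa> l, l - \<kappa> l)) {..Suc n * m}"
    proof (rule inj_onI)
      fix l l' assume "l \<in> {..Suc n * m}" "l' \<in> {..Suc n * m}" "(\<kappa> l, l - \<kappa> l) = (\<kappa> l', l' - \<kappa> l')"
      then show "l = l'" using \<kappa>[of l] \<kappa>[of l'] by auto
    qed
  qed
  also have "\<dots> \<le> sum F ({..m} \<times> {..n * m})"
    by (rule sum_mono2) (use \<kappa> F0 in auto)
  also have "\<dots> = (\<Sum>k\<le>m. \<Sum>l\<le>n * m. F (k, l))"
    by (simp add: sum.cartesian_product)
  also have "\<dots> = (\<Sum>k\<le>m. T ^ M k * (\<Sum>l\<le>n * m. T ^ top_weight m M n l * y (k + l)))"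
    by (simp add: F_def power_add sum_distrib_left mult.assoc)
  finally have "c ^ Suc n * (\<Sum>l\<le>Suc n * m. T ^ top_weight m M (Suc n) l * y l)
      \<le> c ^ Suc n * (\<Sum>k\<le>m. T ^ M k * (\<Sum>l\<le>n * m. T ^ top_weight m M n l * y (k + l)))"
    using assms by (intro mult_left_mono) auto
  also have "\<dots> = (\<Sum>k\<le>m. (c * T ^ M k) * (c ^ n * (\<Sum>l\<le>n * m. T ^ top_weight m M n l * y (k + l))))"
    by (simp add: sum_distrib_left mult_ac)
  also have "\<dots> \<le> (\<Sum>k\<le>m. \<beta> k * symbol_power \<beta> m n (\<lambda>i. y (k + i)))"
  proof (rule sum_mono)
    fix k assume k: "k \<in> {..m}"
    have 0: "0 \<le> c ^ n * (\<Sum>l\<le>n * m. T ^ top_weight m M n l * y (k + l))"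
      using assms Suc.prems by (intro mult_nonneg_nonneg sum_nonneg) auto
    have 1: "c ^ n * (\<Sum>l\<le>n * m. T ^ top_weight m M n l * y (k + l)) \<le> symbol_power \<beta> m n (\<lambda>i. y (k + i))"
      using Suc.IH[of "\<lambda>i. y (k + i)"] Suc.prems by simp
    have 2: "c * T ^ M k \<le> \<beta> k" "0 \<le> c * T ^ M k" using assms k by auto
    show "(c * T ^ M k) * (c ^ n * (\<Sum>l\<le>n * m. T ^ top_weight m M n l * y (k + l)))
        \<le> \<beta> k * symbol_power \<beta> m n (\<lambda>i. y (k + i))"
      using 0 1 2 by (intro mult_mono) auto
  qed
  finally show ?case by simp
qed simp

lemma sum_shift_le:
  fixes y :: "nat \<Rightarrow> real"
  assumes "finite A" "finite B" "\<And>i. i \<in> A \<Longrightarrow> k + i \<in> B" "\<And>i. y i \<ge> 0"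
  shows "(\<Sum>i\<in>A. y (k + i)) \<le> (\<Sum>i\<in>B. y i)"
proof -
  have "(\<Sum>i\<in>A. y (k + i)) = sum y ((+) k ` A)"
    by (simp add: sum.reindex)
  also have "\<dots> \<le> sum y B" using assms by (intro sum_mono2) auto
  finally show ?thesis .
qed

lemma symbol_power_abs_le:
  assumes "\<And>k. k \<le> m \<Longrightarrow> \<bar>\<beta> k\<bar> \<le> B" "B \<ge> 0"
  shows "(\<And>i. y i \<ge> 0) \<Longrightarrow> \<bar>symbol_power \<beta> m n y\<bar> \<le> (real (Suc m) * B) ^ n * (\<Sum>l\<le>n * m. y l)"
proof (induction n arbitrary: y)
  case (Suc n)
  have "\<bar>symbol_power \<beta> m (Suc n) y\<bar> \<le> (\<Sum>k\<le>m. \<bar>\<beta> k * symbol_power \<beta> m n (\<lambda>i. y (k + i))\<bar>)"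
    by simp
  also have "\<dots> \<le> (\<Sum>k\<le>m. B * ((real (Suc m) * B) ^ n * (\<Sum>l\<le>Suc n * m. y l)))"
  proof (rule sum_mono)
    fix k assume k: "k \<in> {..m}"
    have "\<bar>symbol_power \<beta> m n (\<lambda>i. y (k + i))\<bar> \<le> (real (Suc m) * B) ^ n * (\<Sum>l\<le>n * m. y (k + l))"
      using Suc.IH[of "\<lambda>i. y (k + i)"] Suc.prems by simp
    also have "\<dots> \<le> (real (Suc m) * B) ^ n * (\<Sum>l\<le>Suc n * m. y l)"
      using assms Suc.prems k by (intro mult_left_mono sum_shift_le) auto
    finally show "\<bar>\<beta> k * symbol_power \<beta> m n (\<lambda>i. y (k + i))\<bar>
        \<le> B * ((real (Suc m) * B) ^ n * (\<Sum>l\<le>Suc n * m. y l))"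
      unfolding abs_mult using assms k by (intro mult_mono) auto
  qed
  finally show ?case by (simp add: mult.assoc)
qed simp

text \<open>The term \<open>y (n * m)\<close> arises only by taking the index \<open>m\<close> in all \<open>n\<close> factors, so its coefficient
  is \<open>\<beta> m ^ n\<close>; everything else has a smaller index and may have any sign.\<close>
lemma symbol_power_lower_bounded:
  assumes "\<delta> > 0" "B \<ge> 0"
  shows "\<exists>C\<ge>0. \<forall>\<beta> y. (\<forall>k\<le>m. \<bar>\<beta> k\<bar> \<le> B) \<longrightarrow> \<delta> \<le> \<beta> m \<longrightarrow> (\<forall>i. y i \<ge> 0) \<longrightarrow>
    \<delta> ^ n * y (n * m) - C * (\<Sum>l<n * m. y l) \<le> symbol_power \<beta> m n y"
proof (induction n)
  case 0
  then show ?case by auto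
next
  case (Suc n)
  then obtain C where C: "C \<ge> 0" "\<forall>\<beta> y. (\<forall>k\<le>m. \<bar>\<beta> k\<bar> \<le> B) \<longrightarrow> \<delta> \<le> \<beta> m \<longrightarrow> (\<forall>i. y i \<ge> 0) \<longrightarrow>
    \<delta> ^ n * y (n * m) - C * (\<Sum>l<n * m. y l) \<le> symbol_power \<beta> m n y"
    by (elim exE conjE) (rule that)
  define A where "A = (real (Suc m) * B) ^ n"
  have A: "A \<ge> 0" using assms by (simp add: A_def)
  show ?case
  proof (intro exI[of _ "B * C + real m * (B * A)"] conjI allI impI)
    show "0 \<le> B * C + real m * (B * A)" using C A assms by simp
    fix \<beta> y :: "nat \<Rightarrow> real"
    assume \<beta>: "\<forall>k\<le>m. \<bar>\<beta> k\<bar> \<le> B" "\<delta> \<le> \<beta> m" and y: "\<forall>i. y i \<ge> 0"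
    define Y where "Y = (\<Sum>l<Suc n * m. y l)"
    have Y: "Y \<ge> 0" using y by (simp add: Y_def sum_nonneg)
    have \<beta>m: "0 \<le> \<beta> m" "\<beta> m \<le> B" using \<beta> assms abs_le_D1 by auto
    have "\<delta> ^ n * y (m + n * m) - C * (\<Sum>l<n * m. y (m + l)) \<le> symbol_power \<beta> m n (\<lambda>i. y (m + i))"
      using C(2)[rule_format, of \<beta> "\<lambda>i. y (m + i)"] \<beta> y by simp
    moreover have "(\<Sum>l<n * m. y (m + l)) \<le> Y"
      unfolding Y_def using y by (intro sum_shift_le) auto
    ultimately have "\<delta> ^ n * y (m + n * m) - C * Y \<le> symbol_power \<beta> m n (\<lambda>i. y (m + i))"
      using C(1) by (smt (verit) mult_left_mono)
    then have "\<beta> m * (\<delta> ^ n * y (m + n * m) - C * Y) \<le> \<beta> m * symbol_power \<beta> m n (\<lambda>i. y (m + i))"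
      using \<beta>m by (intro mult_left_mono)
    moreover have "\<delta> * (\<delta> ^ n * y (m + n * m)) \<le> \<beta> m * (\<delta> ^ n * y (m + n * m))"
      using \<beta> y assms by (intro mult_right_mono) auto
    moreover have "\<beta> m * (C * Y) \<le> B * (C * Y)"
      using \<beta>m C Y by (intro mult_right_mono) auto
    ultimately have top: "\<delta> * (\<delta> ^ n * y (m + n * m)) - B * (C * Y)
        \<le> \<beta> m * symbol_power \<beta> m n (\<lambda>i. y (m + i))"
      by (simp add: right_diff_distrib)
    have rest: "\<bar>\<beta> k * symbol_power \<beta> m n (\<lambda>i. y (k + i))\<bar> \<le> B * (A * Y)" if k: "k < m" for k
    proof -
      have "\<bar>symbol_power \<beta> m n (\<lambda>i. y (k + i))\<bar> \<le> A * (\<Sum>l\<le>n * m. y (k + l))"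
        unfolding A_def by (rule symbol_power_abs_le) (use \<beta> assms y in auto)
      also have "\<dots> \<le> A * Y"
        unfolding Y_def using k y A by (intro mult_left_mono sum_shift_le) auto
      finally show ?thesis
        unfolding abs_mult using \<beta> k assms by (intro mult_mono) auto
    qed
    have "- (real m * (B * (A * Y))) = (\<Sum>k<m. - (B * (A * Y)))"
      by simp
    also have "\<dots> \<le> (\<Sum>k<m. \<beta> k * symbol_power \<beta> m n (\<lambda>i. y (k + i)))"
    proof (rule sum_mono)
      fix k assume "k \<in> {..<m}"
      then have "\<bar>\<beta> k * symbol_power \<beta> m n (\<lambda>i. y (k + i))\<bar> \<le> B * (A * Y)" using rest by simp
      then show "- (B * (A * Y)) \<le> \<beta> k * symbol_power \<beta> m n (\<lambda>i. y (k + i))"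
        by (simp only: abs_le_iff) linarith
    qed
    finally have "\<delta> * (\<delta> ^ n * y (m + n * m)) - B * (C * Y) - real m * (B * (A * Y))
        \<le> \<beta> m * symbol_power \<beta> m n (\<lambda>i. y (m + i)) + (\<Sum>k<m. \<beta> k * symbol_power \<beta> m n (\<lambda>i. y (k + i)))"
      using top by linarith
    also have "\<dots> = symbol_power \<beta> m (Suc n) y"
      by (simp add: lessThan_Suc_atMost[symmetric])
    finally have "\<delta> * (\<delta> ^ n * y (m + n * m)) - B * (C * Y) - real m * (B * (A * Y))
        \<le> symbol_power \<beta> m (Suc n) y" .
    moreover have "\<delta> * (\<delta> ^ n * y (m + n * m)) - B * (C * Y) - real m * (B * (A * Y))
        = \<delta> ^ Suc n * y (Suc n * m) - (B * C + real m * (B * A)) * Y"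
      by (simp add: algebra_simps)
    ultimately show "\<delta> ^ Suc n * y (Suc n * m) - (B * C + real m * (B * A)) * (\<Sum>l<Suc n * m. y l)
        \<le> symbol_power \<beta> m (Suc n) y"
      unfolding Y_def by (simp only:)
  qed
qed

text \<open>The two regimes are large \<open>x\<close>, where every coefficient is elliptic, and bounded \<open>x\<close>, where
  only the coefficient of the highest order is known to be positive.\<close>
lemma symbol_power_lower:
  assumes "c > 0" "\<delta> > 0" "B \<ge> 0" "T0 \<ge> 1"
  shows "\<exists>c'>0. \<exists>C\<ge>0. \<forall>\<beta> T y. T \<ge> 1 \<longrightarrow> (\<forall>i. y i \<ge> 0) \<longrightarrow>
    (\<forall>k\<le>m. c * T ^ M k \<le> \<beta> k) \<or> (T \<le> T0 \<and> (\<forall>k\<le>m. \<bar>\<beta> k\<bar> \<le> B) \<and> \<delta> \<le> \<beta> m) \<longrightarrow>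
    c' * (\<Sum>l\<le>n * m. T ^ top_weight m M n l * y l) - C * (\<Sum>l<n * m. y l) \<le> symbol_power \<beta> m n y"
proof -
  obtain C where C: "C \<ge> 0" "\<forall>\<beta> y. (\<forall>k\<le>m. \<bar>\<beta> k\<bar> \<le> B) \<longrightarrow> \<delta> \<le> \<beta> m \<longrightarrow> (\<forall>i. y i \<ge> 0) \<longrightarrow>
    \<delta> ^ n * y (n * m) - C * (\<Sum>l<n * m. y l) \<le> symbol_power \<beta> m n y"
    using symbol_power_lower_bounded[OF assms(2,3), of m n] by (elim exE conjE) (rule that)
  define D where "D = (\<Sum>l\<le>n * m. top_weight m M n l)"
  have D: "top_weight m M n l \<le> D" if "l \<le> n * m" for l
    unfolding D_def using that by (intro member_le_sum) auto
  define A where "A = T0 ^ D"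
  have A: "A \<ge> 1" using assms by (simp add: A_def)
  define c' where "c' = min (c ^ n) (\<delta> ^ n / A)"
  have c': "c' > 0" "c' \<le> c ^ n" "c' * A \<le> \<delta> ^ n"
  proof -
    have "\<delta> ^ n / A > 0" using assms(2) A by simp
    then show "c' > 0" using assms(1) by (simp add: c'_def)
    show "c' \<le> c ^ n" by (simp add: c'_def)
    have "c' \<le> \<delta> ^ n / A" by (simp add: c'_def)
    then show "c' * A \<le> \<delta> ^ n" using A by (simp add: pos_le_divide_eq)
  qed
  show ?thesis
  proof (rule exI[of _ c'], rule conjI[OF c'(1)], rule exI[of _ "C + c' * A"], intro conjI allI impI)
    show "0 \<le> C + c' * A" using C(1) A c'(1) by simp
    fix \<beta> y :: "nat \<Rightarrow> real" and T :: real
    assume T: "T \<ge> 1" and y: "\<forall>i. y i \<ge> 0"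
      and cases: "(\<forall>k\<le>m. c * T ^ M k \<le> \<beta> k) \<or> (T \<le> T0 \<and> (\<forall>k\<le>m. \<bar>\<beta> k\<bar> \<le> B) \<and> \<delta> \<le> \<beta> m)"
    let ?S = "\<Sum>l\<le>n * m. T ^ top_weight m M n l * y l" and ?Y = "\<Sum>l<n * m. y l"
    have S: "?S \<ge> 0" and Y: "?Y \<ge> 0" using T y by (auto intro!: sum_nonneg)
    from cases show "c' * ?S - (C + c' * A) * ?Y \<le> symbol_power \<beta> m n y"
    proof
      assume "\<forall>k\<le>m. c * T ^ M k \<le> \<beta> k"
      then have "c ^ n * ?S \<le> symbol_power \<beta> m n y"
        using assms T y by (intro symbol_power_lower_elliptic) auto
      moreover have "c' * ?S \<le> c ^ n * ?S" using c' S by (intro mult_right_mono)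
      moreover have "0 \<le> (C + c' * A) * ?Y" using C(1) A c'(1) Y by simp
      ultimately show ?thesis by linarith
    next
      assume *: "T \<le> T0 \<and> (\<forall>k\<le>m. \<bar>\<beta> k\<bar> \<le> B) \<and> \<delta> \<le> \<beta> m"
      have TA: "T ^ top_weight m M n l \<le> A" if "l \<le> n * m" for l
      proof -
        have "T ^ top_weight m M n l \<le> T ^ D" by (rule power_increasing[OF D[OF that] T])
        also have "\<dots> \<le> A" unfolding A_def using * T by (intro power_mono) auto
        finally show ?thesis .
      qed
      have "?S \<le> (\<Sum>l\<le>n * m. A * y l)"
        using TA y by (intro sum_mono mult_right_mono) auto
      also have "\<dots> = A * y (n * m) + A * ?Y"
        by (simp add: lessThan_Suc_atMost[symmetric] sum_distrib_left)
      finally have "c' * ?S \<le> c' * (A * y (n * m) + A * ?Y)"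
        using c' by (intro mult_left_mono) auto
      also have "\<dots> = (c' * A) * y (n * m) + c' * A * ?Y" by (simp add: algebra_simps)
      also have "\<dots> \<le> \<delta> ^ n * y (n * m) + c' * A * ?Y"
        using c'(3) y by (intro add_right_mono mult_right_mono) auto
  
      finally have upper: "c' * ?S \<le> \<delta> ^ n * y (n * m) + c' * A * ?Y" .
      have "\<delta> ^ n * y (n * m) - C * ?Y \<le> symbol_power \<beta> m n y"
        using C(2) * y by blast
      then show ?thesis using upper unfolding distrib_right by linarith
    qed
  qed
qed


section \<open>Uniform bounds from the hypotheses on the coefficients\<close>

lemma ereal_pos_real_lower:
  assumes "(0::ereal) < z"
  shows "\<exists>\<delta>>0. ereal \<delta> \<le> z"
  using ereal_dense2[OF assms] by (auto simp: zero_ereal_def intro: less_imp_le)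

text \<open>The upper bound \<open>B\<close> comes from continuity on the compact interval \<open>{0..\<eta>}\<close>; the conditions on
  the infima yield the common lower bound \<open>\<delta>\<close>.\<close>
lemma assumption1_coefficients:
  assumes "assumption1 m b \<eta>"
  shows "\<exists>M \<alpha> B \<delta>. B \<ge> 0 \<and> \<delta> > 0 \<and>
    (\<forall>l\<le>m. \<forall>h. 0 < h \<longrightarrow> h < \<eta> \<longrightarrow> b l h = (\<Sum>j\<le>2 * M l. monom (\<alpha> l j h) j)) \<and>
    (\<forall>l\<le>m. \<forall>j\<le>2 * M l. \<forall>h. 0 < h \<longrightarrow> h < \<eta> \<longrightarrow> \<bar>\<alpha> l j h\<bar> \<le> B) \<and>
    (\<forall>l\<le>m. \<forall>h. 0 < h \<longrightarrow> h < \<eta> \<longrightarrow> \<delta> \<le> \<alpha> l (2 * M l) h) \<and>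
    (\<forall>x h. 0 < h \<longrightarrow> h < \<eta> \<longrightarrow> \<delta> \<le> poly (b m h) x) \<and>
    (\<forall>k l. k \<le> l \<longrightarrow> l \<le> m \<longrightarrow> M l \<le> M k)"
proof -
  obtain M :: "nat \<Rightarrow> nat" and \<alpha> :: "nat \<Rightarrow> nat \<Rightarrow> real \<Rightarrow> real" where
    \<eta>: "\<eta> > 0" and
    cont: "\<And>l j. l \<le> m \<Longrightarrow> j \<le> 2 * M l \<Longrightarrow> continuous_on {0..\<eta>} (\<alpha> l j)" and
    expand: "\<And>l h. l \<le> m \<Longrightarrow> h \<in> {0<..<\<eta>} \<Longrightarrow> b l h = (\<Sum>j\<le>2 * M l. monom (\<alpha> l j h) j)" and
    deg: "\<And>l h. h \<in> {0<..<\<eta>} \<Longrightarrow> l \<in> {1..m} \<Longrightarrow>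
           degree (b l h) = 2 * M l \<and> degree (b (l - 1) h) = 2 * M (l - 1) \<and>
           degree (b l h) \<le> degree (b (l - 1) h)" and
    pos: "(INF (x, h) \<in> UNIV \<times> {0<..<\<eta>}. ereal (poly (b m h) x)) > 0" and
    lead: "Min ((\<lambda>l. INF h\<in>{0<..<\<eta>}. ereal (\<alpha> l (2 * M l) h)) ` {..m}) > 0"
    using assms unfolding assumption1_def by blast
  have "\<exists>B. \<forall>h\<in>{0..\<eta>}. \<bar>\<alpha> l j h\<bar> \<le> B" if "l \<le> m" "j \<le> 2 * M l" for l j
    using compact_imp_bounded[OF compact_continuous_image[OF cont[OF that]]]
    by (auto simp: bounded_iff)
  then obtain B where B: "\<And>l j h. l \<le> m \<Longrightarrow> j \<le> 2 * M l \<Longrightarrow> h \<in> {0..\<eta>} \<Longrightarrow> \<bar>\<alpha> l j h\<bar> \<le> B l j"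
    by metis
  define B' where "B' = (\<Sum>l\<le>m. \<Sum>j\<le>2 * M l. \<bar>B l j\<bar>)"
  have B': "\<bar>\<alpha> l j h\<bar> \<le> B'" if "l \<le> m" "j \<le> 2 * M l" "0 < h" "h < \<eta>" for l j h
  proof -
    have "\<bar>\<alpha> l j h\<bar> \<le> B l j" using B[of l j h] that by simp
    also have "\<dots> \<le> \<bar>B l j\<bar>" by simp
    also have "\<dots> \<le> (\<Sum>j\<le>2 * M l. \<bar>B l j\<bar>)"
      using that by (intro member_le_sum) auto
    also have "\<dots> \<le> B'"
      unfolding B'_def using that
      by (intro member_le_sum[where f = "\<lambda>l. \<Sum>j\<le>2 * M l. \<bar>B l j\<bar>"]) (auto intro: sum_nonneg)
    finally show ?thesis .
  qed
  obtain \<delta>1 where \<delta>1: "\<delta>1 > 0" "ereal \<delta>1 \<le> (INF (x, h) \<in> UNIV \<times> {0<..<\<eta>}. ereal (poly (b m h) x))"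
    using ereal_pos_real_lower[OF pos] by blast
  obtain \<delta>2 where \<delta>2: "\<delta>2 > 0"
      "ereal \<delta>2 \<le> Min ((\<lambda>l. INF h\<in>{0<..<\<eta>}. ereal (\<alpha> l (2 * M l) h)) ` {..m})"
    using ereal_pos_real_lower[OF lead] by blast
  have \<delta>1': "\<delta>1 \<le> poly (b m h) x" if "0 < h" "h < \<eta>" for x h
  proof -
    have "(INF (x, h) \<in> UNIV \<times> {0<..<\<eta>}. ereal (poly (b m h) x)) \<le> ereal (poly (b m h) x)"
      by (rule INF_lower2[of "(x, h)"]) (use that in auto)
    then have "ereal \<delta>1 \<le> ereal (poly (b m h) x)" using \<delta>1 order_trans by blast
    then show ?thesis by simp
  qed
  have \<delta>2': "\<delta>2 \<le> \<alpha> l (2 * M l) h" if "l \<le> m" "0 < h" "h < \<eta>" for l h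
  proof -
    have "Min ((\<lambda>l. INF h\<in>{0<..<\<eta>}. ereal (\<alpha> l (2 * M l) h)) ` {..m})
        \<le> (INF h\<in>{0<..<\<eta>}. ereal (\<alpha> l (2 * M l) h))"
      using that by (intro Min_le) auto
    also have "\<dots> \<le> ereal (\<alpha> l (2 * M l) h)"
      by (rule INF_lower) (use that in auto)
    finally have "ereal \<delta>2 \<le> ereal (\<alpha> l (2 * M l) h)" using \<delta>2 order_trans by blast
    then show ?thesis by simp
  qed
  have step: "M (Suc l) \<le> M l" if "Suc l \<le> m" for l
    using deg[of "\<eta> / 2" "Suc l"] \<eta> that by simp
  have "k \<le> l \<Longrightarrow> l \<le> m \<Longrightarrow> M l \<le> M k" for k l
  proof (induction l rule: dec_induct)
    case (step l)
    then show ?case using \<open>\<And>l. Suc l \<le> m \<Longrightarrow> M (Suc l) \<le> M l\<close>[of l] by simp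
  qed simp
  moreover have "B' \<ge> 0" unfolding B'_def by (intro sum_nonneg) auto
  moreover have "min \<delta>1 \<delta>2 > 0" using \<delta>1 \<delta>2 by simp
  ultimately show ?thesis
    using B' \<delta>1' \<delta>2' expand
    by (intro exI[of _ M] exI[of _ \<alpha>] exI[of _ B'] exI[of _ "min \<delta>1 \<delta>2"]) (auto simp: min.coboundedI1 min.coboundedI2)
qed

text \<open>Beyond the stated radius the leading term is at least twice the sum of the others. The
  exponent \<open>N\<close> is decoupled from \<open>M\<close> so that one radius and one constant serve several polynomials.\<close>
lemma polynomial_sum_elliptic:
  fixes a :: "nat \<Rightarrow> real"
  assumes a: "\<And>j. j \<le> 2 * M \<Longrightarrow> \<bar>a j\<bar> \<le> B" "\<delta> \<le> a (2 * M)" and "\<delta> > 0" "B \<ge> 0"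
    and N: "2 * M \<le> N" and x: "\<bar>x\<bar> \<ge> 1 + 2 * real N * B / \<delta>"
  shows "\<delta> / 2 ^ Suc N * (1 + x\<^sup>2) ^ M \<le> (\<Sum>j\<le>2 * M. a j * x ^ j)"
proof -
  have x1: "\<bar>x\<bar> \<ge> 1" and x2: "real N * B \<le> \<delta> / 2 * \<bar>x\<bar>"
  proof -
    have "0 \<le> 2 * real N * B / \<delta>" using assms by simp
    then show "\<bar>x\<bar> \<ge> 1" using x by linarith
    have "2 * real N * B / \<delta> \<le> \<bar>x\<bar>" using x by linarith
    then show "real N * B \<le> \<delta> / 2 * \<bar>x\<bar>" using assms by (simp add: field_simps)
  qed
  have x2M: "x ^ (2 * M) \<ge> 0" by simp
  have "1 + x\<^sup>2 \<le> 2 * x\<^sup>2" using x1 by (simp add: abs_le_square_iff[of 1 x, simplified])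
  then have "(1 + x\<^sup>2) ^ M \<le> (2 * x\<^sup>2) ^ M" by (intro power_mono) auto
  also have "\<dots> = 2 ^ M * x ^ (2 * M)" by (simp add: power_mult_distrib power_mult)
  also have "\<dots> \<le> 2 ^ N * x ^ (2 * M)" using N x2M by (intro mult_right_mono power_increasing) auto
  finally have "\<delta> / 2 ^ Suc N * (1 + x\<^sup>2) ^ M \<le> \<delta> / 2 ^ Suc N * (2 ^ N * x ^ (2 * M))"
    using assms by (intro mult_left_mono) auto
  also have "\<dots> = \<delta> / 2 * x ^ (2 * M)" by (simp add: field_simps)
  finally have weight: "\<delta> / 2 ^ Suc N * (1 + x\<^sup>2) ^ M \<le> \<delta> / 2 * x ^ (2 * M)" .
  have "\<bar>\<Sum>j<2 * M. a j * x ^ j\<bar> \<le> \<delta> / 2 * x ^ (2 * M)"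
  proof (cases "M = 0")
    case False
    have "\<bar>\<Sum>j<2 * M. a j * x ^ j\<bar> \<le> (\<Sum>j<2 * M. \<bar>a j * x ^ j\<bar>)" by (rule sum_abs)
    also have "\<dots> \<le> (\<Sum>j<2 * M. B * \<bar>x\<bar> ^ (2 * M - 1))"
      unfolding abs_mult power_abs
      using a x1 assms by (intro sum_mono mult_mono power_increasing) auto
    also have "\<dots> = real (2 * M) * B * \<bar>x\<bar> ^ (2 * M - 1)" by simp
    also have "\<dots> \<le> real N * B * \<bar>x\<bar> ^ (2 * M - 1)"
      using N assms by (intro mult_right_mono) auto
    also have "\<dots> \<le> \<delta> / 2 * \<bar>x\<bar> * \<bar>x\<bar> ^ (2 * M - 1)"
      using x2 by (intro mult_right_mono) auto
    also have "\<dots> = \<delta> / 2 * \<bar>x\<bar> ^ Suc (2 * M - 1)" by simp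
    also have "\<dots> = \<delta> / 2 * x ^ (2 * M)" using False by (simp add: power_even_abs)
    finally show ?thesis .
  qed (use assms in simp)
  moreover have "\<delta> * x ^ (2 * M) \<le> a (2 * M) * x ^ (2 * M)"
    using a x2M by (intro mult_right_mono)
  moreover have "(\<Sum>j\<le>2 * M. a j * x ^ j) = (\<Sum>j<2 * M. a j * x ^ j) + a (2 * M) * x ^ (2 * M)"
    by (simp add: lessThan_Suc_atMost[symmetric])
  ultimately show ?thesis using weight by linarith
qed

lemma polynomial_sum_bounded:
  fixes a :: "nat \<Rightarrow> real"
  assumes "\<And>j. j \<le> 2 * M \<Longrightarrow> \<bar>a j\<bar> \<le> B" "B \<ge> 0" "2 * M \<le> N" "\<bar>x\<bar> \<le> R" "R \<ge> 1"
  shows "\<bar>\<Sum>j\<le>2 * M. a j * x ^ j\<bar> \<le> real (Suc N) * (B * R ^ N)"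
proof -
  have "\<bar>\<Sum>j\<le>2 * M. a j * x ^ j\<bar> \<le> (\<Sum>j\<le>2 * M. \<bar>a j * x ^ j\<bar>)" by (rule sum_abs)
  also have "\<dots> \<le> (\<Sum>j\<le>2 * M. B * R ^ N)"
  proof (rule sum_mono)
    fix j assume j: "j \<in> {..2 * M}"
    have "\<bar>x\<bar> ^ j \<le> R ^ j" using assms by (intro power_mono) auto
    also have "\<dots> \<le> R ^ N" using j assms by (intro power_increasing) auto
    finally show "\<bar>a j * x ^ j\<bar> \<le> B * R ^ N"
      unfolding abs_mult power_abs using j assms by (intro mult_mono) auto
  qed
  also have "\<dots> \<le> real (Suc N) * (B * R ^ N)"
    using assms by (auto intro!: mult_right_mono)
  finally show ?thesis .
qed

text \<open>Otherwise the square of the right side minus the square of the left side would be a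
  polynomial with negative leading coefficient.\<close>
lemma degree_le_if_abs_poly_le:
  fixes p q :: "real poly"
  assumes "\<And>x. \<bar>poly p x\<bar> \<le> c * (poly q x + d)"
  shows "degree p \<le> degree q"
proof (rule ccontr)
  assume less: "\<not> degree p \<le> degree q"
  define r where "r = smult c (q + [:d:])"
  define s where "s = p * p - r * r"
  have "degree r \<le> degree q"
    unfolding r_def by (intro order_trans[OF degree_smult_le] degree_add_le) auto
  then have r: "degree (r * r) < degree p + degree p"
    using degree_mult_le[of r r] less by linarith
  have "p \<noteq> 0" using less by auto
  then have pp: "degree (p * p) = degree p + degree p" by (simp add: degree_mult_eq)
  have "degree s \<le> degree p + degree p"
    unfolding s_def by (rule degree_diff_le) (use pp r in auto)
  moreover have coeff: "coeff s (degree p + degree p) = lead_coeff p * lead_coeff p"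
    unfolding s_def using r by (simp add: coeff_eq_0 coeff_mult_degree_sum)
  moreover have "lead_coeff p * lead_coeff p > 0" using \<open>p \<noteq> 0\<close>
    by (simp add: not_square_less_zero order_less_le)
  ultimately have "lead_coeff s > 0"
    by (metis le_degree order_antisym order_less_irrefl)
  then obtain x where x: "poly s x \<ge> lead_coeff s" "lead_coeff s > 0"
    using poly_pinfty_gt_lc by blast
  have "\<bar>poly p x\<bar> \<le> poly r x" using assms by (simp add: r_def)
  then have "(poly p x)\<^sup>2 \<le> (poly r x)\<^sup>2" by (simp add: abs_le_square_iff[symmetric])
  then have "poly s x \<le> 0" by (simp add: s_def power2_eq_square)
  then show False using x by linarith
qed


section \<open>Powers of the differential operator as sums of words\<close>

lemma ddx_funpow_schwartz: "f \<in> schwartz \<Longrightarrow> (ddx ^^ k) f \<in> schwartz"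
  by (induction k) (auto simp: schwartz_ddx)

lemma poly_times_schwartz:
  assumes "f \<in> schwartz"
  shows "(\<lambda>y. complex_of_real (poly p (s * y)) * f y) \<in> schwartz"
  using schwartz_times_poly[OF assms, of "pcompose p [:0, s:]"]
  by (simp add: poly_pcompose mult.commute)

text \<open>The pair \<open>(l, j)\<close> stands for the monomial \<open>D\<^sup>l X\<^sup>j D\<^sup>l\<close> of the operator, and a list of such pairs
  for a product of monomials, a summand of a power of the operator.\<close>
definition term_indices :: "nat \<Rightarrow> (nat \<Rightarrow> nat) \<Rightarrow> (nat \<times> nat) set" where
  "term_indices m M = Sigma {..m} (\<lambda>l. {..2 * M l})"

lemma finite_term_indices: "finite (term_indices m M)"
  by (simp add: term_indices_def)

definition term_word :: "nat \<times> nat \<Rightarrow> letter list" where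
  "term_word p = replicate (fst p) Mom @ replicate (snd p) Pos @ replicate (fst p) Mom"

definition term_lists :: "nat \<Rightarrow> (nat \<Rightarrow> nat) \<Rightarrow> nat \<Rightarrow> (nat \<times> nat) list set" where
  "term_lists m M n = {ps. set ps \<subseteq> term_indices m M \<and> length ps = n}"

lemma finite_term_lists: "finite (term_lists m M n)"
  by (simp add: term_lists_def finite_lists_length_eq finite_term_indices)

definition list_coeff :: "(nat \<Rightarrow> nat \<Rightarrow> real \<Rightarrow> real) \<Rightarrow> real \<Rightarrow> (nat \<times> nat) list \<Rightarrow> real" where
  "list_coeff \<alpha> h ps = prod_list (map (\<lambda>p. \<alpha> (fst p) (snd p) h) ps)"

definition list_word :: "(nat \<times> nat) list \<Rightarrow> letter list" where
  "list_word ps = concat (map term_word ps)"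

lemma term_lists_0: "term_lists m M 0 = {[]}"
  by (auto simp: term_lists_def)

lemma sum_term_lists_Suc:
  fixes f :: "(nat \<times> nat) list \<Rightarrow> 'a::comm_monoid_add"
  shows "(\<Sum>ps\<in>term_lists m M (Suc n). f ps)
    = (\<Sum>p\<in>term_indices m M. \<Sum>ps\<in>term_lists m M n. f (p # ps))"
proof -
  have "term_lists m M (Suc n) = (\<lambda>(p, ps). p # ps) ` (term_indices m M \<times> term_lists m M n)"
    by (auto simp: term_lists_def length_Suc_conv image_iff)
  moreover have "inj_on (\<lambda>(p, ps). p # ps) (term_indices m M \<times> term_lists m M n)"
    by (auto simp: inj_on_def)
  ultimately have "(\<Sum>ps\<in>term_lists m M (Suc n). f ps)
      = (\<Sum>(p, ps)\<in>term_indices m M \<times> term_lists m M n. f (p # ps))"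
    by (simp add: sum.reindex case_prod_unfold comp_def)
  then show ?thesis
    by (simp add: sum.Sigma finite_term_indices finite_term_lists)
qed

lemma act_scale:
  assumes "f \<in> schwartz"
  shows "act h w (\<lambda>x. c * f x) = (\<lambda>x. c * act h w f x)"
  using act_sum[of "{()}" "\<lambda>_. f" h w "\<lambda>_. c"] assms by simp

text \<open>The factor \<open>(- h) ^ l\<close> is the product of the two factors \<open>(- \<i> * sqrt h) ^ l\<close> that turn the two
  derivatives of order \<open>l\<close> into momenta.\<close>
lemma diff_op_summand:
  assumes \<psi>: "\<psi> \<in> schwartz" and h: "h \<ge> 0"
    and q: "q = (\<Sum>j\<le>2 * M. monom (a j) j)"
  shows "(\<lambda>x. complex_of_real ((- h) ^ l) *
           (ddx ^^ l) (\<lambda>y. complex_of_real (poly q (sqrt h * y)) * (ddx ^^ l) \<psi> y) x)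
       = (\<lambda>x. \<Sum>j\<le>2 * M. complex_of_real (a j) * act h (term_word (l, j)) \<psi> x)"
proof -
  define s where "s = - \<i> * complex_of_real (sqrt h)"
  have "complex_of_real (sqrt h) * complex_of_real (sqrt h) = complex_of_real h"
    using h by (metis of_real_mult real_sqrt_mult_self abs_of_nonneg)
  then have "s * s = complex_of_real (- h)"
    by (simp add: s_def algebra_simps)
  then have ss: "s ^ l * s ^ l = complex_of_real ((- h) ^ l)"
    by (metis power_mult_distrib of_real_power)
  define \<phi> where "\<phi> = (momentum h ^^ l) \<psi>"
  have \<phi>: "\<phi> \<in> schwartz" unfolding \<phi>_def by (rule momentum_funpow_schwartz[OF \<psi>])
  define g where "g = (\<lambda>y. complex_of_real (poly q (sqrt h * y)) * (ddx ^^ l) \<psi> y)"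
  have g: "g \<in> schwartz"
    unfolding g_def by (intro poly_times_schwartz ddx_funpow_schwartz \<psi>)
  have eval: "poly q z = (\<Sum>j\<le>2 * M. a j * z ^ j)" for z
    by (simp add: q poly_sum poly_monom)
  have "(\<lambda>x. \<Sum>j\<le>2 * M. complex_of_real (a j) * (position h ^^ j) \<phi> x)
      = (\<lambda>x. complex_of_real (poly q (sqrt h * x)) * \<phi> x)"
    by (simp add: position_funpow eval sum_distrib_right mult.assoc)
  also have "\<dots> = (\<lambda>x. s ^ l * g x)"
    by (simp add: \<phi>_def momentum_funpow[OF \<psi>] s_def g_def mult_ac)
  finally have "act h (replicate l Mom) (\<lambda>x. \<Sum>j\<le>2 * M. complex_of_real (a j) * (position h ^^ j) \<phi> x)
      = (\<lambda>x. s ^ l * act h (replicate l Mom) g x)"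
    by (simp only: act_scale[OF g])
  also have "\<dots> = (\<lambda>x. complex_of_real ((- h) ^ l) * (ddx ^^ l) g x)"
    by (simp only: act_replicate letter_op.simps momentum_funpow[OF g] s_def[symmetric] ss[symmetric]
        mult.assoc)
  finally have "act h (replicate l Mom) (\<lambda>x. \<Sum>j\<le>2 * M. complex_of_real (a j) * (position h ^^ j) \<phi> x)
      = (\<lambda>x. complex_of_real ((- h) ^ l) * (ddx ^^ l) g x)" .
  moreover have "act h (replicate l Mom) (\<lambda>x. \<Sum>j\<le>2 * M. complex_of_real (a j) * (position h ^^ j) \<phi> x)
      = (\<lambda>x. \<Sum>j\<le>2 * M. complex_of_real (a j) * act h (replicate l Mom) ((position h ^^ j) \<phi>) x)"
  proof (rule act_sum)
    show "(position h ^^ j) \<phi> \<in> schwartz" for j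
      using act_schwartz[OF \<phi>, of h "replicate j Pos"] by (simp add: act_replicate)
  qed
  ultimately show ?thesis
    by (simp add: term_word_def act_append act_replicate \<phi>_def g_def)
qed

lemma diff_op_app:
  assumes \<psi>: "\<psi> \<in> schwartz" and h: "h \<ge> 0"
    and b: "\<And>l. l \<le> m \<Longrightarrow> b l h = (\<Sum>j\<le>2 * M l. monom (\<alpha> l j h) j)"
  shows "op_app (diff_op m b h) \<psi>
    = (\<lambda>x. \<Sum>p\<in>term_indices m M. complex_of_real (\<alpha> (fst p) (snd p) h) * act h (term_word p) \<psi> x)"
proof
  fix x
  have "op_app (diff_op m b h) \<psi> x = (\<Sum>l\<le>m. complex_of_real ((- h) ^ l) *
       (ddx ^^ l) (\<lambda>y. complex_of_real (poly (b l h) (sqrt h * y)) * (ddx ^^ l) \<psi> y) x)"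
    by (simp add: diff_op_def)
  also have "\<dots> = (\<Sum>l\<le>m. \<Sum>j\<le>2 * M l. complex_of_real (\<alpha> l j h) * act h (term_word (l, j)) \<psi> x)"
    by (rule sum.cong[OF refl]) (use diff_op_summand[OF \<psi> h b] in \<open>simp add: fun_eq_iff\<close>)
  also have "\<dots> = (\<Sum>p\<in>term_indices m M. complex_of_real (\<alpha> (fst p) (snd p) h) * act h (term_word p) \<psi> x)"
    unfolding term_indices_def by (simp add: sum.Sigma case_prod_unfold)
  finally show "op_app (diff_op m b h) \<psi> x
    = (\<Sum>p\<in>term_indices m M. complex_of_real (\<alpha> (fst p) (snd p) h) * act h (term_word p) \<psi> x)" .
qed

lemma op_pow_diff_op_app:
  assumes \<psi>: "\<psi> \<in> schwartz" and h: "h \<ge> 0"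
    and b: "\<And>l. l \<le> m \<Longrightarrow> b l h = (\<Sum>j\<le>2 * M l. monom (\<alpha> l j h) j)"
  shows "op_app (op_pow (diff_op m b h) n) \<psi>
    = (\<lambda>x. \<Sum>ps\<in>term_lists m M n. complex_of_real (list_coeff \<alpha> h ps) * act h (list_word ps) \<psi> x)"
proof (induction n)
  case 0
  then show ?case by (simp add: term_lists_0 op_id_def list_coeff_def list_word_def)
next
  case (Suc n)
  let ?\<phi> = "\<lambda>x. \<Sum>ps\<in>term_lists m M n. complex_of_real (list_coeff \<alpha> h ps) * act h (list_word ps) \<psi> x"
  have \<phi>: "?\<phi> \<in> schwartz" by (intro schwartz_sum act_schwartz \<psi>)
  have act: "act h w ?\<phi> = (\<lambda>x. \<Sum>ps\<in>term_lists m M n. complex_of_real (list_coeff \<alpha> h ps)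
      * act h (w @ list_word ps) \<psi> x)" for w
    unfolding act_append by (rule act_sum) (rule act_schwartz[OF \<psi>])
  have "op_app (op_pow (diff_op m b h) (Suc n)) \<psi> = op_app (diff_op m b h) ?\<phi>"
    by (simp add: op_comp_def Suc)
  also have "\<dots> = (\<lambda>x. \<Sum>p\<in>term_indices m M. complex_of_real (\<alpha> (fst p) (snd p) h)
      * act h (term_word p) ?\<phi> x)"
    by (rule diff_op_app[where b = b and M = M and \<alpha> = \<alpha>, OF \<phi> h b])
  also have "\<dots> = (\<lambda>x. \<Sum>ps\<in>term_lists m M (Suc n). complex_of_real (list_coeff \<alpha> h ps)
      * act h (list_word ps) \<psi> x)"
    unfolding act sum_term_lists_Suc
    by (simp add: sum_distrib_left list_coeff_def list_word_def mult.assoc)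
  finally show ?case .
qed

lemma L2_inner_op_pow_diff_op:
  assumes \<psi>: "\<psi> \<in> schwartz" and h: "h \<ge> 0"
    and b: "\<And>l. l \<le> m \<Longrightarrow> b l h = (\<Sum>j\<le>2 * M l. monom (\<alpha> l j h) j)"
  shows "L2_inner (op_app (op_pow (diff_op m b h) n) \<psi>) \<psi>
    = (\<Sum>ps\<in>term_lists m M n. complex_of_real (list_coeff \<alpha> h ps) * word_form h (list_word ps) \<psi>)"
proof -
  have "op_app (op_pow (diff_op m b h) n) \<psi>
    = (\<lambda>x. \<Sum>ps\<in>term_lists m M n. complex_of_real (list_coeff \<alpha> h ps) * act h (list_word ps) \<psi> x)"
    by (rule op_pow_diff_op_app[OF \<psi> h]) (rule b)
  then show ?thesis
    unfolding word_form_def by (simp only:) (rule L2_inner_sum_left, auto simp: \<psi> act_schwartz)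
qed

lemma count_list_word:
  "count_list (list_word ps) Pos = sum_list (map snd ps)"
  "count_list (list_word ps) Mom = 2 * sum_list (map fst ps)"
  by (induction ps) (auto simp: list_word_def term_word_def count_list_replicate_letter)

lemma term_lists_order_le:
  assumes "ps \<in> term_lists m M n"
  shows "sum_list (map fst ps) \<le> n * m"
  using assms
proof (induction n arbitrary: ps)
  case (Suc n)
  then obtain p ps' where "ps = p # ps'" "p \<in> term_indices m M" "ps' \<in> term_lists m M n"
    by (auto simp: term_lists_def length_Suc_conv)
  then show ?case using Suc.IH[of ps'] by (auto simp: term_indices_def)
qed (simp add: term_lists_0)

lemma term_lists_degree_le:
  assumes "m' \<le> m" "\<And>l. l \<le> m' \<Longrightarrow> M' l \<le> M l"
  shows "ps \<in> term_lists m' M' n \<Longrightarrow>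
    sum_list (map snd ps) \<le> 2 * top_weight m M n (sum_list (map fst ps))"
proof (induction n arbitrary: ps)
  case (Suc n)
  then obtain l j ps' where ps: "ps = (l, j) # ps'" "l \<le> m'" "j \<le> 2 * M' l"
      "ps' \<in> term_lists m' M' n"
    by (auto simp: term_lists_def length_Suc_conv term_indices_def)
  have "j + sum_list (map snd ps') \<le> 2 * (M l + top_weight m M n (sum_list (map fst ps')))"
    unfolding distrib_left
    using Suc.IH[OF ps(4)] order_trans[OF ps(3) mult_le_mono2[OF assms(2)[OF ps(2)]]]
    by (rule add_mono[rotated])
  also have "M l + top_weight m M n (sum_list (map fst ps'))
      \<le> top_weight m M (Suc n) (l + sum_list (map fst ps'))"
  proof (rule top_weight_add_le)
    show "l \<le> m" using ps assms by simp
    have "sum_list (map fst ps') \<le> n * m'" by (rule term_lists_order_le[OF ps(4)])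
    then show "sum_list (map fst ps') \<le> n * m" using assms(1) by (meson mult_le_mono2 order_trans)
  qed
  finally show ?case using ps by simp
qed (simp add: term_lists_0)

lemma symbol_power_term_lists:
  "(\<Sum>ps\<in>term_lists m M n. list_coeff \<alpha> h ps * (x ^ sum_list (map snd ps) * y (sum_list (map fst ps))))
    = symbol_power (\<lambda>l. \<Sum>j\<le>2 * M l. \<alpha> l j h * x ^ j) m n y"
proof (induction n arbitrary: y)
  case 0
  then show ?case by (simp add: term_lists_0 list_coeff_def)
next
  case (Suc n)
  have "(\<Sum>ps\<in>term_lists m M (Suc n). list_coeff \<alpha> h ps * (x ^ sum_list (map snd ps) * y (sum_list (map fst ps))))
    = (\<Sum>p\<in>term_indices m M. \<alpha> (fst p) (snd p) h * x ^ snd p *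
        (\<Sum>ps\<in>term_lists m M n. list_coeff \<alpha> h ps * (x ^ sum_list (map snd ps) * y (fst p + sum_list (map fst ps)))))"
    unfolding sum_term_lists_Suc
    by (simp add: sum_distrib_left list_coeff_def power_add mult_ac)
  also have "\<dots> = (\<Sum>p\<in>term_indices m M. \<alpha> (fst p) (snd p) h * x ^ snd p *
      symbol_power (\<lambda>l. \<Sum>j\<le>2 * M l. \<alpha> l j h * x ^ j) m n (\<lambda>i. y (fst p + i)))"
    by (simp add: Suc.IH[of "\<lambda>i. y (_ + i)"])
  also have "\<dots> = (\<Sum>l\<le>m. \<Sum>j\<le>2 * M l. \<alpha> l j h * x ^ j *
      symbol_power (\<lambda>l. \<Sum>j\<le>2 * M l. \<alpha> l j h * x ^ j) m n (\<lambda>i. y (l + i)))"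
    unfolding term_indices_def by (simp add: sum.Sigma case_prod_unfold)
  finally show ?case by (simp add: sum_distrib_right)
qed

lemma list_coeff_abs_le:
  assumes "\<And>l j. l \<le> m \<Longrightarrow> j \<le> 2 * M l \<Longrightarrow> \<bar>\<alpha> l j h\<bar> \<le> B" "B \<ge> 0"
  shows "ps \<in> term_lists m M n \<Longrightarrow> \<bar>list_coeff \<alpha> h ps\<bar> \<le> B ^ n"
proof (induction n arbitrary: ps)
  case (Suc n)
  then obtain l j ps' where ps: "ps = (l, j) # ps'" "l \<le> m" "j \<le> 2 * M l"
      "ps' \<in> term_lists m M n"
    by (auto simp: term_lists_def length_Suc_conv term_indices_def)
  have "\<bar>\<alpha> l j h\<bar> * \<bar>list_coeff \<alpha> h ps'\<bar> \<le> B * B ^ n"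
    using Suc.IH[OF ps(4)] assms ps by (intro mult_mono) auto
  then show ?case using ps by (simp add: list_coeff_def abs_mult)
qed (simp add: term_lists_0 list_coeff_def)


section \<open>Comparison with the energy\<close>

text \<open>Every word differs from its symmetric ordering by at most a multiple of the energy, and the form of the latter is at most
  one summand of the energy.\<close>
lemma energy_upper:
  assumes anti: "\<And>k l. k \<le> l \<Longrightarrow> l \<le> m \<Longrightarrow> M l \<le> M k"
    and le: "m' \<le> m" "\<And>l. l \<le> m' \<Longrightarrow> M' l \<le> M l"
    and "\<eta> \<ge> 0" "B \<ge> 0"
    and B: "\<And>l j h. l \<le> m' \<Longrightarrow> j \<le> 2 * M' l \<Longrightarrow> 0 < h \<Longrightarrow> h < \<eta> \<Longrightarrow> \<bar>\<alpha> l j h\<bar> \<le> B"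
  shows "\<exists>C\<ge>0. \<forall>h \<psi>. 0 < h \<longrightarrow> h < \<eta> \<longrightarrow> \<psi> \<in> schwartz \<longrightarrow>
    norm (\<Sum>ps\<in>term_lists m' M' n. complex_of_real (list_coeff \<alpha> h ps) * word_form h (list_word ps) \<psi>)
      \<le> C * energy h (top_weight m M n) (n * m) \<psi>"
proof -
  let ?I = "term_lists m' M' n" and ?M = "top_weight m M n"
  have "\<exists>C\<ge>0. \<forall>h \<psi>. 0 < h \<longrightarrow> h < \<eta> \<longrightarrow> \<psi> \<in> schwartz \<longrightarrow>
      norm (word_form h (list_word ps) \<psi>) \<le> C * energy h ?M (n * m) \<psi>" if ps: "ps \<in> ?I" for ps
  proof -
    let ?l = "sum_list (map fst ps)" and ?J = "sum_list (map snd ps)"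
    have "n * m' \<le> n * m" using le by simp
    then have l: "?l \<le> n * m" using term_lists_order_le[OF ps] by linarith
    have J: "?J \<le> 2 * ?M ?l" using term_lists_degree_le[OF le ps] by simp
    have "\<exists>C\<ge>0. \<forall>h \<psi> w. 0 < h \<longrightarrow> h < \<eta> \<longrightarrow> \<psi> \<in> schwartz \<longrightarrow>
      count_list w Pos = ?J \<longrightarrow> count_list w Mom = 2 * ?l \<longrightarrow>
      norm (word_form h w \<psi> - L2_inner ((position h ^^ ?J) ((momentum h ^^ ?l) \<psi>)) ((momentum h ^^ ?l) \<psi>))
        \<le> 1 * energy h ?M (n * m) \<psi> + C * wnorm h 0 \<psi>"
    proof (rule word_form_boundary)
      show "?M l' \<le> ?M k" if "k \<le> l'" "l' \<le> n * m" for k l'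
        by (rule top_weight_antimono) (use that anti in auto)
    qed (use l J assms in auto)
    then obtain C where C: "C \<ge> 0" and C2: "\<forall>h \<psi> w. 0 < h \<longrightarrow> h < \<eta> \<longrightarrow> \<psi> \<in> schwartz \<longrightarrow>
      count_list w Pos = ?J \<longrightarrow> count_list w Mom = 2 * ?l \<longrightarrow>
      norm (word_form h w \<psi> - L2_inner ((position h ^^ ?J) ((momentum h ^^ ?l) \<psi>)) ((momentum h ^^ ?l) \<psi>))
        \<le> 1 * energy h ?M (n * m) \<psi> + C * wnorm h 0 \<psi>"
      by (elim exE conjE) (rule that)
    show ?thesis
    proof (rule exI[of _ "2 + C"], intro conjI allI impI)
      show "0 \<le> 2 + C" using C by simp
      fix h \<psi> assume h: "0 < (h::real)" "h < \<eta>" and \<psi>: "\<psi> \<in> schwartz"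
      let ?E = "energy h ?M (n * m) \<psi>" and ?f = "(momentum h ^^ ?l) \<psi>"
      have "norm (word_form h (list_word ps) \<psi> - L2_inner ((position h ^^ ?J) ?f) ?f)
          \<le> ?E + C * wnorm h 0 \<psi>"
        using C2[rule_format, of h \<psi> "list_word ps"] h \<psi> count_list_word by simp
      moreover have "C * wnorm h 0 \<psi> \<le> C * ?E"
        using C h \<psi> by (intro mult_left_mono wnorm_0_le_energy) auto
      moreover have "norm (L2_inner ((position h ^^ ?J) ?f) ?f) \<le> wnorm h (?M ?l) ?f"
        using h \<psi> J by (intro L2_inner_position_diagonal momentum_funpow_schwartz) auto
      moreover have "wnorm h (?M ?l) ?f \<le> ?E"
        using h l by (intro wnorm_le_energy) auto
      moreover have "norm (word_form h (list_word ps) \<psi>)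
          \<le> norm (word_form h (list_word ps) \<psi> - L2_inner ((position h ^^ ?J) ?f) ?f)
            + norm (L2_inner ((position h ^^ ?J) ?f) ?f)"
        by (subst add.commute) (rule norm_triangle_sub)
      ultimately show "norm (word_form h (list_word ps) \<psi>) \<le> (2 + C) * ?E"
        unfolding distrib_right by linarith
    qed
  qed
  then have "\<forall>ps\<in>?I. \<exists>C. C \<ge> 0 \<and> (\<forall>h \<psi>. 0 < h \<longrightarrow> h < \<eta> \<longrightarrow> \<psi> \<in> schwartz \<longrightarrow>
      norm (word_form h (list_word ps) \<psi>) \<le> C * energy h ?M (n * m) \<psi>)"
    by (rule ballI)
  from bchoice[OF this] obtain C where C: "\<forall>ps\<in>?I. C ps \<ge> 0 \<and> (\<forall>h \<psi>. 0 < h \<longrightarrow> h < \<eta> \<longrightarrow> \<psi> \<in> schwartz \<longrightarrow>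
      norm (word_form h (list_word ps) \<psi>) \<le> C ps * energy h ?M (n * m) \<psi>)"
    by (elim exE) (rule that)
  show ?thesis
  proof (rule exI[of _ "\<Sum>ps\<in>?I. B ^ n * C ps"], intro conjI allI impI)
    show "0 \<le> (\<Sum>ps\<in>?I. B ^ n * C ps)" using C assms(5) by (intro sum_nonneg) auto
    fix h \<psi> assume h: "0 < (h::real)" "h < \<eta>" and \<psi>: "\<psi> \<in> schwartz"
    let ?E = "energy h ?M (n * m) \<psi>"
    have "norm (\<Sum>ps\<in>?I. complex_of_real (list_coeff \<alpha> h ps) * word_form h (list_word ps) \<psi>)
        \<le> (\<Sum>ps\<in>?I. B ^ n * (C ps * ?E))"
    proof (rule sum_norm_le)
      fix ps assume ps: "ps \<in> ?I"
      have "\<bar>list_coeff \<alpha> h ps\<bar> \<le> B ^ n"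
        by (rule list_coeff_abs_le[OF _ _ ps]) (use B h assms(5) in auto)
      moreover have "norm (word_form h (list_word ps) \<psi>) \<le> C ps * ?E"
        using C ps h \<psi> by blast
      ultimately show "norm (complex_of_real (list_coeff \<alpha> h ps) * word_form h (list_word ps) \<psi>)
          \<le> B ^ n * (C ps * ?E)"
        using assms(5) by (simp add: norm_mult mult_mono)
    qed
    then show "norm (\<Sum>ps\<in>?I. complex_of_real (list_coeff \<alpha> h ps) * word_form h (list_word ps) \<psi>)
        \<le> (\<Sum>ps\<in>?I. B ^ n * C ps) * ?E"
      by (simp add: sum_distrib_right mult.assoc)
  qed
qed

lemma integrable_position_moment:
  assumes "f \<in> schwartz"
  shows "integrable lborel (\<lambda>x. (sqrt h * x) ^ J * (norm (f x))\<^sup>2)"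
  using integrable_schwartz_norm_mult[OF assms assms, of "[:0, sqrt h:] ^ J"]
  by (simp add: power2_eq_square mult_ac)

lemma L2_inner_position_eq:
  "Re (L2_inner ((position h ^^ J) f) f) = (LINT x|lborel. (sqrt h * x) ^ J * (norm (f x))\<^sup>2)"
proof -
  have "(position h ^^ J) f x * cnj (f x) = complex_of_real ((sqrt h * x) ^ J * (norm (f x))\<^sup>2)" for x
    by (simp only: position_funpow of_real_mult[of _ "(norm (f x))\<^sup>2"] complex_norm_square mult.assoc)
  then have "L2_inner ((position h ^^ J) f) f
      = (LINT x|lborel. complex_of_real ((sqrt h * x) ^ J * (norm (f x))\<^sup>2))"
    unfolding L2_inner_def by (simp only:)
  also have "\<dots> = complex_of_real (LINT x|lborel. (sqrt h * x) ^ J * (norm (f x))\<^sup>2)"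
    by (rule integral_complex_of_real)
  finally show ?thesis by simp
qed

text \<open>The form of \<open>D\<^sup>l X\<^sup>J D\<^sup>l\<close> is the integral of \<open>X\<^sup>J * \<bar>D\<^sup>l \<psi>\<bar>\<^sup>2\<close>, so the symmetrically ordered terms
  add up to the symbol of the power.\<close>
lemma diagonal_terms_eq_symbol:
  fixes h :: real and \<alpha> :: "nat \<Rightarrow> nat \<Rightarrow> real \<Rightarrow> real" and M :: "nat \<Rightarrow> nat" and m n :: nat
  assumes \<psi>: "\<psi> \<in> schwartz"
  defines "S \<equiv> \<lambda>x. symbol_power (\<lambda>l. \<Sum>j\<le>2 * M l. \<alpha> l j h * (sqrt h * x) ^ j) m n
      (\<lambda>i. (norm ((momentum h ^^ i) \<psi> x))\<^sup>2)"
  shows "integrable lborel S"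
    and "(\<Sum>ps\<in>term_lists m M n. list_coeff \<alpha> h ps *
       Re (L2_inner ((position h ^^ sum_list (map snd ps)) ((momentum h ^^ sum_list (map fst ps)) \<psi>))
          ((momentum h ^^ sum_list (map fst ps)) \<psi>))) = (LINT x|lborel. S x)"
proof -
  let ?g = "\<lambda>ps x. list_coeff \<alpha> h ps *
    ((sqrt h * x) ^ sum_list (map snd ps) * (norm ((momentum h ^^ sum_list (map fst ps)) \<psi> x))\<^sup>2)"
  have S: "S = (\<lambda>x. \<Sum>ps\<in>term_lists m M n. ?g ps x)"
    unfolding S_def by (rule ext) (rule symbol_power_term_lists[symmetric])
  have int: "integrable lborel (?g ps)" for ps
    by (intro integrable_mult_right integrable_position_moment momentum_funpow_schwartz \<psi>)
  show "integrable lborel S"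
    unfolding S by (intro Bochner_Integration.integrable_sum int)
  show "(\<Sum>ps\<in>term_lists m M n. list_coeff \<alpha> h ps *
       Re (L2_inner ((position h ^^ sum_list (map snd ps)) ((momentum h ^^ sum_list (map fst ps)) \<psi>))
          ((momentum h ^^ sum_list (map fst ps)) \<psi>))) = (LINT x|lborel. S x)"
    unfolding S L2_inner_position_eq
    by (subst Bochner_Integration.integral_sum) (use int in auto)
qed

lemma diagonal_terms_lower:
  assumes "\<delta> > 0" "B \<ge> 0"
    and B: "\<And>l j h. l \<le> m \<Longrightarrow> j \<le> 2 * M l \<Longrightarrow> 0 < h \<Longrightarrow> h < \<eta> \<Longrightarrow> \<bar>\<alpha> l j h\<bar> \<le> B"
    and lead: "\<And>l h. l \<le> m \<Longrightarrow> 0 < h \<Longrightarrow> h < \<eta> \<Longrightarrow> \<delta> \<le> \<alpha> l (2 * M l) h"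
    and top: "\<And>x h. 0 < h \<Longrightarrow> h < \<eta> \<Longrightarrow> \<delta> \<le> (\<Sum>j\<le>2 * M m. \<alpha> m j h * x ^ j)"
  shows "\<exists>c>0. \<exists>C\<ge>0. \<forall>h \<psi>. 0 < h \<longrightarrow> h < \<eta> \<longrightarrow> \<psi> \<in> schwartz \<longrightarrow>
    c * energy h (top_weight m M n) (n * m) \<psi> - C * (\<Sum>l<n * m. wnorm h 0 ((momentum h ^^ l) \<psi>))
    \<le> (\<Sum>ps\<in>term_lists m M n. list_coeff \<alpha> h ps *
       Re (L2_inner ((position h ^^ sum_list (map snd ps)) ((momentum h ^^ sum_list (map fst ps)) \<psi>))
          ((momentum h ^^ sum_list (map fst ps)) \<psi>)))"
proof -
  define N where "N = (\<Sum>l\<le>m. 2 * M l)"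
  have N: "2 * M l \<le> N" if "l \<le> m" for l
    unfolding N_def using that by (intro member_le_sum) auto
  define R where "R = 1 + 2 * real N * B / \<delta>"
  have R: "R \<ge> 1" using assms(1,2) by (simp add: R_def)
  define B' where "B' = real (Suc N) * (B * R ^ N)"
  have B': "B' \<ge> 0" using assms(2) R by (simp add: B'_def)
  have pos: "\<delta> / 2 ^ Suc N > 0" and T0: "1 + R\<^sup>2 \<ge> 1" using assms(1) by auto
  obtain c C where c: "c > 0" and C: "C \<ge> 0" and low: "\<forall>\<beta> T y. T \<ge> 1 \<longrightarrow> (\<forall>i. y i \<ge> 0) \<longrightarrow>
    (\<forall>k\<le>m. \<delta> / 2 ^ Suc N * T ^ M k \<le> \<beta> k) \<or> (T \<le> 1 + R\<^sup>2 \<and> (\<forall>k\<le>m. \<bar>\<beta> k\<bar> \<le> B') \<and> \<delta> \<le> \<beta> m) \<longrightarrow>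
    c * (\<Sum>l\<le>n * m. T ^ top_weight m M n l * y l) - C * (\<Sum>l<n * m. y l) \<le> symbol_power \<beta> m n y"
    using symbol_power_lower[OF pos assms(1) B' T0, of m M n] by (elim exE conjE) (rule that)
  show ?thesis
  proof (rule exI[of _ c], rule conjI[OF c], rule exI[of _ C], intro conjI allI impI C)
    fix h \<psi> assume h: "0 < (h::real)" "h < \<eta>" and \<psi>: "\<psi> \<in> schwartz"
    define y where "y = (\<lambda>x i. (norm ((momentum h ^^ i) \<psi> x))\<^sup>2)"
    define \<beta> where "\<beta> = (\<lambda>x l. \<Sum>j\<le>2 * M l. \<alpha> l j h * (sqrt h * x) ^ j)"
    have int: "integrable lborel (\<lambda>x. (1 + h * x\<^sup>2) ^ k * y x l)" for k l
      unfolding y_def by (intro integrable_wnorm momentum_funpow_schwartz \<psi>)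
    have int0: "integrable lborel (\<lambda>x. y x l)" for l
      using int[of 0 l] by simp
    have le: "c * (\<Sum>l\<le>n * m. (1 + h * x\<^sup>2) ^ top_weight m M n l * y x l) - C * (\<Sum>l<n * m. y x l)
        \<le> symbol_power (\<beta> x) m n (y x)" for x
    proof (rule low[rule_format])
      show "1 \<le> 1 + h * x\<^sup>2" using h by simp
      show "0 \<le> y x i" for i by (simp add: y_def)
      have sq: "(sqrt h * x)\<^sup>2 = h * x\<^sup>2" using h by (simp add: power_mult_distrib)
      show "(\<forall>k\<le>m. \<delta> / 2 ^ Suc N * (1 + h * x\<^sup>2) ^ M k \<le> \<beta> x k) \<or>
        (1 + h * x\<^sup>2 \<le> 1 + R\<^sup>2 \<and> (\<forall>k\<le>m. \<bar>\<beta> x k\<bar> \<le> B') \<and> \<delta> \<le> \<beta> x m)"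
      proof (cases "\<bar>sqrt h * x\<bar> \<ge> R")
        case True
        have "\<delta> / 2 ^ Suc N * (1 + (sqrt h * x)\<^sup>2) ^ M k \<le> \<beta> x k" if "k \<le> m" for k
          unfolding \<beta>_def
          by (rule polynomial_sum_elliptic[where B = B])
            (use B lead assms(1,2) h N that True R_def in auto)
        then show ?thesis unfolding sq by blast
      next
        case False
        have "(sqrt h * x)\<^sup>2 \<le> R\<^sup>2"
          using False R by (simp only: abs_le_square_iff[symmetric])
        moreover have "\<bar>\<beta> x k\<bar> \<le> B'" if "k \<le> m" for k
          unfolding \<beta>_def B'_def
          by (rule polynomial_sum_bounded) (use B assms(2) h N that False R in auto)
        moreover have "\<delta> \<le> \<beta> x m" unfolding \<beta>_def by (rule top[OF h])
        ultimately show ?thesis unfolding sq by simp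
      qed
    qed
    have "c * energy h (top_weight m M n) (n * m) \<psi> - C * (\<Sum>l<n * m. wnorm h 0 ((momentum h ^^ l) \<psi>))
      = (LINT x|lborel. c * (\<Sum>l\<le>n * m. (1 + h * x\<^sup>2) ^ top_weight m M n l * y x l) - C * (\<Sum>l<n * m. y x l))"
    proof -
      have "energy h (top_weight m M n) (n * m) \<psi>
          = (LINT x|lborel. (\<Sum>l\<le>n * m. (1 + h * x\<^sup>2) ^ top_weight m M n l * y x l))"
        unfolding energy_def wnorm_def
        by (subst Bochner_Integration.integral_sum) (use int in \<open>auto simp: y_def\<close>)
      moreover have "(\<Sum>l<n * m. wnorm h 0 ((momentum h ^^ l) \<psi>)) = (LINT x|lborel. (\<Sum>l<n * m. y x l))"
        unfolding wnorm_def
        by (subst Bochner_Integration.integral_sum) (use int0 in \<open>auto simp: y_def\<close>)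
      ultimately show ?thesis
        by (subst Bochner_Integration.integral_diff)
          (use int int0 in \<open>auto intro!: Bochner_Integration.integrable_sum integrable_mult_right\<close>)
    qed
    also have "\<dots> \<le> (LINT x|lborel. symbol_power (\<beta> x) m n (y x))"
    proof (rule integral_mono)
      show "integrable lborel (\<lambda>x. c * (\<Sum>l\<le>n * m. (1 + h * x\<^sup>2) ^ top_weight m M n l * y x l)
          - C * (\<Sum>l<n * m. y x l))"
        by (intro Bochner_Integration.integrable_diff integrable_mult_right
            Bochner_Integration.integrable_sum int int0)
      show "integrable lborel (\<lambda>x. symbol_power (\<beta> x) m n (y x))"
        unfolding \<beta>_def y_def by (rule diagonal_terms_eq_symbol(1)[OF \<psi>])
    qed (rule le)
    also have "\<dots> = (\<Sum>ps\<in>term_lists m M n. list_coeff \<alpha> h ps *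
       Re (L2_inner ((position h ^^ sum_list (map snd ps)) ((momentum h ^^ sum_list (map fst ps)) \<psi>))
          ((momentum h ^^ sum_list (map fst ps)) \<psi>)))"
      unfolding \<beta>_def y_def by (rule diagonal_terms_eq_symbol(2)[OF \<psi>, symmetric])
    finally show "c * energy h (top_weight m M n) (n * m) \<psi> - C * (\<Sum>l<n * m. wnorm h 0 ((momentum h ^^ l) \<psi>))
      \<le> (\<Sum>ps\<in>term_lists m M n. list_coeff \<alpha> h ps *
       Re (L2_inner ((position h ^^ sum_list (map snd ps)) ((momentum h ^^ sum_list (map fst ps)) \<psi>))
          ((momentum h ^^ sum_list (map fst ps)) \<psi>)))" .
  qed
qed

lemma lower_momenta_le_energy:
  assumes "\<epsilon> > 0"
  shows "\<exists>C\<ge>0. \<forall>h \<psi>. 0 < h \<longrightarrow> \<psi> \<in> schwartz \<longrightarrow>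
    (\<Sum>l<K. wnorm h 0 ((momentum h ^^ l) \<psi>)) \<le> \<epsilon> * energy h M K \<psi> + C * wnorm h 0 \<psi>"
proof -
  define \<epsilon>' where "\<epsilon>' = \<epsilon> / (real K + 1)"
  have \<epsilon>': "\<epsilon>' > 0" "real K * \<epsilon>' \<le> \<epsilon>" using assms by (auto simp: \<epsilon>'_def field_simps)
  have "\<forall>l\<in>{..<K}. \<exists>C. C \<ge> 0 \<and> (\<forall>h \<psi>. 0 \<le> h \<longrightarrow> \<psi> \<in> schwartz \<longrightarrow>
     wnorm h 0 ((momentum h ^^ l) \<psi>) \<le> \<epsilon>' * wnorm h 0 ((momentum h ^^ K) \<psi>) + C * wnorm h 0 \<psi>)"
    by (rule ballI, rule momentum_interpolation) (use \<epsilon>' in auto)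
  from bchoice[OF this] obtain C where C: "\<forall>l\<in>{..<K}. C l \<ge> 0 \<and> (\<forall>h \<psi>. 0 \<le> h \<longrightarrow> \<psi> \<in> schwartz \<longrightarrow>
     wnorm h 0 ((momentum h ^^ l) \<psi>) \<le> \<epsilon>' * wnorm h 0 ((momentum h ^^ K) \<psi>) + C l * wnorm h 0 \<psi>)"
    by (elim exE) (rule that)
  show ?thesis
  proof (rule exI[of _ "\<Sum>l<K. C l"], intro conjI allI impI)
    show "0 \<le> (\<Sum>l<K. C l)" using C by (intro sum_nonneg) auto
    fix h \<psi> assume h: "0 < (h::real)" and \<psi>: "\<psi> \<in> schwartz"
    let ?E = "energy h M K \<psi>"
    have E: "wnorm h 0 ((momentum h ^^ K) \<psi>) \<le> ?E" "0 \<le> ?E"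
      using h \<psi> by (auto intro: wnorm_le_energy' energy_nonneg)
    have "(\<Sum>l<K. wnorm h 0 ((momentum h ^^ l) \<psi>)) \<le> (\<Sum>l<K. \<epsilon>' * ?E + C l * wnorm h 0 \<psi>)"
    proof (rule sum_mono)
      fix l assume "l \<in> {..<K}"
      then have "wnorm h 0 ((momentum h ^^ l) \<psi>)
          \<le> \<epsilon>' * wnorm h 0 ((momentum h ^^ K) \<psi>) + C l * wnorm h 0 \<psi>"
        using C h \<psi> less_imp_le by blast
      also have "\<dots> \<le> \<epsilon>' * ?E + C l * wnorm h 0 \<psi>"
        using E \<epsilon>' by (intro add_right_mono mult_left_mono) auto
      finally show "wnorm h 0 ((momentum h ^^ l) \<psi>) \<le> \<epsilon>' * ?E + C l * wnorm h 0 \<psi>" .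
    qed
    also have "\<dots> = (real K * \<epsilon>') * ?E + (\<Sum>l<K. C l) * wnorm h 0 \<psi>"
      by (simp add: sum.distrib sum_distrib_right)
    also have "\<dots> \<le> \<epsilon> * ?E + (\<Sum>l<K. C l) * wnorm h 0 \<psi>"
      by (intro add_right_mono mult_right_mono \<epsilon>' E)
    finally show "(\<Sum>l<K. wnorm h 0 ((momentum h ^^ l) \<psi>)) \<le> \<epsilon> * ?E + (\<Sum>l<K. C l) * wnorm h 0 \<psi>" .
  qed
qed

lemma off_diagonal_terms:
  assumes anti: "\<And>k l. k \<le> l \<Longrightarrow> l \<le> m \<Longrightarrow> M l \<le> M k"
    and "\<eta> \<ge> 0" "B \<ge> 0" "\<epsilon> > 0"
    and B: "\<And>l j h. l \<le> m \<Longrightarrow> j \<le> 2 * M l \<Longrightarrow> 0 < h \<Longrightarrow> h < \<eta> \<Longrightarrow> \<bar>\<alpha> l j h\<bar> \<le> B"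
  defines "D \<equiv> \<lambda>h \<psi> ps. L2_inner
      ((position h ^^ sum_list (map snd ps)) ((momentum h ^^ sum_list (map fst ps)) \<psi>))
      ((momentum h ^^ sum_list (map fst ps)) \<psi>)"
  shows "\<exists>C\<ge>0. \<forall>h \<psi>. 0 < h \<longrightarrow> h < \<eta> \<longrightarrow> \<psi> \<in> schwartz \<longrightarrow>
    norm (\<Sum>ps\<in>term_lists m M n. complex_of_real (list_coeff \<alpha> h ps) *
        (word_form h (list_word ps) \<psi> - D h \<psi> ps))
      \<le> \<epsilon> * energy h (top_weight m M n) (n * m) \<psi> + C * wnorm h 0 \<psi>"
proof -
  let ?I = "term_lists m M n" and ?M = "top_weight m M n"
  define A where "A = B ^ n * real (card ?I)"
  have A: "A \<ge> 0" using assms(3) by (simp add: A_def)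
  define \<epsilon>' where "\<epsilon>' = \<epsilon> / (A + 1)"
  have \<epsilon>': "\<epsilon>' > 0" "A * \<epsilon>' \<le> \<epsilon>" using assms(4) A by (auto simp: \<epsilon>'_def field_simps)
  have "\<forall>ps\<in>?I. \<exists>C. C \<ge> 0 \<and> (\<forall>h \<psi> w. 0 < h \<longrightarrow> h < \<eta> \<longrightarrow> \<psi> \<in> schwartz \<longrightarrow>
      count_list w Pos = sum_list (map snd ps) \<longrightarrow> count_list w Mom = 2 * sum_list (map fst ps) \<longrightarrow>
      norm (word_form h w \<psi> - D h \<psi> ps) \<le> \<epsilon>' * energy h ?M (n * m) \<psi> + C * wnorm h 0 \<psi>)"
    unfolding D_def
  proof (rule ballI, rule word_form_boundary)
    fix ps assume ps: "ps \<in> ?I"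
    show "?M l' \<le> ?M k" if "k \<le> l'" "l' \<le> n * m" for k l'
      by (rule top_weight_antimono) (use that anti in auto)
    show "sum_list (map fst ps) \<le> n * m" by (rule term_lists_order_le[OF ps])
    show "sum_list (map snd ps) \<le> 2 * ?M (sum_list (map fst ps))"
      by (rule term_lists_degree_le[OF _ _ ps]) auto
  qed (use assms \<epsilon>' in auto)
  from bchoice[OF this] obtain C where C: "\<forall>ps\<in>?I. C ps \<ge> 0 \<and> (\<forall>h \<psi> w. 0 < h \<longrightarrow> h < \<eta> \<longrightarrow> \<psi> \<in> schwartz \<longrightarrow>
      count_list w Pos = sum_list (map snd ps) \<longrightarrow> count_list w Mom = 2 * sum_list (map fst ps) \<longrightarrow>
      norm (word_form h w \<psi> - D h \<psi> ps) \<le> \<epsilon>' * energy h ?M (n * m) \<psi> + C ps * wnorm h 0 \<psi>)"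
    by (elim exE) (rule that)
  show ?thesis
  proof (rule exI[of _ "\<Sum>ps\<in>?I. B ^ n * C ps"], intro conjI allI impI)
    show "0 \<le> (\<Sum>ps\<in>?I. B ^ n * C ps)" using C assms(3) by (intro sum_nonneg) auto
    fix h \<psi> assume h: "0 < (h::real)" "h < \<eta>" and \<psi>: "\<psi> \<in> schwartz"
    let ?E = "energy h ?M (n * m) \<psi>"
    have "norm (\<Sum>ps\<in>?I. complex_of_real (list_coeff \<alpha> h ps) * (word_form h (list_word ps) \<psi> - D h \<psi> ps))
        \<le> (\<Sum>ps\<in>?I. B ^ n * (\<epsilon>' * ?E + C ps * wnorm h 0 \<psi>))"
    proof (rule sum_norm_le)
      fix ps assume ps: "ps \<in> ?I"
      have "\<bar>list_coeff \<alpha> h ps\<bar> \<le> B ^ n"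
        by (rule list_coeff_abs_le[OF _ _ ps]) (use B h assms(3) in auto)
      moreover have "norm (word_form h (list_word ps) \<psi> - D h \<psi> ps) \<le> \<epsilon>' * ?E + C ps * wnorm h 0 \<psi>"
        using C ps h \<psi> count_list_word by blast
      ultimately show "norm (complex_of_real (list_coeff \<alpha> h ps) * (word_form h (list_word ps) \<psi> - D h \<psi> ps))
          \<le> B ^ n * (\<epsilon>' * ?E + C ps * wnorm h 0 \<psi>)"
        using assms(3) unfolding norm_mult norm_of_real by (intro mult_mono) auto
    qed
    also have "\<dots> = (A * \<epsilon>') * ?E + (\<Sum>ps\<in>?I. B ^ n * C ps) * wnorm h 0 \<psi>"
      by (simp add: distrib_left sum.distrib sum_distrib_right sum_distrib_left A_def mult_ac)
    also have "\<dots> \<le> \<epsilon> * ?E + (\<Sum>ps\<in>?I. B ^ n * C ps) * wnorm h 0 \<psi>"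
      using \<epsilon>' h by (intro add_right_mono mult_right_mono energy_nonneg) auto
    finally show "norm (\<Sum>ps\<in>?I. complex_of_real (list_coeff \<alpha> h ps) * (word_form h (list_word ps) \<psi> - D h \<psi> ps))
        \<le> \<epsilon> * ?E + (\<Sum>ps\<in>?I. B ^ n * C ps) * wnorm h 0 \<psi>" .
  qed
qed

text \<open>Of the constant \<open>c\<close> for the symmetrically ordered terms, one quarter is spent on the
  commutators and one quarter on the lower momenta.\<close>
lemma energy_lower:
  assumes anti: "\<And>k l. k \<le> l \<Longrightarrow> l \<le> m \<Longrightarrow> M l \<le> M k"
    and "\<eta> \<ge> 0" "B \<ge> 0" "\<delta> > 0"
    and B: "\<And>l j h. l \<le> m \<Longrightarrow> j \<le> 2 * M l \<Longrightarrow> 0 < h \<Longrightarrow> h < \<eta> \<Longrightarrow> \<bar>\<alpha> l j h\<bar> \<le> B"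
    and lead: "\<And>l h. l \<le> m \<Longrightarrow> 0 < h \<Longrightarrow> h < \<eta> \<Longrightarrow> \<delta> \<le> \<alpha> l (2 * M l) h"
    and top: "\<And>x h. 0 < h \<Longrightarrow> h < \<eta> \<Longrightarrow> \<delta> \<le> (\<Sum>j\<le>2 * M m. \<alpha> m j h * x ^ j)"
  shows "\<exists>c>0. \<exists>C\<ge>0. \<forall>h \<psi>. 0 < h \<longrightarrow> h < \<eta> \<longrightarrow> \<psi> \<in> schwartz \<longrightarrow>
    c * energy h (top_weight m M n) (n * m) \<psi> - C * wnorm h 0 \<psi>
    \<le> Re (\<Sum>ps\<in>term_lists m M n. complex_of_real (list_coeff \<alpha> h ps) * word_form h (list_word ps) \<psi>)"
proof -
  let ?I = "term_lists m M n" and ?M = "top_weight m M n"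
  define D where "D = (\<lambda>h \<psi> ps. L2_inner
      ((position h ^^ sum_list (map snd ps)) ((momentum h ^^ sum_list (map fst ps)) \<psi>))
      ((momentum h ^^ sum_list (map fst ps)) \<psi>))"
  obtain c C where c: "c > 0" and C: "C \<ge> 0" and diag: "\<forall>h \<psi>. 0 < h \<longrightarrow> h < \<eta> \<longrightarrow> \<psi> \<in> schwartz \<longrightarrow>
    c * energy h ?M (n * m) \<psi> - C * (\<Sum>l<n * m. wnorm h 0 ((momentum h ^^ l) \<psi>))
    \<le> (\<Sum>ps\<in>?I. list_coeff \<alpha> h ps * Re (D h \<psi> ps))"
  proof -
    have "\<exists>c>0. \<exists>C\<ge>0. \<forall>h \<psi>. 0 < h \<longrightarrow> h < \<eta> \<longrightarrow> \<psi> \<in> schwartz \<longrightarrow>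
      c * energy h ?M (n * m) \<psi> - C * (\<Sum>l<n * m. wnorm h 0 ((momentum h ^^ l) \<psi>))
      \<le> (\<Sum>ps\<in>?I. list_coeff \<alpha> h ps * Re (D h \<psi> ps))"
      unfolding D_def by (rule diagonal_terms_lower[where B = B and \<delta> = \<delta>]) (use assms in auto)
    then show ?thesis by (elim exE conjE) (rule that)
  qed
  have c4: "c / 4 > 0" "c / (4 * (C + 1)) > 0" using c C by auto
  obtain C' where C': "C' \<ge> 0" and off: "\<forall>h \<psi>. 0 < h \<longrightarrow> h < \<eta> \<longrightarrow> \<psi> \<in> schwartz \<longrightarrow>
    norm (\<Sum>ps\<in>?I. complex_of_real (list_coeff \<alpha> h ps) * (word_form h (list_word ps) \<psi> - D h \<psi> ps))
      \<le> c / 4 * energy h ?M (n * m) \<psi> + C' * wnorm h 0 \<psi>"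
  proof -
    have "\<exists>C\<ge>0. \<forall>h \<psi>. 0 < h \<longrightarrow> h < \<eta> \<longrightarrow> \<psi> \<in> schwartz \<longrightarrow>
      norm (\<Sum>ps\<in>?I. complex_of_real (list_coeff \<alpha> h ps) * (word_form h (list_word ps) \<psi> - D h \<psi> ps))
        \<le> c / 4 * energy h ?M (n * m) \<psi> + C * wnorm h 0 \<psi>"
      unfolding D_def by (rule off_diagonal_terms[where B = B]) (use assms c4 in auto)
    then show ?thesis by (elim exE conjE) (rule that)
  qed
  obtain C'' where C'': "C'' \<ge> 0" and low: "\<forall>h \<psi>. 0 < h \<longrightarrow> \<psi> \<in> schwartz \<longrightarrow>
    (\<Sum>l<n * m. wnorm h 0 ((momentum h ^^ l) \<psi>))
      \<le> c / (4 * (C + 1)) * energy h ?M (n * m) \<psi> + C'' * wnorm h 0 \<psi>"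
    using lower_momenta_le_energy[where K = "n * m" and M = ?M, OF c4(2)] by (elim exE conjE) (rule that)
  show ?thesis
  proof (rule exI[of _ "c / 2"], rule conjI, simp add: c, rule exI[of _ "C * C'' + C'"],
      intro conjI allI impI)
    show "0 \<le> C * C'' + C'" using C C' C'' by simp
    fix h \<psi> assume h: "0 < (h::real)" "h < \<eta>" and \<psi>: "\<psi> \<in> schwartz"
    let ?E = "energy h ?M (n * m) \<psi>" and ?n = "wnorm h 0 \<psi>"
    have E: "?E \<ge> 0" using h by (simp add: energy_nonneg)
    let ?L = "\<Sum>ps\<in>?I. complex_of_real (list_coeff \<alpha> h ps) * word_form h (list_word ps) \<psi>"
    let ?O = "\<Sum>ps\<in>?I. complex_of_real (list_coeff \<alpha> h ps) * (word_form h (list_word ps) \<psi> - D h \<psi> ps)"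
    have "Re ?L = Re ?O + (\<Sum>ps\<in>?I. list_coeff \<alpha> h ps * Re (D h \<psi> ps))"
      by (simp add: right_diff_distrib sum_subtractf)
    moreover have "- (c / 4 * ?E + C' * ?n) \<le> Re ?O"
    proof -
      have "norm ?O \<le> c / 4 * ?E + C' * ?n" using off h \<psi> by blast
      then show ?thesis using abs_Re_le_cmod[of ?O] by linarith
    qed
    moreover have "c * ?E - C * (\<Sum>l<n * m. wnorm h 0 ((momentum h ^^ l) \<psi>))
        \<le> (\<Sum>ps\<in>?I. list_coeff \<alpha> h ps * Re (D h \<psi> ps))"
      using diag h \<psi> by blast
    moreover have "C * (\<Sum>l<n * m. wnorm h 0 ((momentum h ^^ l) \<psi>)) \<le> c / 4 * ?E + C * C'' * ?n"
    proof -
      have "C * (\<Sum>l<n * m. wnorm h 0 ((momentum h ^^ l) \<psi>)) \<le> C * (c / (4 * (C + 1)) * ?E + C'' * ?n)"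
        using low h \<psi> C by (intro mult_left_mono) auto
      also have "\<dots> = (C * (c / (4 * (C + 1)))) * ?E + C * C'' * ?n" by (simp add: distrib_left)
      also have "\<dots> \<le> c / 4 * ?E + C * C'' * ?n"
      proof (intro add_right_mono mult_right_mono E)
        have "C / (C + 1) \<le> 1" using C by simp
        then have "c / 4 * (C / (C + 1)) \<le> c / 4 * 1" using c by (intro mult_left_mono) auto
        then show "C * (c / (4 * (C + 1))) \<le> c / 4" by (simp add: mult.commute)
      qed
      finally show ?thesis .
    qed
    ultimately show "c / 2 * ?E - (C * C'' + C') * ?n \<le> Re ?L"
      unfolding distrib_right by linarith
  qed
qed


section \<open>Linearity and symmetry\<close>

lemma ddx_funpow_lincomb:
  assumes "u \<in> schwartz" "v \<in> schwartz"
  shows "(ddx ^^ k) (\<lambda>x. a * u x + b * v x) = (\<lambda>x. a * (ddx ^^ k) u x + b * (ddx ^^ k) v x)"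
  by (induction k) (auto simp: ddx_lincomb ddx_funpow_schwartz assms)

lemma diff_op_schwartz: "f \<in> schwartz \<Longrightarrow> op_app (diff_op m b h) f \<in> schwartz"
  unfolding diff_op_def l2_op.simps
  by (intro schwartz_sum ddx_funpow_schwartz poly_times_schwartz)

lemma diff_op_lincomb:
  assumes "u \<in> schwartz" "v \<in> schwartz"
  shows "op_app (diff_op m b h) (\<lambda>x. c * u x + d * v x)
    = (\<lambda>x. c * op_app (diff_op m b h) u x + d * op_app (diff_op m b h) v x)"
proof -
  have *: "(ddx ^^ l) (\<lambda>y. complex_of_real (poly q (s * y)) * (ddx ^^ l) (\<lambda>x. c * u x + d * v x) y)
      = (\<lambda>x. c * (ddx ^^ l) (\<lambda>y. complex_of_real (poly q (s * y)) * (ddx ^^ l) u y) x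
           + d * (ddx ^^ l) (\<lambda>y. complex_of_real (poly q (s * y)) * (ddx ^^ l) v y) x)" for l q s
  proof -
    have "(\<lambda>y. complex_of_real (poly q (s * y)) * (ddx ^^ l) (\<lambda>x. c * u x + d * v x) y)
      = (\<lambda>y. c * (complex_of_real (poly q (s * y)) * (ddx ^^ l) u y)
           + d * (complex_of_real (poly q (s * y)) * (ddx ^^ l) v y))"
      unfolding ddx_funpow_lincomb[OF assms] by (simp add: algebra_simps)
    then show ?thesis
      by (simp only: ddx_funpow_lincomb[OF poly_times_schwartz poly_times_schwartz] ddx_funpow_schwartz assms)
  qed
  show ?thesis
    unfolding diff_op_def l2_op.simps *
    by (simp add: algebra_simps sum.distrib sum_distrib_left)
qed

lemma L2_inner_ddx_funpow:
  assumes "f \<in> schwartz" "g \<in> schwartz"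
  shows "L2_inner ((ddx ^^ k) f) g = (- 1) ^ k * L2_inner f ((ddx ^^ k) g)"
  using assms(2)
proof (induction k arbitrary: g)
  case (Suc k)
  have "L2_inner ((ddx ^^ Suc k) f) g = - L2_inner ((ddx ^^ k) f) (ddx g)"
    using Suc.prems assms by (simp add: L2_inner_ddx ddx_funpow_schwartz)
  also have "\<dots> = - ((- 1) ^ k * L2_inner f ((ddx ^^ k) (ddx g)))"
    using Suc by (simp add: schwartz_ddx)
  finally show ?case by (simp add: funpow_swap1)
qed simp

lemma diff_op_symmetric:
  assumes f: "f \<in> schwartz" and g: "g \<in> schwartz"
  shows "L2_inner (op_app (diff_op m b h) f) g = L2_inner f (op_app (diff_op m b h) g)"
proof -
  define A where "A = (\<lambda>l u. (ddx ^^ l) (\<lambda>y. complex_of_real (poly (b l h) (sqrt h * y)) * (ddx ^^ l) u y))"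
  have A: "A l u \<in> schwartz" if "u \<in> schwartz" for l u
    unfolding A_def using that by (intro ddx_funpow_schwartz poly_times_schwartz)
  have app: "op_app (diff_op m b h) u = (\<lambda>x. \<Sum>l\<le>m. complex_of_real ((- h) ^ l) * A l u x)" for u
    by (simp add: diff_op_def A_def)
  have form: "L2_inner (A l u) v = (- 1) ^ l *
      (LINT x|lborel. complex_of_real (poly (b l h) (sqrt h * x)) * ((ddx ^^ l) u x * cnj ((ddx ^^ l) v x)))"
    if "u \<in> schwartz" "v \<in> schwartz" for l u v
    unfolding A_def using that
    by (simp add: L2_inner_ddx_funpow poly_times_schwartz ddx_funpow_schwartz)
      (simp add: L2_inner_def mult.assoc)
  have sym: "L2_inner (A l f) g = cnj (L2_inner (A l g) f)" for l
    unfolding form[OF f g] form[OF g f]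
    by (simp add: Bochner_Integration.integral_cnj[symmetric] mult_ac)
  have "L2_inner (op_app (diff_op m b h) f) g = (\<Sum>l\<le>m. complex_of_real ((- h) ^ l) * L2_inner (A l f) g)"
    unfolding app by (rule L2_inner_sum_left) (auto intro: A f g)
  also have "\<dots> = cnj (\<Sum>l\<le>m. complex_of_real ((- h) ^ l) * L2_inner (A l g) f)"
    by (simp add: sym)
  also have "(\<Sum>l\<le>m. complex_of_real ((- h) ^ l) * L2_inner (A l g) f) = L2_inner (op_app (diff_op m b h) g) f"
    unfolding app by (rule L2_inner_sum_left[symmetric]) (auto intro: A f g)
  finally show ?thesis by (simp add: L2_inner_commute[of _ f])
qed

lemma op_pow_schwartz:
  "f \<in> schwartz \<Longrightarrow> op_app (op_pow (diff_op m b h) n) f \<in> schwartz"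
  by (induction n) (auto simp: op_id_def op_comp_def diff_op_schwartz)

lemma op_pow_dom:
  "n \<ge> 1 \<Longrightarrow> op_dom (op_pow (diff_op m b h) n) = schwartz"
proof (induction n)
  case (Suc n)
  have dom: "op_dom (diff_op m b h) = schwartz" by (simp add: diff_op_def)
  show ?case
  proof (cases "n = 0")
    case True
    then show ?thesis using schwartz_subset_L2 by (auto simp: op_comp_def op_id_def dom)
  next
    case False
    then have "op_dom (op_pow (diff_op m b h) n) = schwartz" using Suc.IH by simp
    then show ?thesis using op_pow_schwartz by (auto simp: op_comp_def dom)
  qed
qed simp

lemma op_pow_lincomb:
  assumes "u \<in> schwartz" "v \<in> schwartz"
  shows "op_app (op_pow (diff_op m b h) n) (\<lambda>x. c * u x + d * v x)
    = (\<lambda>x. c * op_app (op_pow (diff_op m b h) n) u x + d * op_app (op_pow (diff_op m b h) n) v x)"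
  by (induction n) (auto simp: op_id_def op_comp_def diff_op_lincomb op_pow_schwartz assms)

lemma op_pow_symmetric:
  assumes "f \<in> schwartz" "g \<in> schwartz"
  shows "L2_inner (op_app (op_pow (diff_op m b h) n) f) g = L2_inner f (op_app (op_pow (diff_op m b h) n) g)"
  using assms
proof (induction n arbitrary: g)
  case (Suc n)
  let ?L = "op_app (diff_op m b h)" and ?P = "op_app (op_pow (diff_op m b h) n)"
  have comm: "?P (?L g) = ?L (?P g)"
    by (induction n) (auto simp: op_id_def op_comp_def)
  have "L2_inner (?L (?P f)) g = L2_inner (?P f) (?L g)"
    by (intro diff_op_symmetric op_pow_schwartz Suc.prems)
  also have "\<dots> = L2_inner f (?P (?L g))"
    by (intro Suc.IH diff_op_schwartz Suc.prems)
  finally show ?case by (simp add: op_comp_def comm)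
qed (simp add: op_id_def)

text \<open>Two Schwartz functions that agree almost everywhere are equal, so an operator on the Schwartz
  space is automatically well defined on classes.\<close>
lemma symmetric_on_schwartzI:
  assumes dom: "op_dom A = schwartz"
    and app: "\<And>u. u \<in> schwartz \<Longrightarrow> op_app A u \<in> schwartz"
    and lin: "\<And>u v a b. u \<in> schwartz \<Longrightarrow> v \<in> schwartz \<Longrightarrow>
      op_app A (\<lambda>x. a * u x + b * v x) = (\<lambda>x. a * op_app A u x + b * op_app A v x)"
    and sym: "\<And>u. u \<in> schwartz \<Longrightarrow> L2_inner (op_app A u) u = L2_inner u (op_app A u)"
  shows "symmetric_on_schwartz A"
proof -
  have "linear_l2_op A"
    unfolding linear_l2_op_def dom
  proof (intro conjI ballI allI impI)
    show "schwartz \<subseteq> L2" by (rule schwartz_subset_L2)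
    show "op_app A ` schwartz \<subseteq> L2" using app schwartz_subset_L2 by blast
    show "(\<lambda>x. 0) \<in> schwartz" by (rule schwartz_zero)
    fix u v assume uv: "u \<in> schwartz" "v \<in> schwartz"
    show "(\<lambda>x. a * u x + b * v x) \<in> schwartz" for a b using uv by (rule schwartz_lincomb)
    show "AE x in lborel. op_app A (\<lambda>x. a * u x + b * v x) x = a * op_app A u x + b * op_app A v x" for a b
      using lin[OF uv] by simp
    assume "AE x in lborel. u x = v x"
    then have "u = v" by (rule schwartz_AE_eq[OF uv])
    then show "AE x in lborel. op_app A u x = op_app A v x" by simp
  qed
  then show ?thesis unfolding symmetric_on_schwartz_def using dom sym by simp
qed

lemma op_pow_symmetric_on_schwartz:
  "n \<ge> 1 \<Longrightarrow> symmetric_on_schwartz (op_pow (diff_op m b h) n)"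
  by (rule symmetric_on_schwartzI) (simp_all add: op_pow_dom op_pow_schwartz op_pow_lincomb op_pow_symmetric)

lemma op_scale_add_form:
  assumes "\<psi> \<in> schwartz" "n \<ge> 1"
  shows "L2_inner (op_app (op_scale C1 (op_add (op_pow (diff_op m b h) n) (op_scale C2 op_id))) \<psi>) \<psi>
    = complex_of_real C1 * (L2_inner (op_app (op_pow (diff_op m b h) n) \<psi>) \<psi> + complex_of_real C2 * L2_inner \<psi> \<psi>)"
proof -
  have "L2_inner (\<lambda>x. op_app (op_pow (diff_op m b h) n) \<psi> x + complex_of_real C2 * \<psi> x) \<psi>
      = L2_inner (op_app (op_pow (diff_op m b h) n) \<psi>) \<psi> + complex_of_real C2 * L2_inner \<psi> \<psi>"
    by (intro L2_inner_add_scale op_pow_schwartz assms)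
  then show ?thesis
    by (simp add: op_scale_def op_add_def op_id_def L2_inner_def mult.assoc)
qed

lemma op_scale_add_symmetric_on_schwartz:
  assumes "n \<ge> 1"
  shows "symmetric_on_schwartz (op_scale C1 (op_add (op_pow (diff_op m b h) n) (op_scale C2 op_id)))"
    (is "symmetric_on_schwartz ?A")
proof -
  let ?P = "op_app (op_pow (diff_op m b h) n)"
  have app: "op_app ?A u = (\<lambda>x. complex_of_real C1 * (?P u x + complex_of_real C2 * u x))" for u
    by (simp add: op_scale_def op_add_def op_id_def)
  show ?thesis
  proof (rule symmetric_on_schwartzI)
    show "op_dom ?A = schwartz"
      using schwartz_subset_L2 by (auto simp: op_scale_def op_add_def op_id_def op_pow_dom[OF assms])
    show "op_app ?A u \<in> schwartz" if "u \<in> schwartz" for u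
      unfolding app by (intro schwartz_scale schwartz_add op_pow_schwartz that)
    show "op_app ?A (\<lambda>x. a * u x + d * v x) = (\<lambda>x. a * op_app ?A u x + d * op_app ?A v x)"
      if "u \<in> schwartz" "v \<in> schwartz" for u v a d
      unfolding app op_pow_lincomb[OF that] by (simp add: algebra_simps)
    show "L2_inner (op_app ?A u) u = L2_inner u (op_app ?A u)" if u: "u \<in> schwartz" for u
    proof -
      have "cnj (L2_inner (?P u) u) = L2_inner (?P u) u"
        using op_pow_symmetric[OF u u] L2_inner_commute[of u "?P u"] by simp
      moreover have "cnj (L2_inner u u) = L2_inner u u" using L2_inner_commute[of u u] by simp
      ultimately have "cnj (L2_inner (op_app ?A u) u) = L2_inner (op_app ?A u) u"
        unfolding op_scale_add_form[OF u assms] by simp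
      then show ?thesis by (simp add: L2_inner_commute[of u])
    qed
  qed
qed


section \<open>Comparison of the powers\<close>

theorem theorem1p18:
  fixes mt m :: nat
    and bt b :: "nat \<Rightarrow> real \<Rightarrow> real poly"
    and \<eta>t \<eta>L c1 c2 :: real
  assumes "assumption1 mt bt \<eta>t"
    and "assumption1 m b \<eta>L"
    and "mt \<le> m"
    and "\<And>x l h. l \<le> mt \<Longrightarrow> 0 < h \<Longrightarrow> h < min \<eta>t \<eta>L \<Longrightarrow>
           \<bar>poly (bt l h) x\<bar> \<le> c1 * (poly (b l h) x + c2)"
  shows "\<forall>n::nat. n \<ge> 1 \<longrightarrow> (\<exists>C1 C2 :: real. \<forall>h. 0 < h \<and> h < min \<eta>t \<eta>L \<longrightarrow>
           op_pow (diff_op mt bt h) n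
             \<preceq>\<^sub>S op_scale C1 (op_add (op_pow (diff_op m b h) n) (op_scale C2 op_id)))"
proof (intro allI impI)
  fix n :: nat assume n: "n \<ge> 1"
  let ?\<eta> = "min \<eta>t \<eta>L"
  have \<eta>: "?\<eta> > 0" using assms(1,2) by (simp add: assumption1_def)
  obtain Mt \<alpha>t Bt \<delta>t where t: "Bt \<ge> 0" "\<delta>t > 0"
    "\<forall>l\<le>mt. \<forall>h. 0 < h \<longrightarrow> h < \<eta>t \<longrightarrow> bt l h = (\<Sum>j\<le>2 * Mt l. monom (\<alpha>t l j h) j)"
    "\<forall>l\<le>mt. \<forall>j\<le>2 * Mt l. \<forall>h. 0 < h \<longrightarrow> h < \<eta>t \<longrightarrow> \<bar>\<alpha>t l j h\<bar> \<le> Bt"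
    "\<forall>l\<le>mt. \<forall>h. 0 < h \<longrightarrow> h < \<eta>t \<longrightarrow> \<delta>t \<le> \<alpha>t l (2 * Mt l) h"
    using assumption1_coefficients[OF assms(1)] by (elim exE conjE) (rule that)
  obtain M \<alpha> B \<delta> where L: "B \<ge> 0" "\<delta> > 0"
    "\<forall>l\<le>m. \<forall>h. 0 < h \<longrightarrow> h < \<eta>L \<longrightarrow> b l h = (\<Sum>j\<le>2 * M l. monom (\<alpha> l j h) j)"
    "\<forall>l\<le>m. \<forall>j\<le>2 * M l. \<forall>h. 0 < h \<longrightarrow> h < \<eta>L \<longrightarrow> \<bar>\<alpha> l j h\<bar> \<le> B"
    "\<forall>l\<le>m. \<forall>h. 0 < h \<longrightarrow> h < \<eta>L \<longrightarrow> \<delta> \<le> \<alpha> l (2 * M l) h"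
    "\<forall>x h. 0 < h \<longrightarrow> h < \<eta>L \<longrightarrow> \<delta> \<le> poly (b m h) x"
    "\<forall>k l. k \<le> l \<longrightarrow> l \<le> m \<longrightarrow> M l \<le> M k"
    using assumption1_coefficients[OF assms(2)] by (elim exE conjE) (rule that)
  have Mt_le: "Mt l \<le> M l" if l: "l \<le> mt" for l
  proof -
    define h where "h = ?\<eta> / 2"
    have h: "0 < h" "h < ?\<eta>" using \<eta> by (auto simp: h_def)
    have h': "h < \<eta>t" "h < \<eta>L" using h by auto
    have bt: "bt l h = (\<Sum>j\<le>2 * Mt l. monom (\<alpha>t l j h) j)"
      and b: "b l h = (\<Sum>j\<le>2 * M l. monom (\<alpha> l j h) j)"
      using t(3) L(3) l assms(3) h h' by auto
    have "coeff (bt l h) (2 * Mt l) = \<alpha>t l (2 * Mt l) h"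
      unfolding bt by (simp add: coeff_sum)
    moreover have "\<alpha>t l (2 * Mt l) h > 0" using t(2,5) l h h' by (meson order_less_le_trans)
    ultimately have "2 * Mt l \<le> degree (bt l h)" by (intro le_degree) simp
    also have "\<dots> \<le> degree (b l h)"
      by (rule degree_le_if_abs_poly_le) (rule assms(4)[OF l h])
    also have "\<dots> \<le> 2 * M l"
      unfolding b by (intro degree_sum_le) (auto intro: order_trans[OF degree_monom_le])
    finally show ?thesis by simp
  qed
  obtain Cu where Cu: "Cu \<ge> 0" and upper: "\<forall>h \<psi>. 0 < h \<longrightarrow> h < ?\<eta> \<longrightarrow> \<psi> \<in> schwartz \<longrightarrow>
    norm (\<Sum>ps\<in>term_lists mt Mt n. complex_of_real (list_coeff \<alpha>t h ps) * word_form h (list_word ps) \<psi>)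
      \<le> Cu * energy h (top_weight m M n) (n * m) \<psi>"
  proof -
    have "\<exists>C\<ge>0. \<forall>h \<psi>. 0 < h \<longrightarrow> h < ?\<eta> \<longrightarrow> \<psi> \<in> schwartz \<longrightarrow>
      norm (\<Sum>ps\<in>term_lists mt Mt n. complex_of_real (list_coeff \<alpha>t h ps) * word_form h (list_word ps) \<psi>)
        \<le> C * energy h (top_weight m M n) (n * m) \<psi>"
      by (rule energy_upper[where B = Bt]) (use L(7) assms(3) Mt_le \<eta> t in auto)
    then show ?thesis by (elim exE conjE) (rule that)
  qed
  obtain c C where c: "c > 0" and C: "C \<ge> 0" and lower: "\<forall>h \<psi>. 0 < h \<longrightarrow> h < ?\<eta> \<longrightarrow> \<psi> \<in> schwartz \<longrightarrow>
    c * energy h (top_weight m M n) (n * m) \<psi> - C * wnorm h 0 \<psi>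
    \<le> Re (\<Sum>ps\<in>term_lists m M n. complex_of_real (list_coeff \<alpha> h ps) * word_form h (list_word ps) \<psi>)"
  proof -
    have top: "\<delta> \<le> (\<Sum>j\<le>2 * M m. \<alpha> m j h * x ^ j)" if "0 < h" "h < ?\<eta>" for x h
    proof -
      have "b m h = (\<Sum>j\<le>2 * M m. monom (\<alpha> m j h) j)" using L(3) that by simp
      then have "poly (b m h) x = (\<Sum>j\<le>2 * M m. \<alpha> m j h * x ^ j)"
        by (simp add: poly_sum poly_monom)
      moreover have "\<delta> \<le> poly (b m h) x" using L(6) that by simp
      ultimately show ?thesis by simp
    qed
    have "\<exists>c>0. \<exists>C\<ge>0. \<forall>h \<psi>. 0 < h \<longrightarrow> h < ?\<eta> \<longrightarrow> \<psi> \<in> schwartz \<longrightarrow>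
      c * energy h (top_weight m M n) (n * m) \<psi> - C * wnorm h 0 \<psi>
      \<le> Re (\<Sum>ps\<in>term_lists m M n. complex_of_real (list_coeff \<alpha> h ps) * word_form h (list_word ps) \<psi>)"
      by (rule energy_lower[where B = B and \<delta> = \<delta>]) (use L(1-5,7) \<eta> top in auto)
    then show ?thesis by (elim exE conjE) (rule that)
  qed
  show "\<exists>C1 C2 :: real. \<forall>h. 0 < h \<and> h < ?\<eta> \<longrightarrow> op_pow (diff_op mt bt h) n
             \<preceq>\<^sub>S op_scale C1 (op_add (op_pow (diff_op m b h) n) (op_scale C2 op_id))"
  proof (rule exI[of _ "Cu / c"], rule exI[of _ C], intro allI impI)
    fix h assume "0 < h \<and> h < ?\<eta>"
    then have h: "0 < h" "h < ?\<eta>" and h': "h < \<eta>t" "h < \<eta>L" by auto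
    show "op_pow (diff_op mt bt h) n
             \<preceq>\<^sub>S op_scale (Cu / c) (op_add (op_pow (diff_op m b h) n) (op_scale C op_id))"
      unfolding op_le_schwartz_def
    proof (intro conjI ballI)
      show "symmetric_on_schwartz (op_pow (diff_op mt bt h) n)"
        by (rule op_pow_symmetric_on_schwartz[OF n])
      show "symmetric_on_schwartz (op_scale (Cu / c) (op_add (op_pow (diff_op m b h) n) (op_scale C op_id)))"
        by (rule op_scale_add_symmetric_on_schwartz[OF n])
      fix \<psi> assume \<psi>: "\<psi> \<in> schwartz"
      let ?E = "energy h (top_weight m M n) (n * m) \<psi>"
      let ?P = "L2_inner (op_app (op_pow (diff_op m b h) n) \<psi>) \<psi>"
      let ?Pt = "L2_inner (op_app (op_pow (diff_op mt bt h) n) \<psi>) \<psi>"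
      have Pt: "?Pt = (\<Sum>ps\<in>term_lists mt Mt n. complex_of_real (list_coeff \<alpha>t h ps) * word_form h (list_word ps) \<psi>)"
        by (rule L2_inner_op_pow_diff_op[OF \<psi>]) (use h h' t(3) in auto)
      have P: "?P = (\<Sum>ps\<in>term_lists m M n. complex_of_real (list_coeff \<alpha> h ps) * word_form h (list_word ps) \<psi>)"
        by (rule L2_inner_op_pow_diff_op[OF \<psi>]) (use h h' L(3) in auto)
      have "Re ?Pt \<le> norm ?Pt" by (rule complex_Re_le_cmod)
      also have "\<dots> \<le> Cu * ?E" unfolding Pt using upper h \<psi> by blast
      also have "\<dots> = Cu / c * (c * ?E)" using c by simp
      also have "\<dots> \<le> Cu / c * (Re ?P + C * wnorm h 0 \<psi>)"
      proof (rule mult_left_mono)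
        have "c * ?E - C * wnorm h 0 \<psi> \<le> Re ?P" unfolding P using lower h \<psi> by blast
        then show "c * ?E \<le> Re ?P + C * wnorm h 0 \<psi>" by linarith
      qed (use Cu c in simp)
      also have "\<dots> = Re (L2_inner (op_app (op_scale (Cu / c)
          (op_add (op_pow (diff_op m b h) n) (op_scale C op_id))) \<psi>) \<psi>)"
        unfolding op_scale_add_form[OF \<psi> n] wnorm_0_eq by simp
      finally show "Re ?Pt \<le> Re (L2_inner (op_app (op_scale (Cu / c)
          (op_add (op_pow (diff_op m b h) n) (op_scale C op_id))) \<psi>) \<psi>)" .
    qed
  qed
qed


end
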